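(* Let $\mathcal G=(G,\mathfrak g)$ be a $\star$-reduced Lie supergroup. Then the following statements hold. (i) $\mathrm{Cone}(\mathcal G)$ is pointed. (ii) For every $\lambda\in\mathrm{Int}(\mathrm{Cone}(\mathcal G)^\star)$, the symmetric bilinear form $$\mathsf\Omega_\lambda:\mathfrak g_{\bar 1}\times\mathfrak g_{\bar 1}\to\mathbb R,\qquad \mathsf\Omega_\lambda(X,Y)=\lambda([X,Y]),$$ is positive definite. (iii) Let $\mathfrak k_{\bar 0}$ be a Lie subalgebra of $\mathfrak g_{\bar 0}$. If $\mathfrak k_{\bar 0}$ is compactly embedded in $\mathfrak g_{\bar 0}$, then $\mathfrak k_{\bar 0}$ is compactly embedded in $\mathfrak g$ as well. (iv) If $\mathfrak g_{\bar 0}=[\mathfrak g_{\bar 1},\mathfrak g_{\bar 1}]$, then $\mathfrak g_{\bar 0}$ has a Cartan subalgebra which is compactly embedded in $\mathfrak g$. (v) Assume that there exists a Cartan subalgebra $\mathfrak h_{\bar 0}$ of $\mathfrak g_{\bar 0}$ which is compactly embedded in $\mathfrak g$. Let $\mathbf p:\mathfrak g_{\bar 0}\to\mathfrak h_{\bar 0}$ be the projection corresponding to the decomposition $\mathfrak g_{\bar 0}=\mathfrak h_{\bar 0}\oplus[\mathfrak h_{\bar 0},\mathfrak g_{\bar 0}]$, and let $\mathbf p^*:\mathfrak h_{\bar 0}^*\to\mathfrak g_{\bar 0}^*$, $\mathbf p^*(\nu)=\nu\circ\mathbf p$, be the dual map. Then $$\mathrm{Int}(\mathrm{Cone}(\mathcal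 G)^\star)\cap\mathbf p^*(\mathfrak h_{\bar 0}^* )\neq\emptyset.$$
   Context: All Lie superalgebras $\mathfrak g=\mathfrak g_{\bar 0}\oplus\mathfrak g_{\bar 1}$ are finite dimensional over $\mathbb R$. Lie supergroup: a Harish-Chandra pair $\mathcal G=(G,\mathfrak g)$, i.e. $G$ is a Lie group, $\mathfrak g$ a Lie superalgebra, $\mathfrak g_{\bar 0}$ is the Lie algebra of $G$, $G$ acts smoothly on $\mathfrak g$ by automorphisms (action denoted $\mathrm{Ad}$), and the differential of this action is the adjoint action of $\mathfrak g_{\bar 0}$ on $\mathfrak g$. Unitary representation of $(G,\mathfrak g)$: a triple $(\pi,\rho^\pi,\mathscr H)$ where $\mathscr H=\mathscr H_{\bar 0}\oplus\mathscr H_{\bar 1}$ is a separable complex Hilbert space with $\mathscr H_{\bar 0}\perp\mathscr H_{\bar 1}$ closed subspaces; $\pi$ is a unitary representation of $G$ on $\mathscr H$ by grading-preserving operators; and, with $\mathscr H^\infty$ the space of smooth vectors of $\pi$, $\rho^\pi:\mathfrak g\to\mathrm{End}_{\mathbb C}(\mathscr H^\infty)$ is an $\mathbb R$-linear $\mathbb Z_2$-graded map such that: $\rho^\pi(X)=\mathsf d\pi(X)$ for $X\in\mathfrak g_{\bar 0}$; $\rho^\pi(X)\rho^\pi(Y)+\rho^\pi(Y)\rho^\pi(X)=-i\rho^\pi([X,Y])$ for $X,Y\in\mathfrak g_{\bar 1}$; $\rho^\pi(X)$ is symmetric for $X\in\mathfrak g_{\bar 1}$; and $\rho^\pi(\mathrm{Ad}(g)X)=\pi(g)\rho^\pi(X)\pi(g)^{-1}$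 for $g\in G$, $X\in\mathfrak g$. $\mathcal G$ is $\star$-reduced if for every nonzero $X\in\mathfrak g$ there is a unitary representation $(\pi,\rho^\pi,\mathscr H)$ of $\mathcal G$ with $\rho^\pi(X)\neq 0$. An invariant cone in a real Lie algebra $\mathfrak l$ is a closed convex cone invariant under the group $\mathrm{Inn}(\mathfrak l)$ generated by $e^{\mathrm{ad}(\mathfrak l)}$. $\mathrm{Cone}(\mathcal G)$ is the invariant cone in $\mathfrak g_{\bar 0}$ generated by the elements $[X,X]$, $X\in\mathfrak g_{\bar 1}$. A cone $C$ is pointed if $C\cap -C=\{0\}$. For a cone $C$ in a vector space $V$, $C^\star=\{\lambda\in V^*: \lambda(x)\ge 0\ \forall x\in C\}$, and $\mathrm{Int}$ denotes the set of interior points. Let $\mathfrak l$ be $\mathfrak g$ or $\mathfrak g_{\bar 0}$. A Lie subalgebra $\mathfrak k_{\bar 0}\subseteq\mathfrak g_{\bar 0}$ is compactly embedded in $\mathfrak l$ if the closure in $\mathrm{Aut}(\mathfrak l)$ of the subgroup generated by $e^{\mathrm{ad}(\mathfrak k_{\bar 0})}$ (acting on $\mathfrak l$) is compact. If $\mathfrak h_{\bar 0}$ is a Cartan subalgebra of $\mathfrak g_{\bar 0}$ compactly embedded in $\mathfrak g$, then $\mathfrak g_{\bar 0}=\mathfrak h_{\bar 0}\oplus[\mathfrak h_{\bar 0},\mathfrak g_{\bar 0}]$. *)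

theory Defs
  imports "HOL-Analysis.Analysis" "HOL-Algebra.Bij" "HOL-Algebra.Generated_Groups"
begin

section \<open>Smooth manifolds\<close>

text \<open>
  Model spaces are linear subspaces \<open>E\<close> of a normed space, so that dimension zero is
  included. \<open>Ck_on k E U f\<close> is meant for \<open>U\<close> relatively open in \<open>E\<close>; derivatives are
  then unique on \<open>E\<close>, and for finite-dimensional \<open>E\<close> this is the usual notion of
  being \<open>k\<close> times continuously differentiable (the target may have infinite dimension).
\<close>

primrec Ck_on :: "nat \<Rightarrow> 'e::real_normed_vector set \<Rightarrow> 'e set \<Rightarrow> ('e \<Rightarrow> 'f::real_normed_vector) \<Rightarrow> bool"
where
  "Ck_on 0 E U f \<longleftrightarrow> continuous_on U f"
| "Ck_on (Suc k) E U f \<longleftrightarrow>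
     (\<exists>f'. (\<forall>x\<in>U. (f has_derivative f' x) (at x within U)) \<and>
           (\<forall>v\<in>E. Ck_on k E U (\<lambda>x. f' x v)))"

definition smooth_on :: "'e::real_normed_vector set \<Rightarrow> 'e set \<Rightarrow> ('e \<Rightarrow> 'f::real_normed_vector) \<Rightarrow> bool"
  where "smooth_on E U f \<longleftrightarrow> (\<forall>k. Ck_on k E U f)"

record ('a, 'e) mfd =
  mtop :: "'a topology"
  model :: "'e set"
  charts :: "('a set \<times> ('a \<Rightarrow> 'e)) set"

definition smooth_manifold :: "('a, 'e::euclidean_space) mfd \<Rightarrow> bool" where
  "smooth_manifold M \<longleftrightarrow>
     Hausdorff_space (mtop M) \<and> second_countable (mtop M) \<and> subspace (model M) \<and>
     \<Union> (fst ` charts M) = topspace (mtop M) \<and>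
     (\<forall>(U, \<phi>) \<in> charts M.
        openin (mtop M) U \<and> openin (top_of_set (model M)) (\<phi> ` U) \<and>
        homeomorphic_map (subtopology (mtop M) U) (top_of_set (\<phi> ` U)) \<phi>) \<and>
     (\<forall>(U, \<phi>) \<in> charts M. \<forall>(V, \<psi>) \<in> charts M.
        smooth_on (model M) (\<phi> ` (U \<inter> V)) (\<psi> \<circ> inv_into U \<phi>))"

definition smooth_map ::
  "('a, 'e::real_normed_vector) mfd \<Rightarrow> ('b, 'f::real_normed_vector) mfd \<Rightarrow> ('a \<Rightarrow> 'b) \<Rightarrow> bool" where
  "smooth_map M N f \<longleftrightarrow>
     continuous_map (mtop M) (mtop N) f \<and>
     (\<forall>(U, \<phi>) \<in> charts M. \<forall>(V, \<psi>) \<in> charts N.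
        smooth_on (model M) (\<phi> ` (U \<inter> f -` V)) (\<psi> \<circ> f \<circ> inv_into U \<phi>))"

definition prod_mfd ::
  "('a, 'e) mfd \<Rightarrow> ('b, 'f) mfd \<Rightarrow> ('a \<times> 'b, 'e \<times> 'f) mfd" where
  "prod_mfd M N = \<lparr> mtop = prod_topology (mtop M) (mtop N), model = model M \<times> model N,
     charts = {(U \<times> V, map_prod \<phi> \<psi>) | U \<phi> V \<psi>. (U, \<phi>) \<in> charts M \<and> (V, \<psi>) \<in> charts N} \<rparr>"

definition linear_mfd :: "'e::real_normed_vector set \<Rightarrow> ('e, 'e) mfd" where
  "linear_mfd V = \<lparr> mtop = top_of_set V, model = V, charts = {(V, id)} \<rparr>"

definition smooth_functions :: "('a, 'e::real_normed_vector) mfd \<Rightarrow> ('a \<Rightarrow> real) set" where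
  "smooth_functions M =
     {f \<in> extensional (topspace (mtop M)). smooth_map M (linear_mfd UNIV) f}"


section \<open>Lie groups and their Lie algebras\<close>

definition lie_group :: "'a monoid \<Rightarrow> ('a, 'e::euclidean_space) mfd \<Rightarrow> bool" where
  "lie_group G M \<longleftrightarrow>
     group G \<and> smooth_manifold M \<and> topspace (mtop M) = carrier G \<and>
     smooth_map (prod_mfd M M) M (\<lambda>(x, y). x \<otimes>\<^bsub>G\<^esub> y) \<and>
     smooth_map M M (\<lambda>x. inv\<^bsub>G\<^esub> x)"

definition one_parameter_subgroup ::
  "'a monoid \<Rightarrow> ('a, 'e::euclidean_space) mfd \<Rightarrow> (real \<Rightarrow> 'a) \<Rightarrow> bool" where
  "one_parameter_subgroup G M c \<longleftrightarrow>
     smooth_map (linear_mfd UNIV) M c \<and> (\<forall>s t. c (s + t) = c s \<otimes>\<^bsub>G\<^esub> c t)"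

text \<open>Left-invariant vector fields, as derivations of the algebra of smooth functions.\<close>

definition left_invariant_fields ::
  "'a monoid \<Rightarrow> ('a, 'e::euclidean_space) mfd \<Rightarrow> (('a \<Rightarrow> real) \<Rightarrow> 'a \<Rightarrow> real) set" where
  "left_invariant_fields G M =
     {D \<in> smooth_functions M \<rightarrow>\<^sub>E smooth_functions M.
        (\<forall>f\<in>smooth_functions M. \<forall>h\<in>smooth_functions M. \<forall>x\<in>carrier G.
           D (\<lambda>y\<in>carrier G. f y + h y) x = D f x + D h x \<and>
           (\<forall>c. D (\<lambda>y\<in>carrier G. c * f y) x = c * D f x) \<and>
           D (\<lambda>y\<in>carrier G. f y * h y) x = D f x * h x + f x * D h x) \<and>
        (\<forall>a\<in>carrier G. \<forall>f\<in>smooth_functions M.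
           D (\<lambda>x\<in>carrier G. f (a \<otimes>\<^bsub>G\<^esub> x)) = (\<lambda>x\<in>carrier G. D f (a \<otimes>\<^bsub>G\<^esub> x)))}"

definition field_of ::
  "'a monoid \<Rightarrow> ('a, 'e::euclidean_space) mfd \<Rightarrow> ('v::real_vector \<Rightarrow> 'a) \<Rightarrow> 'v \<Rightarrow>
   ('a \<Rightarrow> real) \<Rightarrow> 'a \<Rightarrow> real" where
  "field_of G M Exp X =
     (\<lambda>f\<in>smooth_functions M. \<lambda>x\<in>carrier G. deriv (\<lambda>t. f (x \<otimes>\<^bsub>G\<^esub> Exp (t *\<^sub>R X))) 0)"

text \<open>
  \<open>(V, br)\<close> is the Lie algebra of \<open>G\<close>, with exponential map \<open>Exp\<close>: the element \<open>X\<close>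
  corresponds to the left-invariant vector field generating \<open>t \<mapsto> Exp (t X)\<close>, and this
  identifies \<open>V\<close> with the Lie algebra of all left-invariant vector fields.
  The identification determines \<open>Exp\<close> on \<open>V\<close> and conversely.
\<close>

definition is_lie_algebra_of ::
  "'a monoid \<Rightarrow> ('a, 'e::euclidean_space) mfd \<Rightarrow> 'v::real_vector set \<Rightarrow> ('v \<Rightarrow> 'v \<Rightarrow> 'v) \<Rightarrow>
   ('v \<Rightarrow> 'a) \<Rightarrow> bool" where
  "is_lie_algebra_of G M V br Exp \<longleftrightarrow>
     (\<forall>X\<in>V. one_parameter_subgroup G M (\<lambda>t. Exp (t *\<^sub>R X))) \<and>
     bij_betw (field_of G M Exp) V (left_invariant_fields G M) \<and>
     (\<forall>X\<in>V. \<forall>Y\<in>V. \<forall>f\<in>smooth_functions M. \<forall>x\<in>carrier G.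
        field_of G M Exp (X + Y) f x = field_of G M Exp X f x + field_of G M Exp Y f x \<and>
        (\<forall>c. field_of G M Exp (c *\<^sub>R X) f x = c * field_of G M Exp X f x) \<and>
        field_of G M Exp (br X Y) f x =
          field_of G M Exp X (field_of G M Exp Y f) x - field_of G M Exp Y (field_of G M Exp X f) x)"


section \<open>Lie superalgebras\<close>

text \<open>
  The homogeneous parts are linear subspaces of an ambient Euclidean space, of which only
  the linear structure and the topology are used; either part may be zero. An ordinary
  Lie algebra is a Lie superalgebra with odd part \<open>{0}\<close>.
\<close>

record 'v superalg =
  ev :: "'v set"
  od :: "'v set"
  br :: "'v \<Rightarrow> 'v \<Rightarrow> 'v"

definition space_of :: "'v::real_vector superalg \<Rightarrow> 'v set" where
  "space_of L = ev L + od L"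

definition part :: "'v superalg \<Rightarrow> nat \<Rightarrow> 'v set" where
  "part L i = (if even i then ev L else od L)"

definition lie_superalgebra :: "'v::euclidean_space superalg \<Rightarrow> bool" where
  "lie_superalgebra L \<longleftrightarrow>
     subspace (ev L) \<and> subspace (od L) \<and> ev L \<inter> od L = {0} \<and>
     (\<forall>x\<in>space_of L. \<forall>y\<in>space_of L. \<forall>z\<in>space_of L. \<forall>c.
        br L (x + y) z = br L x z + br L y z \<and> br L (c *\<^sub>R x) z = c *\<^sub>R br L x z \<and>
        br L z (x + y) = br L z x + br L z y \<and> br L z (c *\<^sub>R x) = c *\<^sub>R br L z x) \<and>
     (\<forall>i j. \<forall>x\<in>part L i. \<forall>y\<in>part L j.
        br L x y \<in> part L (i + j) \<and>
        br L x y = - ((-1) ^ (i * j) *\<^sub>R br L y x) \<and>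
        (\<forall>z\<in>space_of L. br L x (br L y z) = br L (br L x y) z + (-1) ^ (i * j) *\<^sub>R br L y (br L x z)))"

definition even_alg :: "'v::real_vector superalg \<Rightarrow> 'v superalg" where
  "even_alg L = L\<lparr>od := {0}\<rparr>"

definition brs :: "'v::real_vector superalg \<Rightarrow> 'v set \<Rightarrow> 'v set \<Rightarrow> 'v set" where
  "brs L A B = span {br L x y | x y. x \<in> A \<and> y \<in> B}"

definition lie_subalgebra :: "'v::real_vector superalg \<Rightarrow> 'v set \<Rightarrow> bool" where
  "lie_subalgebra L k \<longleftrightarrow>
     subspace k \<and> k \<subseteq> space_of L \<and> (\<forall>x\<in>k. \<forall>y\<in>k. br L x y \<in> k)"

primrec lower_central :: "'v::real_vector superalg \<Rightarrow> 'v set \<Rightarrow> nat \<Rightarrow> 'v set" where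
  "lower_central L h 0 = h"
| "lower_central L h (Suc n) = brs L h (lower_central L h n)"

definition cartan_subalgebra :: "'v::real_vector superalg \<Rightarrow> 'v set \<Rightarrow> bool" where
  "cartan_subalgebra L h \<longleftrightarrow>
     lie_subalgebra L h \<and> (\<exists>n. lower_central L h n = {0}) \<and>
     {x \<in> space_of L. \<forall>y\<in>h. br L x y \<in> h} = h"

definition superalg_aut :: "'v::real_vector superalg \<Rightarrow> ('v \<Rightarrow> 'v) set" where
  "superalg_aut L =
     {f \<in> Bij (space_of L).
        (\<forall>x\<in>space_of L. \<forall>y\<in>space_of L. \<forall>c.
           f (x + y) = f x + f y \<and> f (c *\<^sub>R x) = c *\<^sub>R f x \<and> f (br L x y) = br L (f x) (f y)) \<and>
        f ` ev L = ev L \<and> f ` od L = od L}"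

text \<open>
  The topology of pointwise convergence; on linear endomorphisms of a finite-dimensional
  space this is the usual topology.
\<close>

definition aut_topology :: "'v::euclidean_space superalg \<Rightarrow> ('v \<Rightarrow> 'v) topology" where
  "aut_topology L =
     subtopology (product_topology (\<lambda>_. euclidean) (space_of L)) (superalg_aut L)"

definition exp_ad :: "'v::euclidean_space superalg \<Rightarrow> 'v \<Rightarrow> 'v \<Rightarrow> 'v" where
  "exp_ad L X = (\<lambda>Y\<in>space_of L. \<Sum>n. (1 / fact n) *\<^sub>R (br L X ^^ n) Y)"

definition inner_group :: "'v::euclidean_space superalg \<Rightarrow> 'v set \<Rightarrow> ('v \<Rightarrow> 'v) set" where
  "inner_group L k = generate (BijGroup (space_of L)) (exp_ad L ` k)"

definition compactly_embedded :: "'v::euclidean_space superalg \<Rightarrow> 'v set \<Rightarrow> bool" where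
  "compactly_embedded L k \<longleftrightarrow>
     compactin (aut_topology L) (aut_topology L closure_of inner_group L k)"


section \<open>Cones and duals\<close>

definition invariant_cone :: "'v::euclidean_space superalg \<Rightarrow> 'v set \<Rightarrow> bool" where
  "invariant_cone L C \<longleftrightarrow>
     C \<subseteq> space_of L \<and> closed C \<and> convex_cone C \<and>
     (\<forall>f\<in>inner_group L (space_of L). f ` C \<subseteq> C)"

definition Cone :: "'v::euclidean_space superalg \<Rightarrow> 'v set" where
  "Cone L = invariant_cone (even_alg L) hull {br L X X | X. X \<in> od L}"

definition pointed :: "'v::real_vector set \<Rightarrow> bool" where
  "pointed C \<longleftrightarrow> C \<inter> uminus ` C = {0}"

definition dual_space :: "'v::real_vector set \<Rightarrow> ('v \<Rightarrow> real) set" where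
  "dual_space V =
     {l \<in> extensional V. \<forall>x\<in>V. \<forall>y\<in>V. \<forall>c. l (x + y) = l x + l y \<and> l (c *\<^sub>R x) = c * l x}"

definition dual_topology :: "'v::real_vector set \<Rightarrow> ('v \<Rightarrow> real) topology" where
  "dual_topology V = subtopology (product_topology (\<lambda>_. euclideanreal) V) (dual_space V)"

definition dual_cone :: "'v::real_vector set \<Rightarrow> 'v set \<Rightarrow> ('v \<Rightarrow> real) set" where
  "dual_cone V C = {l \<in> dual_space V. \<forall>x\<in>C. 0 \<le> l x}"

definition Int_Cone_dual :: "'v::euclidean_space superalg \<Rightarrow> ('v \<Rightarrow> real) set" where
  "Int_Cone_dual L = dual_topology (ev L) interior_of dual_cone (ev L) (Cone L)"

definition Omega :: "'v superalg \<Rightarrow> ('v \<Rightarrow> real) \<Rightarrow> 'v \<Rightarrow> 'v \<Rightarrow> real" where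
  "Omega L l X Y = l (br L X Y)"

definition symmetric_bilinear_form_on :: "'v::real_vector set \<Rightarrow> ('v \<Rightarrow> 'v \<Rightarrow> real) \<Rightarrow> bool" where
  "symmetric_bilinear_form_on V B \<longleftrightarrow>
     (\<forall>x\<in>V. \<forall>y\<in>V. \<forall>z\<in>V. \<forall>c.
        B x y = B y x \<and> B (x + y) z = B x z + B y z \<and> B (c *\<^sub>R x) z = c * B x z)"

definition positive_definite_on :: "'v::real_vector set \<Rightarrow> ('v \<Rightarrow> 'v \<Rightarrow> real) \<Rightarrow> bool" where
  "positive_definite_on V B \<longleftrightarrow> (\<forall>x\<in>V. x \<noteq> 0 \<longrightarrow> 0 < B x x)"

definition projection :: "'v::real_vector set \<Rightarrow> 'v set \<Rightarrow> 'v \<Rightarrow> 'v" where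
  "projection A B x = (THE a. a \<in> A \<and> x - a \<in> B)"

definition dual_map :: "'v set \<Rightarrow> ('v \<Rightarrow> 'w) \<Rightarrow> ('w \<Rightarrow> real) \<Rightarrow> 'v \<Rightarrow> real" where
  "dual_map V p l = restrict (l \<circ> p) V"


section \<open>Lie supergroups\<close>

record ('a, 'e, 'v) supergroup =
  grp :: "'a monoid"
  mfd :: "('a, 'e) mfd"
  alg :: "'v superalg"
  Exp :: "'v \<Rightarrow> 'a"
  Ad :: "'a \<Rightarrow> 'v \<Rightarrow> 'v"

definition lie_supergroup :: "('a, 'e::euclidean_space, 'v::euclidean_space) supergroup \<Rightarrow> bool" where
  "lie_supergroup S \<longleftrightarrow>
     lie_group (grp S) (mfd S) \<and> lie_superalgebra (alg S) \<and>
     is_lie_algebra_of (grp S) (mfd S) (ev (alg S)) (br (alg S)) (Exp S) \<and>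
     smooth_map (prod_mfd (mfd S) (linear_mfd (space_of (alg S)))) (linear_mfd (space_of (alg S)))
       (\<lambda>(g, X). Ad S g X) \<and>
     (\<forall>g\<in>carrier (grp S). restrict (Ad S g) (space_of (alg S)) \<in> superalg_aut (alg S)) \<and>
     (\<forall>g\<in>carrier (grp S). \<forall>h\<in>carrier (grp S). \<forall>X\<in>space_of (alg S).
        Ad S (g \<otimes>\<^bsub>grp S\<^esub> h) X = Ad S g (Ad S h X)) \<and>
     (\<forall>X\<in>ev (alg S). \<forall>Y\<in>space_of (alg S).
        ((\<lambda>t. Ad S (Exp S (t *\<^sub>R X)) Y) has_vector_derivative br (alg S) X Y) (at 0))"


section \<open>Complex inner product spaces\<close>

class complex_inner = real_inner +
  fixes scaleC :: "complex \<Rightarrow> 'a \<Rightarrow> 'a" (infixr "*\<^sub>C" 75)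
    and cinner :: "'a \<Rightarrow> 'a \<Rightarrow> complex"
  assumes scaleC_add_right: "a *\<^sub>C (x + y) = a *\<^sub>C x + a *\<^sub>C y"
    and scaleC_add_left: "(a + b) *\<^sub>C x = a *\<^sub>C x + b *\<^sub>C x"
    and scaleC_scaleC: "a *\<^sub>C (b *\<^sub>C x) = (a * b) *\<^sub>C x"
    and scaleC_of_real: "of_real r *\<^sub>C x = r *\<^sub>R x"
    and cinner_add_left: "cinner (x + y) z = cinner x z + cinner y z"
    and cinner_scaleC_left: "cinner (a *\<^sub>C x) y = a * cinner x y"
    and cinner_commute: "cinner x y = cnj (cinner y x)"
    and Re_cinner: "Re (cinner x y) = inner x y"

definition csubspace :: "'h::complex_inner set \<Rightarrow> bool" where
  "csubspace H \<longleftrightarrow> subspace H \<and> (\<forall>a. \<forall>x\<in>H. a *\<^sub>C x \<in> H)"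

definition clinear_on :: "'h::complex_inner set \<Rightarrow> ('h \<Rightarrow> 'h) \<Rightarrow> bool" where
  "clinear_on H f \<longleftrightarrow>
     (\<forall>x\<in>H. \<forall>y\<in>H. \<forall>a. f (x + y) = f x + f y \<and> f (a *\<^sub>C x) = a *\<^sub>C f x)"


section \<open>The sequence space of square-summable sequences\<close>

typedef ell2 = "{x :: nat \<Rightarrow> complex. summable (\<lambda>n. (cmod (x n))\<^sup>2)}"
  by (rule exI[of _ "\<lambda>_. 0"]) simp

lemma ell2_summable: "summable (\<lambda>n. (cmod (Rep_ell2 x n))\<^sup>2)"
  using Rep_ell2[of x] by simp

lemma square_summable_add:
  fixes x y :: "nat \<Rightarrow> complex"
  assumes "summable (\<lambda>n. (cmod (x n))\<^sup>2)" "summable (\<lambda>n. (cmod (y n))\<^sup>2)"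
  shows "summable (\<lambda>n. (cmod (x n + y n))\<^sup>2)"
proof (rule summable_comparison_test')
  show "summable (\<lambda>n. 2 * (cmod (x n))\<^sup>2 + 2 * (cmod (y n))\<^sup>2)"
    using assms by (intro summable_add summable_mult)
  fix n
  have "(cmod (x n + y n))\<^sup>2 \<le> (cmod (x n) + cmod (y n))\<^sup>2"
    by (intro power_mono norm_triangle_ineq norm_ge_zero)
  also have "\<dots> \<le> 2 * (cmod (x n))\<^sup>2 + 2 * (cmod (y n))\<^sup>2"
    using zero_le_power2[of "cmod (x n) - cmod (y n)"]
    by (simp add: power2_eq_square algebra_simps)
  finally show "norm ((cmod (x n + y n))\<^sup>2) \<le> 2 * (cmod (x n))\<^sup>2 + 2 * (cmod (y n))\<^sup>2"
    by simp
qed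

lemma square_summable_mult:
  fixes x :: "nat \<Rightarrow> complex"
  assumes "summable (\<lambda>n. (cmod (x n))\<^sup>2)"
  shows "summable (\<lambda>n. (cmod (a * x n))\<^sup>2)"
  using assms by (simp add: norm_mult power_mult_distrib summable_mult)

lemma ell2_cinner_summable: "summable (\<lambda>n. Rep_ell2 x n * cnj (Rep_ell2 y n))"
proof (rule summable_norm_cancel, rule summable_comparison_test')
  show "summable (\<lambda>n. (cmod (Rep_ell2 x n))\<^sup>2 + (cmod (Rep_ell2 y n))\<^sup>2)"
    by (intro summable_add ell2_summable)
  fix n
  have "2 * (cmod (Rep_ell2 x n) * cmod (Rep_ell2 y n)) \<le> (cmod (Rep_ell2 x n))\<^sup>2 + (cmod (Rep_ell2 y n))\<^sup>2"
    using zero_le_power2[of "cmod (Rep_ell2 x n) - cmod (Rep_ell2 y n)"]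
    by (simp add: power2_eq_square algebra_simps)
  moreover have "0 \<le> cmod (Rep_ell2 x n) * cmod (Rep_ell2 y n)" by simp
  ultimately show "norm (norm (Rep_ell2 x n * cnj (Rep_ell2 y n)))
      \<le> (cmod (Rep_ell2 x n))\<^sup>2 + (cmod (Rep_ell2 y n))\<^sup>2"
    unfolding norm_mult complex_mod_cnj real_norm_def abs_mult abs_norm_cancel by linarith
qed

instantiation ell2 :: complex_inner
begin

definition "0 = Abs_ell2 (\<lambda>_. 0)"
definition "x + y = Abs_ell2 (\<lambda>n. Rep_ell2 x n + Rep_ell2 y n)"
definition "- x = Abs_ell2 (\<lambda>n. - Rep_ell2 x n)"
definition "(x::ell2) - y = x + (- y)"
definition "a *\<^sub>C x = Abs_ell2 (\<lambda>n. a * Rep_ell2 x n)"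
definition "r *\<^sub>R (x::ell2) = complex_of_real r *\<^sub>C x"
definition "cinner x y = (\<Sum>n. Rep_ell2 x n * cnj (Rep_ell2 y n))"
definition "inner x (y::ell2) = Re (cinner x y)"
definition "norm (x::ell2) = sqrt (inner x x)"
definition "dist x (y::ell2) = norm (x - y)"
definition "sgn (x::ell2) = inverse (norm x) *\<^sub>R x"
definition "(uniformity :: (ell2 \<times> ell2) filter) = (INF e\<in>{0 <..}. principal {(x, y). dist x y < e})"
definition "open (U :: ell2 set) = (\<forall>x\<in>U. \<forall>\<^sub>F (x', y) in uniformity. x' = x \<longrightarrow> y \<in> U)"

lemma Rep_ell2_zero: "Rep_ell2 0 n = 0"
  by (simp add: zero_ell2_def Abs_ell2_inverse)

lemma Rep_ell2_add: "Rep_ell2 (x + y) n = Rep_ell2 x n + Rep_ell2 y n"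
  by (simp add: plus_ell2_def Abs_ell2_inverse square_summable_add ell2_summable)

lemma Rep_ell2_scaleC: "Rep_ell2 (a *\<^sub>C x) n = a * Rep_ell2 x n"
  by (simp add: scaleC_ell2_def Abs_ell2_inverse square_summable_mult ell2_summable)

lemma Rep_ell2_uminus: "Rep_ell2 (- x) n = - Rep_ell2 x n"
  by (simp add: uminus_ell2_def Abs_ell2_inverse ell2_summable)

lemma ell2_eqI: "(\<And>n. Rep_ell2 x n = Rep_ell2 y n) \<Longrightarrow> x = y"
  by (metis Rep_ell2_inject ext)

instance
proof
  fix x y z :: ell2 and a b :: complex and r s :: real
  note rep = Rep_ell2_zero Rep_ell2_add Rep_ell2_scaleC Rep_ell2_uminus minus_ell2_def scaleR_ell2_def
  show "x + y + z = x + (y + z)" by (rule ell2_eqI) (simp add: rep)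
  show "x + y = y + x" by (rule ell2_eqI) (simp add: rep)
  show "0 + x = x" by (rule ell2_eqI) (simp add: rep)
  show "- x + x = 0" by (rule ell2_eqI) (simp add: rep)
  show "x - y = x + - y" by (simp add: minus_ell2_def)
  show "r *\<^sub>R (x + y) = r *\<^sub>R x + r *\<^sub>R y" by (rule ell2_eqI) (simp add: rep algebra_simps)
  show "(r + s) *\<^sub>R x = r *\<^sub>R x + s *\<^sub>R x" by (rule ell2_eqI) (simp add: rep algebra_simps)
  show "r *\<^sub>R s *\<^sub>R x = (r * s) *\<^sub>R x" by (rule ell2_eqI) (simp add: rep)
  show "1 *\<^sub>R x = x" by (rule ell2_eqI) (simp add: rep)
  show "a *\<^sub>C (x + y) = a *\<^sub>C x + a *\<^sub>C y" by (rule ell2_eqI) (simp add: rep algebra_simps)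
  show "(a + b) *\<^sub>C x = a *\<^sub>C x + b *\<^sub>C x" by (rule ell2_eqI) (simp add: rep algebra_simps)
  show "a *\<^sub>C b *\<^sub>C x = (a * b) *\<^sub>C x" by (rule ell2_eqI) (simp add: rep)
  show "complex_of_real r *\<^sub>C x = r *\<^sub>R x" by (simp add: scaleR_ell2_def)
  show add: "cinner (x + y) z = cinner x z + cinner y z" for x y z :: ell2
    by (simp add: cinner_ell2_def rep distrib_right suminf_add[symmetric] ell2_cinner_summable)
  show scl: "cinner (a *\<^sub>C x) y = a * cinner x y" for a and x y :: ell2
    by (simp add: cinner_ell2_def rep mult.assoc suminf_mult ell2_cinner_summable)
  show com: "cinner x y = cnj (cinner y x)" for x y :: ell2
  proof -
    have "(\<lambda>n. cnj (Rep_ell2 y n * cnj (Rep_ell2 x n))) sums cnj (cinner y x)"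
      unfolding cinner_ell2_def sums_cnj by (rule summable_sums[OF ell2_cinner_summable])
    then show ?thesis by (simp add: cinner_ell2_def sums_iff mult.commute)
  qed
  show "Re (cinner x y) = inner x y" by (simp add: inner_ell2_def)
  show "dist x y = norm (x - y)" by (rule dist_ell2_def)
  show "sgn x = inverse (norm x) *\<^sub>R x" by (rule sgn_ell2_def)
  show "uniformity = (INF e\<in>{0 <..}. principal {(x, y :: ell2). dist x y < e})"
    by (rule uniformity_ell2_def)
  show "open U = (\<forall>x\<in>U. \<forall>\<^sub>F (x', y) in uniformity. x' = x \<longrightarrow> y \<in> U)" for U :: "ell2 set"
    by (rule open_ell2_def)
  show "inner x y = inner y x" unfolding inner_ell2_def by (subst com) simp
  show "inner (x + y) z = inner x z + inner y z" by (simp add: inner_ell2_def add)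
  show "inner (r *\<^sub>R x) y = r * inner x y" by (simp add: inner_ell2_def scaleR_ell2_def scl)
  have sq: "inner x x = (\<Sum>n. (cmod (Rep_ell2 x n))\<^sup>2)"
  proof -
    have "inner x x = (\<Sum>n. Re (Rep_ell2 x n * cnj (Rep_ell2 x n)))"
      unfolding inner_ell2_def cinner_ell2_def by (rule Re_suminf[OF ell2_cinner_summable])
    then show ?thesis by (simp add: complex_mult_cnj cmod_power2)
  qed
  show "0 \<le> inner x x" unfolding sq by (intro suminf_nonneg ell2_summable) simp
  show "inner x x = 0 \<longleftrightarrow> x = 0"
  proof
    assume "inner x x = 0"
    then have "\<forall>n. (cmod (Rep_ell2 x n))\<^sup>2 = 0"
      unfolding sq by (subst (asm) suminf_eq_zero_iff) (auto simp: ell2_summable)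
    then show "x = 0" by (intro ell2_eqI) (simp add: Rep_ell2_zero)
  next
    assume "x = 0" then show "inner x x = 0" unfolding sq by (simp add: Rep_ell2_zero)
  qed
  show "norm x = sqrt (inner x x)" by (rule norm_ell2_def)
qed

end


section \<open>Unitary representations\<close>

definition unitary_group_rep ::
  "'a monoid \<Rightarrow> ('a, 'e::euclidean_space) mfd \<Rightarrow> 'h::complex_inner set \<Rightarrow> ('a \<Rightarrow> 'h \<Rightarrow> 'h) \<Rightarrow> bool" where
  "unitary_group_rep G M H \<pi> \<longleftrightarrow>
     (\<forall>g\<in>carrier G. bij_betw (\<pi> g) H H \<and> clinear_on H (\<pi> g) \<and>
        (\<forall>v\<in>H. \<forall>w\<in>H. cinner (\<pi> g v) (\<pi> g w) = cinner v w)) \<and>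
     (\<forall>g\<in>carrier G. \<forall>h\<in>carrier G. \<forall>v\<in>H. \<pi> (g \<otimes>\<^bsub>G\<^esub> h) v = \<pi> g (\<pi> h v)) \<and>
     (\<forall>v\<in>H. continuous_map (mtop M) euclidean (\<lambda>g. \<pi> g v))"

definition smooth_vectors ::
  "('a, 'e::euclidean_space) mfd \<Rightarrow> 'h::complex_inner set \<Rightarrow> ('a \<Rightarrow> 'h \<Rightarrow> 'h) \<Rightarrow> 'h set" where
  "smooth_vectors M H \<pi> = {v \<in> H. smooth_map M (linear_mfd H) (\<lambda>g. \<pi> g v)}"

text \<open>The Hilbert space is the orthogonal sum of its homogeneous parts \<open>H0\<close> and \<open>H1\<close>.\<close>

definition unitary_rep ::
  "('a, 'e::euclidean_space, 'v::euclidean_space) supergroup \<Rightarrow> 'h::complex_inner set \<Rightarrow> 'h set \<Rightarrow>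
   ('a \<Rightarrow> 'h \<Rightarrow> 'h) \<Rightarrow> ('v \<Rightarrow> 'h \<Rightarrow> 'h) \<Rightarrow> bool" where
  "unitary_rep S H0 H1 \<pi> \<rho> \<longleftrightarrow>
     (let H = H0 + H1; Hs = smooth_vectors (mfd S) H \<pi>; L = alg S in
     csubspace H0 \<and> csubspace H1 \<and> complete H0 \<and> complete H1 \<and>
     (\<forall>v\<in>H0. \<forall>w\<in>H1. cinner v w = 0) \<and>
     (\<exists>D. countable D \<and> D \<subseteq> H \<and> H \<subseteq> closure D) \<and>
     unitary_group_rep (grp S) (mfd S) H \<pi> \<and>
     (\<forall>g\<in>carrier (grp S). \<pi> g ` H0 \<subseteq> H0 \<and> \<pi> g ` H1 \<subseteq> H1) \<and>
     (\<forall>X\<in>space_of L. \<rho> X ` Hs \<subseteq> Hs \<and> clinear_on Hs (\<rho> X)) \<and>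
     (\<forall>X\<in>space_of L. \<forall>Y\<in>space_of L. \<forall>c. \<forall>v\<in>Hs.
        \<rho> (X + Y) v = \<rho> X v + \<rho> Y v \<and> \<rho> (c *\<^sub>R X) v = c *\<^sub>R \<rho> X v) \<and>
     (\<forall>X\<in>ev L. \<rho> X ` (Hs \<inter> H0) \<subseteq> H0 \<and> \<rho> X ` (Hs \<inter> H1) \<subseteq> H1) \<and>
     (\<forall>X\<in>od L. \<rho> X ` (Hs \<inter> H0) \<subseteq> H1 \<and> \<rho> X ` (Hs \<inter> H1) \<subseteq> H0) \<and>
     (\<forall>X\<in>ev L. \<forall>v\<in>Hs. ((\<lambda>t. \<pi> (Exp S (t *\<^sub>R X)) v) has_vector_derivative \<rho> X v) (at 0)) \<and>
     (\<forall>X\<in>od L. \<forall>Y\<in>od L. \<forall>v\<in>Hs.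
        \<rho> X (\<rho> Y v) + \<rho> Y (\<rho> X v) = (- \<i>) *\<^sub>C \<rho> (br L X Y) v) \<and>
     (\<forall>X\<in>od L. \<forall>v\<in>Hs. \<forall>w\<in>Hs. cinner (\<rho> X v) w = cinner v (\<rho> X w)) \<and>
     (\<forall>g\<in>carrier (grp S). \<forall>X\<in>space_of L. \<forall>v\<in>Hs.
        \<rho> (Ad S g X) v = \<pi> g (\<rho> X (\<pi> (inv\<^bsub>grp S\<^esub> g) v))))"

text \<open>
  Every separable complex Hilbert space is isometric to a closed subspace of \<open>ell2\<close>, so
  representations on subspaces of \<open>ell2\<close> suffice.
\<close>

definition star_reduced :: "('a, 'e::euclidean_space, 'v::euclidean_space) supergroup \<Rightarrow> bool" where
  "star_reduced S \<longleftrightarrow>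
     (\<forall>X\<in>space_of (alg S). X \<noteq> 0 \<longrightarrow>
        (\<exists>(H0 :: ell2 set) H1 \<pi> \<rho>. unitary_rep S H0 H1 \<pi> \<rho> \<and>
           (\<exists>v\<in>smooth_vectors (mfd S) (H0 + H1) \<pi>. \<rho> X v \<noteq> 0)))"

end

theory Submission
  imports Defs
begin

text \<open>
  In a unitary representation \<open>-i \<rho>([X,X]) = 2 \<rho>(X)\<^sup>2 \<ge> 0\<close> for odd \<open>X\<close>. The squares \<open>[X,X]\<close> are permuted
  by the adjoint action, so already their closed convex conical hull is invariant, and
  \<open>-i \<rho>(Y) \<ge> 0\<close> for every \<open>Y\<close> in the cone; if also \<open>-Y\<close> lies in the cone, then \<open>\<rho>(Y) = 0\<close>. Hence
  the cone is pointed and has a functional that is strictly positive on it.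

  A group of inner automorphisms with bounded orbits on the even part fixes a point in the closed
  convex hull of each orbit, on the even part and on its dual. It therefore fixes a functional in
  the interior of the dual cone, and \<open>\<Omega>\<close> of this functional is an invariant inner product on the
  odd part. The stabilizer of an interior point \<open>x\<close> of the cone is bounded because it preserves the
  order interval \<open>[-x, x]\<close>; if \<open>x\<close> has minimal centralizer, this centralizer is an abelian Cartan
  subalgebra. Finally, a functional invariant under a compactly embedded Cartan subalgebra \<open>h\<close>
  annihilates the brackets of \<open>h\<close> with the even part, so it factors through the projection onto \<open>h\<close>.
\<close>

section \<open>Linear algebra and convexity\<close>

text \<open>Compact embedding enters only through bounded orbits. Going back from bounded orbits to
  compactness needs limits of automorphisms to stay invertible; they do, because a uniform bound on
  a group, applied to inverses, is a uniform lower bound. Since exp(ad X) = Ad(Exp X), the inner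
  groups acting on the even part and on the whole algebra are images of one subgroup
  \<open>exp_group k\<close> of the Lie group, so bounds on the two parts can be compared element by
  element. Fixed points come from minimizing a norm instead of integrating over a compact closure.
  This also covers the non-invertible extensions of the action to the ambient space, and their
  adjoints. The representation that detects an element depends on that element, so unitarity yields
  two facts about single elements: pointedness, and [X,X] \<noteq> 0 for odd X \<noteq> 0. The rest
  is convex geometry of the cone, which has interior points in the even part once the odd brackets
  span it. In place of semisimplicity of ad X stands the remark that a bounded orbit of the form Y +
  t [X,Y] forces [X,Y] = 0.\<close>

definition lin_on :: "'v::real_vector set \<Rightarrow> ('v \<Rightarrow> 'w::real_vector) \<Rightarrow> bool" where
  "lin_on V f \<longleftrightarrow> (\<forall>x\<in>V. \<forall>y\<in>V. \<forall>c. f (x + y) = f x + f y \<and> f (c *\<^sub>R x) = c *\<^sub>R f x)"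

lemma lin_on_add: "lin_on V f \<Longrightarrow> x \<in> V \<Longrightarrow> y \<in> V \<Longrightarrow> f (x + y) = f x + f y"
  and lin_on_scaleR: "lin_on V f \<Longrightarrow> x \<in> V \<Longrightarrow> f (c *\<^sub>R x) = c *\<^sub>R f x"
  by (auto simp: lin_on_def)

lemma lin_on_subset: "lin_on V f \<Longrightarrow> W \<subseteq> V \<Longrightarrow> lin_on W f"
  by (auto simp: lin_on_def)

lemma lin_on_diff:
  assumes "lin_on V f" "subspace V" "x \<in> V" "y \<in> V"
  shows "f (x - y) = f x - f y"
  using lin_on_add[OF assms(1), of x "(-1) *\<^sub>R y"] lin_on_scaleR[OF assms(1), of y "-1"] assms
  by (simp add: subspace_neg)

lemma subspace_projection:
  fixes V :: "'v::euclidean_space set"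
  assumes "subspace V"
  obtains P where "linear P" "\<And>x. P x \<in> V" "\<And>x. x \<in> V \<Longrightarrow> P x = x"
  using linear_exists_left_inverse_on[of id V] assms linear_id by (auto simp: image_subset_iff)

text \<open>Maps such as \<open>Ad S g\<close> are specified only on a subspace. Precomposition with
  a projection onto it gives maps of the ambient space, to which the theory of \<open>linear\<close>
  applies.\<close>

lemma lin_on_projection:
  assumes "lin_on V f" "linear P" "\<And>x. P x \<in> V"
  shows "linear (f \<circ> P)"
  using assms by (intro linearI) (auto simp: linear_add linear_scale lin_on_add lin_on_scaleR)

text \<open>Uniform boundedness without a category argument: bounds at the finitely many vectors
  \<open>P b\<close> control all of \<open>V\<close>.\<close>

lemma pointwise_bounded_imp_uniformly_bounded:
  fixes V :: "'v::euclidean_space set" and F :: "('v \<Rightarrow> 'w::real_normed_vector) set"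
  assumes V: "subspace V" and lin: "\<And>f. f \<in> F \<Longrightarrow> lin_on V f"
    and bdd: "\<And>x. x \<in> V \<Longrightarrow> bounded ((\<lambda>f. f x) ` F)"
  obtains B where "B > 0" "\<And>f x. f \<in> F \<Longrightarrow> x \<in> V \<Longrightarrow> norm (f x) \<le> B * norm x"
proof -
  obtain P where P: "linear P" "\<And>x. P x \<in> V" "\<And>x. x \<in> V \<Longrightarrow> P x = x"
    using subspace_projection[OF V] by metis
  have "\<forall>b. \<exists>M. \<forall>f\<in>F. norm (f (P b)) \<le> M"
    using bdd[OF P(2)] by (simp add: bounded_iff)
  then obtain M where M: "\<And>b f. f \<in> F \<Longrightarrow> norm (f (P b)) \<le> M b"
    by metis
  \<comment> \<open>The summand 1 keeps \<open>B\<close> positive when every \<open>M b\<close> is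
    0.\<close>
  define B where "B = 1 + (\<Sum>b\<in>Basis. \<bar>M b\<bar>)"
  show thesis
  proof
    show "B > 0"
      by (simp add: B_def add_pos_nonneg sum_nonneg)
    fix f x assume f: "f \<in> F" and x: "x \<in> V"
    have lf: "linear (f \<circ> P)"
      using lin_on_projection[OF lin[OF f] P(1,2)] .
    have "f x = (f \<circ> P) (\<Sum>b\<in>Basis. (x \<bullet> b) *\<^sub>R b)"
      by (simp add: P x euclidean_representation)
    also have "\<dots> = (\<Sum>b\<in>Basis. (x \<bullet> b) *\<^sub>R f (P b))"
      by (simp only: linear_sum[OF lf] linear_scale[OF lf]) simp
    finally have "norm (f x) \<le> (\<Sum>b\<in>Basis. norm ((x \<bullet> b) *\<^sub>R f (P b)))"
      using norm_sum by metis
    also have "\<dots> \<le> (\<Sum>b\<in>Basis. norm x * \<bar>M b\<bar>)"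
    proof (intro sum_mono)
      fix b :: 'v assume "b \<in> Basis"
      then have "\<bar>x \<bullet> b\<bar> \<le> norm x" by (rule Basis_le_norm)
      moreover have "norm (f (P b)) \<le> \<bar>M b\<bar>" using M[OF f, of b] by linarith
      ultimately show "norm ((x \<bullet> b) *\<^sub>R f (P b)) \<le> norm x * \<bar>M b\<bar>"
        by (simp add: mult_mono)
    qed
    also have "\<dots> \<le> B * norm x"
      by (simp add: B_def algebra_simps flip: sum_distrib_left)
    finally show "norm (f x) \<le> B * norm x" .
  qed
qed

text \<open>
  The supremum of the norm over an orbit is an invariant seminorm which, being a supremum of
  Hilbert norms that are uniformly comparable, attains its minimum on \<open>Q\<close> only once.
\<close>

lemma bounded_semigroup_fixed_point:
  fixes T :: "('e::euclidean_space \<Rightarrow> 'e) set"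
  assumes lin: "\<And>f. f \<in> T \<Longrightarrow> linear f"
    and comp: "\<And>f g. f \<in> T \<Longrightarrow> g \<in> T \<Longrightarrow> f \<circ> g \<in> T"
    and upper: "\<And>f x. f \<in> T \<Longrightarrow> norm (f x) \<le> B * norm x"
    and lower: "\<And>f x y. f \<in> T \<Longrightarrow> x \<in> Q \<Longrightarrow> y \<in> Q \<Longrightarrow> norm (x - y) \<le> B * norm (f (x - y))"
    and Q: "compact Q" "convex Q" "Q \<noteq> {}"
    and inv: "\<And>f x. f \<in> T \<Longrightarrow> x \<in> Q \<Longrightarrow> f x \<in> Q"
  shows "\<exists>q\<in>Q. \<forall>f\<in>T. f q = q"
proof (cases "T = {}")
  case True
  then show ?thesis using Q by auto
next
  case False
  define N where "N x = (SUP f\<in>T. norm (f x))" for x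
  have bdd: "bdd_above ((\<lambda>f. norm (f x)) ` T)" for x
    using upper by (auto intro!: bdd_aboveI2)
  have le_N: "norm (f x) \<le> N x" if "f \<in> T" for f x
    unfolding N_def by (rule cSUP_upper[OF that bdd])
  have N_le: "N x \<le> c" if "\<And>f. f \<in> T \<Longrightarrow> norm (f x) \<le> c" for x c
    unfolding N_def by (rule cSUP_least[OF False that])
  have lip: "N x \<le> N y + \<bar>B\<bar> * norm (x - y)" for x y
  proof (rule N_le)
    fix f assume f: "f \<in> T"
    have "f x = f y + f (x - y)" using lin[OF f] by (simp add: linear_diff)
    then have "norm (f x) \<le> norm (f y) + norm (f (x - y))" by (metis norm_triangle_ineq)
    moreover have "B * norm (x - y) \<le> \<bar>B\<bar> * norm (x - y)" by (simp add: mult_right_mono)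
    ultimately show "norm (f x) \<le> N y + \<bar>B\<bar> * norm (x - y)"
      using le_N[OF f, of y] upper[OF f, of "x - y"] by linarith
  qed
  have "\<bar>B\<bar>-lipschitz_on Q N"
  proof (rule lipschitz_onI)
    show "dist (N x) (N y) \<le> \<bar>B\<bar> * dist x y" for x y
      using lip[of x y] lip[of y x] by (auto simp: dist_norm norm_minus_commute abs_le_iff)
  qed simp
  then obtain p where p: "p \<in> Q" "\<And>y. y \<in> Q \<Longrightarrow> N p \<le> N y"
    using continuous_attains_inf[OF Q(1,3), of N] lipschitz_on_continuous_on by blast
  have "f p = p" if f: "f \<in> T" for f
  proof (rule ccontr)
    assume "f p \<noteq> p"
    define q where "q = f p"
    \<comment> \<open>For g in \<open>T\<close>, g q = (g o f) p is again a point of the orbit of p,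
      whence N q \<le> N p.\<close>
    have q: "q \<in> Q" and ne: "q \<noteq> p" and Nq: "N q \<le> N p"
      using inv[OF f p(1)] \<open>f p \<noteq> p\<close> le_N[OF comp[OF _ f], of _ p]
      by (auto simp: q_def intro!: N_le)
    define mid where "mid = (1/2) *\<^sub>R p + (1/2) *\<^sub>R q"
    have mid: "mid \<in> Q"
      unfolding mid_def using Q(2) p(1) q by (intro convexD) auto
    have "0 < norm (p - q)" using ne by auto
    then have "0 < B * norm (f (p - q))"
      using lower[OF f p(1) q] by linarith
    then have "0 < B"
      by (auto simp: zero_less_mult_iff)
    \<comment> \<open>By \<open>lower\<close>, \<open>e\<close> bounds the squared distance of g p
      and g q from below for all g at once. The parallelogram law then pushes the squared norm of g
      mid at least e/4 below N(p)^2; as this is uniform in g, the supremum \<open>N mid\<close>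
      drops too.\<close>
    define e where "e = (norm (p - q) / B)\<^sup>2"
    define d where "d = e / 4"
    have d: "d > 0" using \<open>0 < B\<close> \<open>0 < norm (p - q)\<close> by (simp add: d_def e_def)
    have "0 \<le> N p" using le_N[OF f, of p] norm_ge_zero order_trans by blast
    have convexity_arith: "m \<le> n - e / 4"
      if "m = (a + b) / 2 - c / 4" "a \<le> n" "b \<le> n" "e \<le> c" for a b c m n :: real
    proof -
      have "4 * m = 2 * a + 2 * b - c" unfolding that(1) by simp
      then have "4 * m \<le> 4 * n - e" using that(2-4) by linarith
      then show ?thesis by simp
    qed
    have mid_le: "(norm (g mid))\<^sup>2 \<le> (N p)\<^sup>2 - d" if g: "g \<in> T" for g
    proof -
      have lg: "linear g" using lin[OF g] .
      have "g mid = (1/2) *\<^sub>R (g p + g q)"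
        by (simp add: mid_def linear_add[OF lg] linear_scale[OF lg] scaleR_add_right)
      then have "(norm (g mid))\<^sup>2 = ((norm (g p))\<^sup>2 + (norm (g q))\<^sup>2) / 2 - (norm (g p - g q))\<^sup>2 / 4"
        by (simp add: power2_norm_eq_inner inner_add_left inner_add_right inner_diff_left
              inner_diff_right inner_commute field_simps)
      moreover have "(norm (g p))\<^sup>2 \<le> (N p)\<^sup>2" "(norm (g q))\<^sup>2 \<le> (N p)\<^sup>2"
        using le_N[OF g, of p] le_N[OF g, of q] Nq by (auto intro!: power_mono)
      moreover have "norm (p - q) / B \<le> norm (g p - g q)"
        using lower[OF g p(1) q] \<open>0 < B\<close> by (simp add: linear_diff[OF lg] field_simps)
      then have "e \<le> (norm (g p - g q))\<^sup>2"
        unfolding e_def using \<open>0 < B\<close> by (intro power_mono) auto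
      ultimately show ?thesis
        unfolding d_def by (rule convexity_arith)
    qed
    have "N mid \<le> sqrt ((N p)\<^sup>2 - d)"
      using mid_le by (intro N_le real_le_rsqrt)
    also have "\<dots> < sqrt ((N p)\<^sup>2)"
      using d by (intro real_sqrt_less_mono) simp
    also have "\<dots> = N p" using \<open>0 \<le> N p\<close> by simp
    finally show False using p(2)[OF mid] by simp
  qed
  then show ?thesis using p(1) by blast
qed

text \<open>The maps may be singular off \<open>W\<close>. Since all their values lie in
  \<open>W\<close>, so does the closed convex hull of the orbit, and there the lower bound applies
  to differences.\<close>

lemma orbit_hull_fixed_point:
  fixes T :: "('e::euclidean_space \<Rightarrow> 'e) set"
  assumes ne: "T \<noteq> {}" and lin: "\<And>f. f \<in> T \<Longrightarrow> linear f"
    and comp: "\<And>f g. f \<in> T \<Longrightarrow> g \<in> T \<Longrightarrow> f \<circ> g \<in> T"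
    and upper: "\<And>f x. f \<in> T \<Longrightarrow> norm (f x) \<le> B * norm x"
    and W: "subspace W" "\<And>f x. f \<in> T \<Longrightarrow> f x \<in> W"
    and lower: "\<And>f x. f \<in> T \<Longrightarrow> x \<in> W \<Longrightarrow> norm x \<le> B * norm (f x)"
  obtains q where "q \<in> closure (convex hull ((\<lambda>f. f x) ` T))" "\<And>f. f \<in> T \<Longrightarrow> f q = q"
proof -
  define orb where "orb = (\<lambda>f. f x) ` T"
  define Q where "Q = closure (convex hull orb)"
  have "bounded orb"
    unfolding bounded_iff orb_def using upper by blast
  then have "compact Q"
    by (simp add: Q_def bounded_convex_hull)
  have QW: "Q \<subseteq> W"
    unfolding Q_def orb_def using W
    by (intro closure_minimal hull_minimal closed_subspace subspace_imp_convex) auto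
  have "\<exists>q\<in>Q. \<forall>f\<in>T. f q = q"
  proof (rule bounded_semigroup_fixed_point[where B = B])
    show "convex Q" by (simp add: Q_def)
    show "Q \<noteq> {}" using ne by (simp add: Q_def orb_def)
    show "norm (y - z) \<le> B * norm (f (y - z))" if "f \<in> T" "y \<in> Q" "z \<in> Q" for f y z
      using that QW W(1) by (intro lower) (auto intro: subspace_diff)
    show "f y \<in> Q" if f: "f \<in> T" and "y \<in> Q" for f y
    proof -
      have "f ` orb \<subseteq> orb" proof
        fix y assume "y \<in> f ` orb"
        then obtain g where g: "g \<in> T" "y = (f \<circ> g) x" by (auto simp: orb_def)
        show "y \<in> orb" unfolding orb_def
          by (rule image_eqI[where x = "f \<circ> g"]) (rule g(2), rule comp[OF f g(1)])
      qed
      then have "f ` (convex hull orb) \<subseteq> convex hull orb"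
        using convex_hull_linear_image[OF lin[OF f], of orb] hull_mono by metis
      then have "closure (f ` (convex hull orb)) \<subseteq> Q"
        unfolding Q_def by (rule closure_mono)
      moreover have "f ` Q \<subseteq> closure (f ` (convex hull orb))"
        unfolding Q_def using lin[OF f] linear_conv_bounded_linear
        by (intro closure_bounded_linear_image_subset) auto
      ultimately show ?thesis using \<open>y \<in> Q\<close> by blast
    qed
  qed (use lin comp upper \<open>compact Q\<close> in auto)
  then show thesis using that unfolding Q_def orb_def by blast
qed

text \<open>Pointedness makes C - {0} convex, so the convex hull of the compact base of unit vectors
  misses 0 and can be strictly separated from it. Homogeneity spreads the margin \<open>e\<close>
  over the cone.\<close>

lemma pointed_cone_positive_functional:
  fixes C :: "'v::euclidean_space set"
  assumes C: "closed C" "convex_cone C" and pt: "pointed C"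
  obtains a e where "e > 0" "\<And>x. x \<in> C \<Longrightarrow> e * norm x \<le> a \<bullet> x"
proof -
  have add: "x + y \<in> C" and scl: "c \<ge> 0 \<Longrightarrow> c *\<^sub>R x \<in> C" if "x \<in> C" "y \<in> C" for x y c
    using C(2) that by (auto simp: convex_cone_iff)
  have pt': "x = 0" if "x \<in> C" "- x \<in> C" for x
  proof -
    have "x \<in> C \<inter> uminus ` C" using that by force
    then show ?thesis using pt unfolding pointed_def by blast
  qed
  have "convex (C - {0})"
  proof (rule convexI)
    fix x y and u v :: real
    assume *: "x \<in> C - {0}" "y \<in> C - {0}" "0 \<le> u" "0 \<le> v" "u + v = 1"
    have ux: "u *\<^sub>R x \<in> C" and vy: "v *\<^sub>R y \<in> C" using * scl by auto
    moreover have "u *\<^sub>R x + v *\<^sub>R y \<noteq> 0"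
    proof
      assume 0: "u *\<^sub>R x + v *\<^sub>R y = 0"
      then have "- (u *\<^sub>R x) = v *\<^sub>R y" by (metis add.inverse_unique)
      then have "u *\<^sub>R x = 0" using pt'[OF ux] vy by simp
      moreover from this have "v *\<^sub>R y = 0" using 0 by (metis add_0)
      ultimately show False using * by auto
    qed
    ultimately show "u *\<^sub>R x + v *\<^sub>R y \<in> C - {0}" using add by auto
  qed
  then have "convex hull (C \<inter> sphere 0 1) \<subseteq> C - {0}"
    by (intro hull_minimal) auto
  then have "0 \<notin> convex hull (C \<inter> sphere 0 1)" by blast
  moreover have "closed (convex hull (C \<inter> sphere 0 1))"
    by (intro compact_imp_closed compact_convex_hull closed_Int_compact[OF C(1) compact_sphere])
  ultimately obtain a e where ae: "0 < e" "\<forall>x\<in>convex hull (C \<inter> sphere 0 1). a \<bullet> x > e"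
    using separating_hyperplane_closed_0[of "convex hull (C \<inter> sphere 0 1)"] convex_convex_hull by blast
  show thesis
  proof (rule that[OF ae(1)])
    fix x assume x: "x \<in> C"
    show "e * norm x \<le> a \<bullet> x"
    proof (cases "x = 0")
      case False
      have "(1 / norm x) *\<^sub>R x \<in> C \<inter> sphere 0 1"
        using x False scl by auto
      then have "e < a \<bullet> ((1 / norm x) *\<^sub>R x)" using ae(2) by (simp only: hull_inc)
      then show ?thesis using False by (simp add: field_simps)
    qed simp
  qed
qed

section \<open>Lie superalgebras and compactly embedded subalgebras\<close>

text \<open>Equality of dimensions. It will be applied to a limit of automorphisms, on the whole
  space and on each homogeneous part.\<close>

lemma lin_on_image_eq:
  fixes V :: "'v::euclidean_space set"
  assumes V: "subspace V" and f: "lin_on V f" "inj_on f V" "f ` V \<subseteq> V"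
  shows "f ` V = V"
proof -
  obtain P where P: "linear P" "\<And>x. P x \<in> V" "\<And>x. x \<in> V \<Longrightarrow> P x = x"
    using subspace_projection[OF V] by metis
  have lin: "linear (f \<circ> P)" by (rule lin_on_projection[OF f(1) P(1,2)])
  have im: "(f \<circ> P) ` V = f ` V" using P(3) by force
  have "inj_on (f \<circ> P) V" using f(2) P(3) by (simp add: inj_on_def)
  then have "dim ((f \<circ> P) ` V) = dim V"
    using lin V by (intro dim_image_eq) (auto simp: span_eq_iff[THEN iffD2])
  moreover have "subspace ((f \<circ> P) ` V)"
    using lin V by (rule linear_subspace_image)
  ultimately show ?thesis
    using subspace_dim_equal[of "f ` V" V] V f(3) im by auto
qed

lemma space_of_even_alg [simp]: "space_of (even_alg L) = ev L"
  by (auto simp: space_of_def even_alg_def)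

lemma even_alg_sel [simp]: "br (even_alg L) = br L" "ev (even_alg L) = ev L" "od (even_alg L) = {0}"
  by (simp_all add: even_alg_def)

locale superalgebra =
  fixes L :: "'v::euclidean_space superalg"
  assumes superalgebra: "lie_superalgebra L"
begin

lemma subspace_ev: "subspace (ev L)" and subspace_od: "subspace (od L)"
  using superalgebra by (auto simp: lie_superalgebra_def)

lemma space_ofE:
  assumes "x \<in> space_of L"
  obtains x0 x1 where "x = x0 + x1" "x0 \<in> ev L" "x1 \<in> od L"
  using assms by (auto simp: space_of_def set_plus_def)

lemma ev_subset: "ev L \<subseteq> space_of L" and od_subset: "od L \<subseteq> space_of L"
  using subspace_0[OF subspace_ev] subspace_0[OF subspace_od]
  by (force simp: space_of_def set_plus_def)+

lemma ev_in_space [simp]: "x \<in> ev L \<Longrightarrow> x \<in> space_of L"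
  and od_in_space [simp]: "x \<in> od L \<Longrightarrow> x \<in> space_of L"
  using ev_subset od_subset by auto

lemma subspace_space_of: "subspace (space_of L)"
proof -
  have "space_of L = {x + y |x y. x \<in> ev L \<and> y \<in> od L}"
    by (auto simp: space_of_def set_plus_def)
  then show ?thesis using subspace_sums[OF subspace_ev subspace_od] by simp
qed

lemma lin_on_br: "x \<in> space_of L \<Longrightarrow> lin_on (space_of L) (br L x)"
  and lin_on_br_left: "x \<in> space_of L \<Longrightarrow> lin_on (space_of L) (\<lambda>y. br L y x)"
  using superalgebra unfolding lie_superalgebra_def lin_on_def by blast+

lemma br_part:
  assumes "x \<in> part L i" "y \<in> part L j"
  shows "br L x y \<in> part L (i + j)" "br L x y = - ((-1) ^ (i * j) *\<^sub>R br L y x)"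
    and "z \<in> space_of L \<Longrightarrow>
      br L x (br L y z) = br L (br L x y) z + (-1) ^ (i * j) *\<^sub>R br L y (br L x z)"
  using superalgebra assms unfolding lie_superalgebra_def by blast+

lemma br_ev_ev [simp]: "x \<in> ev L \<Longrightarrow> y \<in> ev L \<Longrightarrow> br L x y \<in> ev L"
  and br_ev_od [simp]: "x \<in> ev L \<Longrightarrow> y \<in> od L \<Longrightarrow> br L x y \<in> od L"
  and br_od_od [simp]: "x \<in> od L \<Longrightarrow> y \<in> od L \<Longrightarrow> br L x y \<in> ev L"
  using br_part(1)[of x 0 y 0] br_part(1)[of x 0 y 1] br_part(1)[of x 1 y 1]
  by (simp_all add: part_def)

lemma br_anticomm: "x \<in> ev L \<Longrightarrow> y \<in> ev L \<Longrightarrow> br L x y = - br L y x"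
  and br_od_comm: "x \<in> od L \<Longrightarrow> y \<in> od L \<Longrightarrow> br L x y = br L y x"
  using br_part(2)[of x 0 y 0] br_part(2)[of x 1 y 1] by (simp_all add: part_def)

lemma br_self: "x \<in> ev L \<Longrightarrow> br L x x = 0"
  using br_anticomm[of x x] by (metis add.left_inverse scaleR_2 scaleR_eq_0_iff zero_neq_numeral)

lemma br_jacobi:
  assumes "x \<in> ev L" "y \<in> ev L" "z \<in> space_of L"
  shows "br L x (br L y z) = br L (br L x y) z + br L y (br L x z)"
  using br_part(3)[of x 0 y 0 z] assms by (simp add: part_def)

lemma br_ev_space: "x \<in> ev L \<Longrightarrow> y \<in> space_of L \<Longrightarrow> br L x y \<in> space_of L"
  by (metis space_ofE lin_on_add[OF lin_on_br] ev_in_space od_in_space br_ev_ev br_ev_od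
      subspace_add[OF subspace_space_of])

lemma br_od_ev [simp]: "x \<in> od L \<Longrightarrow> y \<in> ev L \<Longrightarrow> br L x y \<in> od L"
  using br_part(1)[of x 1 y 0] by (simp add: part_def)

lemma br_space [simp]:
  assumes "x \<in> space_of L" "y \<in> space_of L"
  shows "br L x y \<in> space_of L"
proof -
  obtain x0 x1 where x: "x = x0 + x1" "x0 \<in> ev L" "x1 \<in> od L" using assms space_ofE by metis
  obtain y0 y1 where y: "y = y0 + y1" "y0 \<in> ev L" "y1 \<in> od L" using assms space_ofE by metis
  have "br L x1 y = br L x1 y0 + br L x1 y1"
    unfolding y(1) by (rule lin_on_add[OF lin_on_br]) (use x y in simp_all)
  then have "br L x1 y \<in> space_of L"
    using x y by (simp add: subspace_add[OF subspace_space_of])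
  moreover have "br L x y = br L x0 y + br L x1 y"
    unfolding x(1) by (rule lin_on_add[OF lin_on_br_left[OF assms(2)]]) (use x in simp_all)
  ultimately show ?thesis
    using br_ev_space[OF x(2) assms(2)] by (simp add: subspace_add[OF subspace_space_of])
qed

lemma br_0 [simp]: "x \<in> space_of L \<Longrightarrow> br L x 0 = 0"
  using lin_on_scaleR[OF lin_on_br, of x x 0] by simp

lemma br_scaleR_right: "x \<in> space_of L \<Longrightarrow> y \<in> space_of L \<Longrightarrow> br L x (c *\<^sub>R y) = c *\<^sub>R br L x y"
  and br_scaleR_left: "x \<in> space_of L \<Longrightarrow> y \<in> space_of L \<Longrightarrow> br L (c *\<^sub>R x) y = c *\<^sub>R br L x y"
  and br_add_right: "x \<in> space_of L \<Longrightarrow> y \<in> space_of L \<Longrightarrow> z \<in> space_of L \<Longrightarrow>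
        br L x (y + z) = br L x y + br L x z"
  and br_add_left: "x \<in> space_of L \<Longrightarrow> y \<in> space_of L \<Longrightarrow> z \<in> space_of L \<Longrightarrow>
        br L (x + y) z = br L x z + br L y z"
  using lin_on_br[of x] lin_on_br_left[of z] lin_on_br_left[of y]
  by (auto simp: lin_on_def)

text \<open>Lets the results on compact embedding be used for the even part as well.\<close>

lemma superalgebra_even_alg: "superalgebra (even_alg L)"
proof
  have z: "0 \<in> ev L" by (rule subspace_0[OF subspace_ev])
  have p: "part (even_alg L) i = (if even i then ev L else {0})" for i
    by (simp add: part_def)
  have zl: "br L 0 y = 0" if "y \<in> ev L" for y
    using br_scaleR_left[of 0 y 0] that z by simp
  have parts: "br L x y \<in> part (even_alg L) (i + j)"
      "br L x y = - ((-1) ^ (i * j) *\<^sub>R br L y x)"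
      "w \<in> ev L \<Longrightarrow> br L x (br L y w) = br L (br L x y) w + (-1) ^ (i * j) *\<^sub>R br L y (br L x w)"
    if "x \<in> part (even_alg L) i" "y \<in> part (even_alg L) j" for i j x y w
  proof -
    \<comment> \<open>An odd index forces the element to be 0, so both sides vanish whenever the
      sign is negative.\<close>
    have xy: "x \<in> ev L" "y \<in> ev L" and od: "odd i \<Longrightarrow> x = 0" "odd j \<Longrightarrow> y = 0"
      using that z by (auto simp: p split: if_splits)
    have "br L x y = 0" if "odd (i + j)"
      using that od xy zl by (cases "even i") auto
    then show "br L x y \<in> part (even_alg L) (i + j)"
      using xy by (simp add: p)
    show "br L x y = - ((-1) ^ (i * j) *\<^sub>R br L y x)"
    proof (cases "even (i * j)")
      case True
      then have "(-1) ^ (i * j) *\<^sub>R br L y x = br L y x" by simp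
      then show ?thesis using br_anticomm[OF xy] by simp
    next
      case False
      then show ?thesis using od xy zl by simp
    qed
    show "br L x (br L y w) = br L (br L x y) w + (-1) ^ (i * j) *\<^sub>R br L y (br L x w)"
      if w: "w \<in> ev L"
    proof (cases "even (i * j)")
      case True
      then have "(-1) ^ (i * j) *\<^sub>R br L y (br L x w) = br L y (br L x w)" by simp
      then show ?thesis using br_jacobi[OF xy, of w] w by simp
    next
      case False
      then show ?thesis using od w z zl by simp
    qed
  qed
  show "lie_superalgebra (even_alg L)"
    unfolding lie_superalgebra_def space_of_even_alg even_alg_sel
  proof (intro conjI)
    show "ev L \<inter> {0} = {0}" using z by auto
    show "\<forall>x\<in>ev L. \<forall>y\<in>ev L. \<forall>z\<in>ev L. \<forall>c.
        br L (x + y) z = br L x z + br L y z \<and> br L (c *\<^sub>R x) z = c *\<^sub>R br L x z \<and>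
        br L z (x + y) = br L z x + br L z y \<and> br L z (c *\<^sub>R x) = c *\<^sub>R br L z x"
      by (simp add: br_scaleR_left br_scaleR_right br_add_left br_add_right)
    show "subspace (ev L)" "subspace {0 :: 'v}" by (rule subspace_ev) simp
    show "\<forall>i j. \<forall>x\<in>part (even_alg L) i. \<forall>y\<in>part (even_alg L) j.
        br L x y \<in> part (even_alg L) (i + j) \<and>
        br L x y = - ((-1) ^ (i * j) *\<^sub>R br L y x) \<and>
        (\<forall>z\<in>ev L. br L x (br L y z) = br L (br L x y) z + (-1) ^ (i * j) *\<^sub>R br L y (br L x z))"
      by (intro allI ballI conjI parts)
  qed
qed

section \<open>Compact embedding in terms of bounded orbits\<close>

lemma superalg_aut_lin_on: "f \<in> superalg_aut L \<Longrightarrow> lin_on (space_of L) f"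
  by (auto simp: superalg_aut_def lin_on_def)

lemma superalg_aut_in_space: "f \<in> superalg_aut L \<Longrightarrow> x \<in> space_of L \<Longrightarrow> f x \<in> space_of L"
  by (auto simp: superalg_aut_def Bij_def bij_betw_def)

text \<open>Evaluation at \<open>x\<close> is continuous for pointwise convergence, so it maps the
  compact closure to a compact set containing the orbit.\<close>

lemma compactly_embedded_imp_bounded:
  assumes "compactly_embedded L k" and sub: "inner_group L k \<subseteq> superalg_aut L"
    and x: "x \<in> space_of L"
  shows "bounded ((\<lambda>f. f x) ` inner_group L k)"
proof -
  have "superalg_aut L \<subseteq> topspace (aut_topology L)"
    by (auto simp: aut_topology_def superalg_aut_def Bij_def extensional_def PiE_def)
  then have "inner_group L k \<subseteq> aut_topology L closure_of inner_group L k"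
    using sub by (intro closure_of_subset) auto
  moreover have "continuous_map (aut_topology L) euclidean (\<lambda>f. f x)"
    unfolding aut_topology_def
    by (intro continuous_map_from_subtopology continuous_map_product_projection x)
  then have "compact ((\<lambda>f. f x) ` (aut_topology L closure_of inner_group L k))"
    using assms(1) image_compactin unfolding compactly_embedded_def compactin_euclidean_iff[symmetric]
    by blast
  ultimately show ?thesis
    by (meson bounded_subset compact_imp_bounded image_mono)
qed

text \<open>Applied to inverses, an upper bound for the group becomes the lower bound that keeps
  limits injective.\<close>

lemma inner_group_inverse:
  assumes sub: "inner_group L k \<subseteq> superalg_aut L" and f: "f \<in> inner_group L k"
  obtains g where "g \<in> inner_group L k" "\<And>x. x \<in> space_of L \<Longrightarrow> g (f x) = x"
proof -
  interpret B: group "BijGroup (space_of L)" by (rule group_BijGroup)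
  have Bij: "superalg_aut L \<subseteq> Bij (space_of L)" by (auto simp: superalg_aut_def)
  have "exp_ad L ` k \<subseteq> inner_group L k"
    unfolding inner_group_def by (auto intro: generate.incl)
  then have "exp_ad L ` k \<subseteq> carrier (BijGroup (space_of L))"
    using sub Bij by (auto simp: BijGroup_def)
  then have "inv\<^bsub>BijGroup (space_of L)\<^esub> f \<in> inner_group L k"
    using f unfolding inner_group_def by (rule B.generate_m_inv_closed)
  moreover have "f \<in> Bij (space_of L)" using f sub Bij by auto
  then have "(inv\<^bsub>BijGroup (space_of L)\<^esub> f) (f x) = x" if "x \<in> space_of L" for x
    using that by (auto simp: inv_BijGroup Bij_def bij_betw_def)
  ultimately show thesis using that by blast
qed

text \<open>The closure \<open>CI\<close> in the full product space is compact by Tychonoff, as it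
  lies in a product of balls. What remains is that its elements are automorphisms: identities pass
  to pointwise limits, and bijectivity survives through the lower bound.\<close>

lemma bounded_imp_compactly_embedded:
  assumes sub: "inner_group L k \<subseteq> superalg_aut L"
    and bdd: "\<And>x. x \<in> space_of L \<Longrightarrow> bounded ((\<lambda>f. f x) ` inner_group L k)"
  shows "compactly_embedded L k"
proof -
  define V where "V = space_of L"
  define I where "I = inner_group L k"
  define TV where "TV = product_topology (\<lambda>_. euclidean :: 'v topology) V"
  define CI where "CI = TV closure_of I"
  have V: "subspace V" unfolding V_def by (rule subspace_space_of)
  have aut: "f \<in> superalg_aut L" if "f \<in> I" for f using that sub I_def by auto
  obtain B where B: "B > 0" "\<And>f x. f \<in> I \<Longrightarrow> x \<in> V \<Longrightarrow> norm (f x) \<le> B * norm x"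
    using pointwise_bounded_imp_uniformly_bounded[OF V, of I] superalg_aut_lin_on aut bdd
    unfolding V_def I_def by metis
  have lower: "norm x \<le> B * norm (f x)" if "f \<in> I" "x \<in> V" for f x
    using inner_group_inverse[OF sub, of f] B(2) superalg_aut_in_space[OF aut] that
    unfolding V_def I_def by metis
  have "I \<subseteq> extensional V"
    using aut by (auto simp: superalg_aut_def Bij_def V_def)
  have proj: "continuous_map TV euclidean (\<lambda>f. f x)" if "x \<in> V" for x
    unfolding TV_def by (intro continuous_map_product_projection that)
  have closed: "f x \<in> S" if "f \<in> CI" "closed S" "x \<in> V" "\<And>h. h \<in> I \<Longrightarrow> h x \<in> S" for f x S
    using that(1)[unfolded CI_def] that(4)
  proof (rule forall_in_closure_of)
    show "closedin TV {f \<in> topspace TV. f x \<in> S}"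
      using that(2) by (intro closedin_continuous_map_preimage[OF proj[OF that(3)]]) auto
  qed
  \<comment> \<open>One transfer principle for sums, multiples and brackets: each is a continuous
    function of two values of the map.\<close>
  have eq: "f z = g (f x, f y)"
    if "f \<in> CI" "continuous_on UNIV g" "x \<in> V" "y \<in> V" "z \<in> V"
      "\<And>h. h \<in> I \<Longrightarrow> h z = g (h x, h y)" for f x y z and g :: "'v \<times> 'v \<Rightarrow> 'v"
    using that(1)[unfolded CI_def] Hausdorff_space_euclidean proj[OF that(5)] _ that(6)
  proof (rule forall_in_closure_of_eq)
    have "continuous_map TV (prod_topology euclidean euclidean) (\<lambda>f. (f x, f y))"
      by (intro continuous_map_pairedI proj that)
    then have "continuous_map TV euclidean (\<lambda>f. (f x, f y))" by simp
    then have "continuous_map TV euclidean (g \<circ> (\<lambda>f. (f x, f y)))"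
      by (rule continuous_map_compose) (simp add: that(2))
    then show "continuous_map TV euclidean (\<lambda>f. g (f x, f y))" by (simp add: o_def)
  qed
  obtain P where P: "linear P" "\<And>x. P x \<in> V" "\<And>x. x \<in> V \<Longrightarrow> P x = x"
    using subspace_projection[OF V] by metis
  \<comment> \<open>Extended by \<open>P\<close>, the bracket is bilinear on the ambient space and
    therefore continuous.\<close>
  have "bilinear (\<lambda>x y. br L (P x) (P y))"
    using P(2) unfolding bilinear_def V_def
    by (auto intro!: linearI simp: linear_add[OF P(1)] linear_scale[OF P(1)] br_add_left
        br_add_right br_scaleR_left br_scaleR_right)
  then have "bounded_bilinear (\<lambda>x y. br L (P x) (P y))"
    by (simp add: bilinear_conv_bounded_bilinear)
  then have br_cont: "continuous_on UNIV (\<lambda>p. br L (P (fst p)) (P (snd p)))"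
    by (rule bounded_bilinear.continuous_on) (rule continuous_on_fst continuous_on_snd continuous_on_id)+
  have "CI \<subseteq> superalg_aut L"
  proof
    fix f assume f: "f \<in> CI"
    have "f \<in> topspace TV" using f by (simp add: CI_def in_closure_of)
    then have ext: "f \<in> extensional V" by (simp add: TV_def PiE_def)
    have inV: "f x \<in> V" if "x \<in> V" for x
      using superalg_aut_in_space[OF aut] V that
      by (intro closed[OF f]) (auto simp: V_def closed_subspace)
    have add: "continuous_on UNIV (\<lambda>p. fst p + snd p :: 'v)"
      and scl: "continuous_on UNIV (\<lambda>p :: 'v \<times> 'v. c *\<^sub>R fst p)" for c
      by (intro continuous_intros)+
    have lin: "lin_on V f"
      unfolding lin_on_def
    proof (intro ballI allI conjI)
      fix x y c assume xy: "x \<in> V" "y \<in> V"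
      show "f (x + y) = f x + f y"
        using eq[OF f add, of x y "x + y"] xy V superalg_aut_lin_on[OF aut]
        by (auto simp: lin_on_def V_def subspace_add)
      show "f (c *\<^sub>R x) = c *\<^sub>R f x"
        using eq[OF f scl, of x y "c *\<^sub>R x" c] xy V superalg_aut_lin_on[OF aut]
        by (auto simp: lin_on_def V_def subspace_scale)
    qed
    have br: "f (br L x y) = br L (f x) (f y)" if "x \<in> V" "y \<in> V" for x y
    proof -
      have "f (br L x y) = br L (P (f x)) (P (f y))"
        using eq[OF f br_cont that, of "br L x y"] that aut P(3) superalg_aut_in_space[OF aut]
        by (auto simp: V_def superalg_aut_def)
      then show ?thesis by (simp add: P(3) inV that)
    qed
    have low: "norm x \<le> B * norm (f x)" if "x \<in> V" for x
    proof -
      have "f x \<in> {y. norm x \<le> B * norm y}"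
        using lower that by (intro closed[OF f]) (auto intro!: closed_Collect_le continuous_intros)
      then show ?thesis by simp
    qed
    have inj: "inj_on f V"
    proof (rule inj_onI)
      fix x y assume xy: "x \<in> V" "y \<in> V" "f x = f y"
      then show "x = y"
        using low[of "x - y"] lin_on_diff[OF lin V, of x y] V by (simp add: subspace_diff)
    qed
    have sub_onto: "f ` W = W" if W: "subspace W" "W \<subseteq> V" and "\<And>h. h \<in> I \<Longrightarrow> h ` W \<subseteq> W" for W
    proof (rule lin_on_image_eq[OF W(1)])
      show "lin_on W f" using lin W(2) by (rule lin_on_subset)
      show "inj_on f W" using inj W(2) by (rule inj_on_subset)
      show "f ` W \<subseteq> W"
        using that by (auto intro!: closed[OF f] closed_subspace)
    qed
    have "f ` V = V"
      using superalg_aut_in_space[OF aut] by (intro sub_onto V) (auto simp: V_def)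
    moreover have "f ` ev L = ev L"
      using aut by (intro sub_onto subspace_ev) (auto simp: V_def superalg_aut_def)
    moreover have "f ` od L = od L"
      using aut by (intro sub_onto subspace_od) (auto simp: V_def superalg_aut_def)
    ultimately show "f \<in> superalg_aut L"
      using ext inj lin br
      by (auto simp: superalg_aut_def Bij_def bij_betw_def lin_on_def V_def[symmetric])
  qed
  moreover have "CI \<subseteq> PiE V (\<lambda>x. cball 0 (B * norm x))"
  proof
    fix f assume f: "f \<in> CI"
    have "f \<in> topspace TV" using f by (simp add: CI_def in_closure_of)
    moreover have "f x \<in> cball 0 (B * norm x)" if "x \<in> V" for x
      using B(2) that by (intro closed[OF f]) auto
    ultimately show "f \<in> PiE V (\<lambda>x. cball 0 (B * norm x))"
      by (auto simp: TV_def PiE_def Pi_def)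
  qed
  then have "compactin TV (CI)"
    unfolding TV_def CI_def by (rule closed_compactin[rotated]) (auto simp: compactin_PiE)
  ultimately have "compactin (aut_topology L) (CI)"
    unfolding aut_topology_def TV_def V_def by (simp add: compactin_subtopology)
  \<comment> \<open>All limits in the product space are automorphisms, so closing within the
    automorphism group gives the same set.\<close>
  moreover have "aut_topology L closure_of inner_group L k = CI"
    using \<open>CI \<subseteq> superalg_aut L\<close> sub
    by (simp add: aut_topology_def closure_of_subtopology TV_def V_def I_def CI_def Int_absorb1)
  ultimately show ?thesis by (simp add: compactly_embedded_def)
qed

end

section \<open>The adjoint action\<close>

locale supergroup =
  fixes S :: "('a, 'e::euclidean_space, 'v::euclidean_space) supergroup"
  assumes supergroup: "lie_supergroup S"
begin

abbreviation "G \<equiv> grp S"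
abbreviation "L \<equiv> alg S"

sublocale superalgebra L
  using supergroup by unfold_locales (simp add: lie_supergroup_def)

sublocale G: group G
  using supergroup by (simp add: lie_supergroup_def lie_group_def)

lemma one_parameter_subgroup_Exp: "X \<in> ev L \<Longrightarrow> one_parameter_subgroup G (mfd S) (\<lambda>t. Exp S (t *\<^sub>R X))"
  using supergroup by (simp add: lie_supergroup_def is_lie_algebra_of_def)

lemma Exp_closed [simp]:
  assumes "X \<in> ev L"
  shows "Exp S X \<in> carrier G"
proof -
  have "continuous_map (mtop (linear_mfd UNIV)) (mtop (mfd S)) (\<lambda>t::real. Exp S (t *\<^sub>R X))"
    using one_parameter_subgroup_Exp[OF assms] by (simp add: one_parameter_subgroup_def smooth_map_def)
  then have "Exp S (1 *\<^sub>R X) \<in> topspace (mtop (mfd S))"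
    by (auto simp: continuous_map_def linear_mfd_def Pi_iff simp del: scaleR_one)
  then show ?thesis
    using supergroup by (simp add: lie_supergroup_def lie_group_def)
qed

lemma Exp_add: "X \<in> ev L \<Longrightarrow> Exp S ((s + t) *\<^sub>R X) = Exp S (s *\<^sub>R X) \<otimes>\<^bsub>G\<^esub> Exp S (t *\<^sub>R X)"
  using one_parameter_subgroup_Exp by (simp add: one_parameter_subgroup_def)

lemma scaleR_ev [simp]: "X \<in> ev L \<Longrightarrow> c *\<^sub>R X \<in> ev L"
  by (rule subspace_scale[OF subspace_ev])

lemma Exp_0 [simp]: "Exp S 0 = \<one>\<^bsub>G\<^esub>"
proof -
  have 0: "0 \<in> ev L" by (rule subspace_0[OF subspace_ev])
  then have "Exp S 0 \<otimes>\<^bsub>G\<^esub> Exp S 0 = Exp S 0"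
    using Exp_add[of 0 0 0] by simp
  then show ?thesis using 0 by (simp add: G.r_cancel_one')
qed

lemma inv_Exp:
  assumes "X \<in> ev L"
  shows "inv\<^bsub>G\<^esub> (Exp S X) = Exp S (- X)"
proof (rule G.inv_equality)
  show "Exp S (- X) \<otimes>\<^bsub>G\<^esub> Exp S X = \<one>\<^bsub>G\<^esub>"
    using Exp_add[OF assms, of "-1" 1] by simp
  show "Exp S X \<in> carrier G" "Exp S (- X) \<in> carrier G"
    using assms subspace_neg[OF subspace_ev] by simp_all
qed

lemma Ad_aut: "g \<in> carrier G \<Longrightarrow> restrict (Ad S g) (space_of L) \<in> superalg_aut L"
  using supergroup by (simp add: lie_supergroup_def)

lemma Ad_mult:
  "g \<in> carrier G \<Longrightarrow> h \<in> carrier G \<Longrightarrow> X \<in> space_of L \<Longrightarrow> Ad S (g \<otimes>\<^bsub>G\<^esub> h) X = Ad S g (Ad S h X)"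
  using supergroup by (simp add: lie_supergroup_def)

lemma lin_on_Ad: "g \<in> carrier G \<Longrightarrow> lin_on (space_of L) (Ad S g)"
  using superalg_aut_lin_on[OF Ad_aut, of g] subspace_space_of
  by (auto simp: lin_on_def subspace_add subspace_scale)

lemma Ad_in_space [simp]: "g \<in> carrier G \<Longrightarrow> X \<in> space_of L \<Longrightarrow> Ad S g X \<in> space_of L"
  using superalg_aut_in_space[OF Ad_aut, of g X] by simp

lemma Ad_image:
  assumes "g \<in> carrier G"
  shows "Ad S g ` ev L = ev L" "Ad S g ` od L = od L"
proof -
  have "restrict (Ad S g) (space_of L) ` W = Ad S g ` W" if "W \<subseteq> space_of L" for W
    using that by (intro image_cong) auto
  then show "Ad S g ` ev L = ev L" "Ad S g ` od L = od L"
    using Ad_aut[OF assms] ev_subset od_subset by (auto simp: superalg_aut_def)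
qed

lemma Ad_ev [simp]: "g \<in> carrier G \<Longrightarrow> X \<in> ev L \<Longrightarrow> Ad S g X \<in> ev L"
  and Ad_od [simp]: "g \<in> carrier G \<Longrightarrow> X \<in> od L \<Longrightarrow> Ad S g X \<in> od L"
  using Ad_image by blast+

lemma Ad_br:
  assumes "g \<in> carrier G" "X \<in> space_of L" "Y \<in> space_of L"
  shows "Ad S g (br L X Y) = br L (Ad S g X) (Ad S g Y)"
  using Ad_aut[OF assms(1)] assms(2,3) by (auto simp: superalg_aut_def)

lemma inj_on_Ad: "g \<in> carrier G \<Longrightarrow> inj_on (Ad S g) (space_of L)"
  using Ad_aut[of g] by (auto simp: superalg_aut_def Bij_def bij_betw_def inj_on_def)

text \<open>Multiplicativity makes this map idempotent, and an injective idempotent is the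
  identity.\<close>

lemma Ad_one [simp]:
  assumes "X \<in> space_of L"
  shows "Ad S \<one>\<^bsub>G\<^esub> X = X"
proof (rule inj_onD[OF inj_on_Ad[OF G.one_closed]])
  show "Ad S \<one>\<^bsub>G\<^esub> (Ad S \<one>\<^bsub>G\<^esub> X) = Ad S \<one>\<^bsub>G\<^esub> X"
    using Ad_mult[of "\<one>\<^bsub>G\<^esub>" "\<one>\<^bsub>G\<^esub>" X] assms by simp
qed (use assms in auto)

lemma Ad_inv [simp]:
  assumes "g \<in> carrier G" "X \<in> space_of L"
  shows "Ad S (inv\<^bsub>G\<^esub> g) (Ad S g X) = X" "Ad S g (Ad S (inv\<^bsub>G\<^esub> g) X) = X"
  using Ad_mult[of "inv\<^bsub>G\<^esub> g" g X] Ad_mult[of g "inv\<^bsub>G\<^esub> g" X] assms by simp_all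

text \<open>The supergroup axiom differentiates at 0 only; the one-parameter group law moves the
  base point to \<open>s\<close>.\<close>

lemma Ad_Exp_has_vector_derivative:
  assumes X: "X \<in> ev L" and Y: "Y \<in> space_of L"
  shows "((\<lambda>t. Ad S (Exp S (t *\<^sub>R X)) Y) has_vector_derivative
    br L X (Ad S (Exp S (s *\<^sub>R X)) Y)) (at s)"
proof -
  let ?Z = "Ad S (Exp S (s *\<^sub>R X)) Y"
  have Z: "?Z \<in> space_of L" using X Y by simp
  have "((\<lambda>t. Ad S (Exp S (t *\<^sub>R X)) ?Z) has_vector_derivative br L X ?Z) (at (s - s))"
    using supergroup X Z by (simp add: lie_supergroup_def)
  moreover have "((\<lambda>t. t - s) has_vector_derivative 1) (at s)"
    by (auto intro!: derivative_eq_intros)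
  ultimately have "(((\<lambda>t. Ad S (Exp S (t *\<^sub>R X)) ?Z) \<circ> (\<lambda>t. t - s)) has_vector_derivative 1 *\<^sub>R br L X ?Z) (at s)"
    using vector_diff_chain_at by blast
  moreover have "(\<lambda>t. Ad S (Exp S (t *\<^sub>R X)) ?Z) \<circ> (\<lambda>t. t - s) = (\<lambda>t. Ad S (Exp S (t *\<^sub>R X)) Y)"
  proof
    fix t
    have "Exp S (t *\<^sub>R X) = Exp S ((t - s) *\<^sub>R X) \<otimes>\<^bsub>G\<^esub> Exp S (s *\<^sub>R X)"
      using Exp_add[OF X, of "t - s" s] by simp
    then show "((\<lambda>t. Ad S (Exp S (t *\<^sub>R X)) ?Z) \<circ> (\<lambda>t. t - s)) t = Ad S (Exp S (t *\<^sub>R X)) Y"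
      using X Y by (simp add: Ad_mult)
  qed
  ultimately show ?thesis by simp
qed

text \<open>The curve f(t) = Ad(Exp(tX)) Y solves f' = A f, so its n-th derivative is A^n f. Its
  Taylor remainder at t = 1 is at most K^n M / n! in each coordinate.\<close>

lemma Ad_Exp_sums:
  assumes X: "X \<in> ev L" and Y: "Y \<in> space_of L"
  shows "(\<lambda>n. (1 / fact n) *\<^sub>R (br L X ^^ n) Y) sums Ad S (Exp S X) Y"
proof -
  obtain P where P: "linear P" "\<And>x. P x \<in> space_of L" "\<And>x. x \<in> space_of L \<Longrightarrow> P x = x"
    using subspace_projection[OF subspace_space_of] by metis
  define A where "A = br L X \<circ> P"
  have "linear A"
    unfolding A_def using P X by (intro lin_on_projection[OF lin_on_br]) simp_all
  then have linA: "linear (A ^^ n)" for n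
    by (induction n) (auto simp: linear_id[unfolded id_def] intro: linear_compose simp: id_def)
  have A_eq: "A Z = br L X Z" "A Z \<in> space_of L" if "Z \<in> space_of L" for Z
    using that X by (simp_all add: A_def P(3))
  have pow: "(br L X ^^ n) Z = (A ^^ n) Z \<and> (A ^^ n) Z \<in> space_of L" if "Z \<in> space_of L" for n Z
    by (induction n) (simp_all add: that A_eq X)
  obtain K where K: "K > 0" "\<And>Z. norm (A Z) \<le> K * norm Z"
    using linear_bounded_pos[OF \<open>linear A\<close>] by blast
  have norm_pow: "norm ((A ^^ n) Z) \<le> K ^ n * norm Z" for n Z
  proof (induction n)
    case (Suc n)
    have "norm ((A ^^ Suc n) Z) \<le> K * norm ((A ^^ n) Z)" using K(2) by simp
    also have "\<dots> \<le> K * (K ^ n * norm Z)" using Suc K(1) by (intro mult_left_mono) auto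
    finally show ?case by (simp add: mult.assoc)
  qed simp
  define f where "f t = Ad S (Exp S (t *\<^sub>R X)) Y" for t
  have f: "f t \<in> space_of L" for t using X Y by (simp add: f_def)
  have f': "(f has_vector_derivative A (f t)) (at t)" for t
    using Ad_Exp_has_vector_derivative[OF X Y, of t] A_eq(1)[OF f, of t] by (simp add: f_def[abs_def])
  have f0: "f 0 = Y" using Y by (simp add: f_def)
  have "continuous_on {-1..1} f"
    using f' by (intro continuous_at_imp_continuous_on) (auto intro: has_vector_derivative_continuous)
  then have "bounded (f ` {-1..1})"
    by (intro compact_imp_bounded compact_continuous_image) auto
  then obtain M where M: "\<And>t. \<bar>t\<bar> \<le> 1 \<Longrightarrow> norm (f t) \<le> M"
    by (fastforce simp: bounded_iff abs_le_iff)
  have deriv: "((\<lambda>t. (A ^^ m) (f t) \<bullet> b) has_real_derivative (A ^^ Suc m) (f t) \<bullet> b) (at t)" for m b t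
  proof -
    have "bounded_linear (\<lambda>v. (A ^^ m) v \<bullet> b)"
      using linA[of m] linear_conv_bounded_linear
      by (intro bounded_linear_inner_left_comp) auto
    from bounded_linear.has_vector_derivative[OF this f', of t]
    show ?thesis
      by (simp add: has_real_derivative_iff_has_vector_derivative funpow_swap1)
  qed
  \<comment> \<open>The Lagrange remainder is available for real functions, hence the passage to
    coordinates. Its intermediate point lies in [-1,1], where \<open>M\<close> bounds the
    curve.\<close>
  have component: "\<bar>(f 1 - (\<Sum>m<n. (1 / fact m) *\<^sub>R (A ^^ m) Y)) \<bullet> b\<bar> \<le> K ^ n / fact n * M"
    if b: "b \<in> Basis" for n b
  proof -
    obtain t where t: "\<bar>t\<bar> \<le> 1" and
      eq: "f 1 \<bullet> b = (\<Sum>m<n. ((A ^^ m) (f 0) \<bullet> b / fact m) * 1 ^ m) + ((A ^^ n) (f t) \<bullet> b / fact n) * 1 ^ n"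
      using Maclaurin_all_le[of "\<lambda>m t. (A ^^ m) (f t) \<bullet> b" "\<lambda>t. f t \<bullet> b" 1 n] deriv by auto
    then have "(f 1 - (\<Sum>m<n. (1 / fact m) *\<^sub>R (A ^^ m) Y)) \<bullet> b = (A ^^ n) (f t) \<bullet> b / fact n"
      by (simp add: inner_diff_left inner_sum_left f0)
    also have "\<bar>\<dots>\<bar> \<le> K ^ n * M / fact n"
    proof -
      have "\<bar>(A ^^ n) (f t) \<bullet> b\<bar> \<le> norm ((A ^^ n) (f t))" using b by (rule Basis_le_norm)
      also have "\<dots> \<le> K ^ n * norm (f t)" by (rule norm_pow)
      also have "\<dots> \<le> K ^ n * M" using M[OF t] K(1) by (intro mult_left_mono) auto
      finally show ?thesis by (simp add: divide_right_mono)
    qed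
    finally show ?thesis by simp
  qed
  have "(\<lambda>n. (\<Sum>m<n. (1 / fact m) *\<^sub>R (A ^^ m) Y) - f 1) \<longlonglongrightarrow> 0"
  proof (rule Lim_null_comparison)
    have "(\<lambda>n. K ^ n / fact n) \<longlonglongrightarrow> 0"
      using summable_LIMSEQ_zero[OF summable_exp[of K]] by (simp add: field_simps)
    from tendsto_mult[OF tendsto_const tendsto_mult[OF this tendsto_const], of "real DIM('v)" M]
    show "(\<lambda>n. real DIM('v) * (K ^ n / fact n * M)) \<longlonglongrightarrow> 0" by simp
    show "\<forall>\<^sub>F n in sequentially. norm ((\<Sum>m<n. (1 / fact m) *\<^sub>R (A ^^ m) Y) - f 1)
        \<le> real DIM('v) * (K ^ n / fact n * M)"
    proof (rule always_eventually, rule allI)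
      fix n
      let ?d = "f 1 - (\<Sum>m<n. (1 / fact m) *\<^sub>R (A ^^ m) Y)"
      have "norm ?d \<le> (\<Sum>b\<in>Basis. \<bar>?d \<bullet> b\<bar>)" by (rule norm_le_l1)
      also have "\<dots> \<le> (\<Sum>b\<in>(Basis :: 'v set). K ^ n / fact n * M)"
        by (intro sum_mono component)
      finally show "norm ((\<Sum>m<n. (1 / fact m) *\<^sub>R (A ^^ m) Y) - f 1) \<le> real DIM('v) * (K ^ n / fact n * M)"
        by (simp only: sum_constant norm_minus_commute)
    qed
  qed
  then have "(\<lambda>n. (\<Sum>m<n. (1 / fact m) *\<^sub>R (A ^^ m) Y)) \<longlonglongrightarrow> f 1"
    by (rule LIM_zero_cancel)
  then show ?thesis
    using pow[OF Y] by (simp add: sums_def f_def)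
qed

section \<open>Inner groups as images of a subgroup of the Lie group\<close>

lemma exp_ad_eq_Ad:
  assumes "X \<in> ev L"
  shows "exp_ad L X = restrict (Ad S (Exp S X)) (space_of L)"
    and "exp_ad (even_alg L) X = restrict (Ad S (Exp S X)) (ev L)"
proof -
  have *: "(\<Sum>n. (1 / fact n) *\<^sub>R (br L X ^^ n) Y) = Ad S (Exp S X) Y" if "Y \<in> space_of L" for Y
    using Ad_Exp_sums[OF assms that] by (simp add: sums_iff)
  show "exp_ad L X = restrict (Ad S (Exp S X)) (space_of L)"
    unfolding exp_ad_def by (intro restrict_ext *)
  show "exp_ad (even_alg L) X = restrict (Ad S (Exp S X)) (ev L)"
    unfolding exp_ad_def space_of_even_alg even_alg_sel by (intro restrict_ext *) simp
qed

text \<open>Working with group elements instead of automorphisms lets the same \<open>g\<close> act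
  on the even part, on the odd part and on functionals.\<close>

definition exp_group :: "'v set \<Rightarrow> 'a set" where
  "exp_group k = generate G (Exp S ` k)"

lemma exp_group_closed: "k \<subseteq> ev L \<Longrightarrow> g \<in> exp_group k \<Longrightarrow> g \<in> carrier G"
  unfolding exp_group_def by (rule G.generate_in_carrier) auto

lemma exp_group_one: "\<one>\<^bsub>G\<^esub> \<in> exp_group k"
  and exp_group_mult: "g \<in> exp_group k \<Longrightarrow> h \<in> exp_group k \<Longrightarrow> g \<otimes>\<^bsub>G\<^esub> h \<in> exp_group k"
  and exp_group_Exp: "X \<in> k \<Longrightarrow> Exp S X \<in> exp_group k"
  unfolding exp_group_def by (auto intro: generate.intros)

lemma exp_group_inv: "k \<subseteq> ev L \<Longrightarrow> g \<in> exp_group k \<Longrightarrow> inv\<^bsub>G\<^esub> g \<in> exp_group k"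
  unfolding exp_group_def by (rule G.generate_m_inv_closed) auto

text \<open>Inverses of generators are covered by the case \<open>Exp\<close>, because Exp(X)^-1 =
  Exp(-X) and \<open>k\<close> contains -X.\<close>

lemma exp_group_induct [consumes 3, case_names one Exp mult]:
  assumes k: "subspace k" "k \<subseteq> ev L" and g: "g \<in> exp_group k"
    and one: "Q \<one>\<^bsub>G\<^esub>" and Exp: "\<And>X. X \<in> k \<Longrightarrow> Q (Exp S X)"
    and mult: "\<And>g h. g \<in> carrier G \<Longrightarrow> h \<in> carrier G \<Longrightarrow> Q g \<Longrightarrow> Q h \<Longrightarrow> Q (g \<otimes>\<^bsub>G\<^esub> h)"
  shows "Q g"
proof -
  have "g \<in> carrier G \<and> Q g"
    using g unfolding exp_group_def
  proof (induction rule: generate.induct)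
    case (inv h)
    then obtain X where X: "X \<in> k" "h = Exp S X" by auto
    then have "X \<in> ev L" "- X \<in> k" using k by (auto simp: subspace_neg)
    then show ?case
      using X Exp[of "- X"] by (simp add: inv_Exp[symmetric])
  qed (use k one Exp mult in auto)
  then show ?thesis ..
qed

lemma restrict_Ad_aut_even:
  assumes g: "g \<in> carrier G"
  shows "restrict (Ad S g) (ev L) \<in> superalg_aut (even_alg L)"
proof -
  have z: "0 \<in> ev L" by (rule subspace_0[OF subspace_ev])
  have lin: "lin_on (ev L) (Ad S g)"
    using lin_on_Ad[OF g] ev_subset by (rule lin_on_subset)
  have "Ad S g 0 = 0" using lin_on_scaleR[OF lin z, of 0] by simp
  have "inj_on (Ad S g) (ev L)"
    using inj_on_Ad[OF g] ev_subset by (rule inj_on_subset)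
  then have Bij: "restrict (Ad S g) (ev L) \<in> Bij (ev L)"
    using Ad_image(1)[OF g] by (simp add: Bij_def bij_betw_def)
  have im: "restrict (Ad S g) (ev L) ` ev L = ev L"
    using Bij by (simp add: Bij_def bij_betw_def)
  have "restrict (Ad S g) (ev L) (x + y) = restrict (Ad S g) (ev L) x + restrict (Ad S g) (ev L) y"
    "restrict (Ad S g) (ev L) (c *\<^sub>R x) = c *\<^sub>R restrict (Ad S g) (ev L) x"
    "restrict (Ad S g) (ev L) (br L x y) = br L (restrict (Ad S g) (ev L) x) (restrict (Ad S g) (ev L) y)"
    if "x \<in> ev L" "y \<in> ev L" for x y c
    using that g by (simp_all add: lin_on_add[OF lin] lin_on_scaleR[OF lin] Ad_br
        subspace_add[OF subspace_ev])
  then show ?thesis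
    unfolding superalg_aut_def using Bij im z \<open>Ad S g 0 = 0\<close>
    by simp
qed

text \<open>Restriction of Ad to \<open>V\<close> is a group homomorphism into
  \<open>BijGroup V\<close>, and homomorphisms map generated subgroups to generated
  subgroups.\<close>

lemma generate_restrict_Ad:
  assumes k: "k \<subseteq> ev L" and V: "V \<subseteq> space_of L"
    and Bij: "\<And>g. g \<in> carrier G \<Longrightarrow> restrict (Ad S g) V \<in> Bij V"
  shows "generate (BijGroup V) ((\<lambda>X. restrict (Ad S (Exp S X)) V) ` k) = (\<lambda>g. restrict (Ad S g) V) ` exp_group k"
proof -
  interpret h: group_hom G "BijGroup V" "\<lambda>g. restrict (Ad S g) V"
  proof (intro group_hom.intro group_hom_axioms.intro homI)
    fix g h assume gh: "g \<in> carrier G" "h \<in> carrier G"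
    then show "restrict (Ad S g) V \<in> carrier (BijGroup V)"
      by (simp add: BijGroup_def Bij)
    have "Ad S h x \<in> V" if "x \<in> V" for x
      using Bij[OF gh(2)] that by (auto simp: Bij_def bij_betw_def)
    then show "restrict (Ad S (g \<otimes>\<^bsub>G\<^esub> h)) V = restrict (Ad S g) V \<otimes>\<^bsub>BijGroup V\<^esub> restrict (Ad S h) V"
      using V gh by (auto simp: BijGroup_def Bij compose_def Ad_mult intro!: restrict_ext)
  qed (auto intro: group_BijGroup)
  have "Exp S ` k \<subseteq> carrier G" using k by auto
  from h.generate_img[OF this] show ?thesis
    by (simp add: image_image exp_group_def)
qed

lemma inner_group_eq:
  assumes k: "k \<subseteq> ev L"
  shows "inner_group L k = (\<lambda>g. restrict (Ad S g) (space_of L)) ` exp_group k"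
    and "inner_group (even_alg L) k = (\<lambda>g. restrict (Ad S g) (ev L)) ` exp_group k"
proof -
  have "exp_ad L ` k = (\<lambda>X. restrict (Ad S (Exp S X)) (space_of L)) ` k"
    using k by (intro image_cong exp_ad_eq_Ad) auto
  moreover have "restrict (Ad S g) (space_of L) \<in> Bij (space_of L)" if "g \<in> carrier G" for g
    using Ad_aut[OF that] by (simp add: superalg_aut_def)
  ultimately show "inner_group L k = (\<lambda>g. restrict (Ad S g) (space_of L)) ` exp_group k"
    using generate_restrict_Ad[OF k, of "space_of L"] by (simp add: inner_group_def)
next
  have "exp_ad (even_alg L) ` k = (\<lambda>X. restrict (Ad S (Exp S X)) (ev L)) ` k"
    using k by (intro image_cong exp_ad_eq_Ad) auto
  moreover have "restrict (Ad S g) (ev L) \<in> Bij (ev L)" if "g \<in> carrier G" for g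
    using restrict_Ad_aut_even[OF that] by (simp add: superalg_aut_def)
  ultimately show "inner_group (even_alg L) k = (\<lambda>g. restrict (Ad S g) (ev L)) ` exp_group k"
    using generate_restrict_Ad[OF k ev_subset] by (simp add: inner_group_def)
qed

lemma compactly_embedded_iff:
  assumes k: "k \<subseteq> ev L"
  shows "compactly_embedded L k \<longleftrightarrow> (\<forall>Y\<in>space_of L. bounded ((\<lambda>g. Ad S g Y) ` exp_group k))"
proof -
  have "inner_group L k \<subseteq> superalg_aut L"
    unfolding inner_group_eq(1)[OF k] using Ad_aut exp_group_closed[OF k] by auto
  moreover have "(\<lambda>f. f Y) ` inner_group L k = (\<lambda>g. Ad S g Y) ` exp_group k" if "Y \<in> space_of L" for Y
    using that unfolding inner_group_eq(1)[OF k] image_image by simp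
  ultimately show ?thesis
    using compactly_embedded_imp_bounded[of k] bounded_imp_compactly_embedded[of k] by auto
qed

lemma compactly_embedded_even_iff:
  assumes k: "k \<subseteq> ev L"
  shows "compactly_embedded (even_alg L) k \<longleftrightarrow> (\<forall>Y\<in>ev L. bounded ((\<lambda>g. Ad S g Y) ` exp_group k))"
proof -
  interpret E: superalgebra "even_alg L" by (rule superalgebra_even_alg)
  have "inner_group (even_alg L) k \<subseteq> superalg_aut (even_alg L)"
    unfolding inner_group_eq(2)[OF k] using restrict_Ad_aut_even exp_group_closed[OF k] by auto
  moreover have "(\<lambda>f. f Y) ` inner_group (even_alg L) k = (\<lambda>g. Ad S g Y) ` exp_group k" if "Y \<in> ev L" for Y
    using that unfolding inner_group_eq(2)[OF k] image_image by simp
  ultimately show ?thesis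
    using E.compactly_embedded_imp_bounded[of k] E.bounded_imp_compactly_embedded[of k] by auto
qed

end

section \<open>The cone generated by the odd squares\<close>

lemma convex_cone_closure:
  fixes C :: "'v::euclidean_space set"
  assumes "convex_cone C"
  shows "convex_cone (closure C)"
  using assms by (simp add: convex_cone_def convex_closure conic_closure)

context supergroup
begin

definition squares :: "'v set" where
  "squares = {br L X X | X. X \<in> od L}"

lemma squares_subset: "squares \<subseteq> ev L"
  by (auto simp: squares_def)

lemma Ad_squares: "g \<in> carrier G \<Longrightarrow> Ad S g ` squares \<subseteq> squares"
  by (force simp: squares_def Ad_br)

lemma invariant_cone_iff:
  "invariant_cone (even_alg L) C \<longleftrightarrow>
    C \<subseteq> ev L \<and> closed C \<and> convex_cone C \<and> (\<forall>g\<in>exp_group (ev L). Ad S g ` C \<subseteq> C)"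
proof -
  have "restrict (Ad S g) (ev L) ` C = Ad S g ` C" if "C \<subseteq> ev L" for g
    using that by (intro image_cong) auto
  then have "(\<forall>f\<in>inner_group (even_alg L) (ev L). f ` C \<subseteq> C) \<longleftrightarrow> (\<forall>g\<in>exp_group (ev L). Ad S g ` C \<subseteq> C)"
    if "C \<subseteq> ev L"
    unfolding inner_group_eq(2)[OF order_refl] using that by (simp only: ball_simps)
  then show ?thesis
    unfolding invariant_cone_def space_of_even_alg by blast
qed

text \<open>The facts on images of hulls and closures concern linear maps of the ambient space, so
  Ad is replaced by such a map.\<close>

lemma Ad_extension:
  assumes "g \<in> carrier G" "subspace V" "V \<subseteq> space_of L"
  obtains F where "linear F" "\<And>x. x \<in> V \<Longrightarrow> F x = Ad S g x"
proof -
  obtain P where P: "linear P" "\<And>x. P x \<in> V" "\<And>x. x \<in> V \<Longrightarrow> P x = x"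
    using subspace_projection[OF assms(2)] by metis
  have "linear (Ad S g \<circ> P)"
    using lin_on_subset[OF lin_on_Ad assms(3)] assms(1) P(1,2) by (intro lin_on_projection)
  then show thesis using that P(3) by simp
qed

lemma invariant_cone_ev: "invariant_cone (even_alg L) (ev L)"
  unfolding invariant_cone_iff
  using subspace_ev exp_group_closed[OF order_refl]
  by (auto simp: closed_subspace subspace_imp_convex_cone)

lemma invariant_cone_closure_squares: "invariant_cone (even_alg L) (closure (convex_cone hull squares))"
  unfolding invariant_cone_iff
proof (intro conjI ballI)
  have sub: "convex_cone hull squares \<subseteq> ev L"
    using squares_subset subspace_imp_convex_cone[OF subspace_ev] by (rule hull_minimal)
  then show cl: "closure (convex_cone hull squares) \<subseteq> ev L"
    by (rule closure_minimal) (rule closed_subspace[OF subspace_ev])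
  show "convex_cone (closure (convex_cone hull squares))"
    by (intro convex_cone_closure convex_cone_convex_cone_hull)
  fix g assume "g \<in> exp_group (ev L)"
  then have g: "g \<in> carrier G" using exp_group_closed by blast
  obtain F where F: "linear F" "\<And>x. x \<in> ev L \<Longrightarrow> F x = Ad S g x"
    using Ad_extension[OF g subspace_ev ev_subset] by blast
  have "F ` squares \<subseteq> squares"
    using Ad_squares[OF g] F(2) squares_subset by (force simp: image_subset_iff)
  then have "F ` (convex_cone hull squares) \<subseteq> convex_cone hull squares"
    using convex_cone_hull_linear_image[OF F(1), of squares] by (metis hull_mono)
  moreover have "F ` closure (convex_cone hull squares) \<subseteq> closure (F ` (convex_cone hull squares))"
    using F(1) linear_conv_bounded_linear by (intro closure_bounded_linear_image_subset) auto
  ultimately have "F ` closure (convex_cone hull squares) \<subseteq> closure (convex_cone hull squares)"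
    using closure_mono by blast
  then show "Ad S g ` closure (convex_cone hull squares) \<subseteq> closure (convex_cone hull squares)"
    using F(2) cl by (force simp: image_subset_iff)
qed simp

lemma Cone_eq: "Cone L = invariant_cone (even_alg L) hull squares"
  by (simp add: Cone_def squares_def)

lemma Cone_subset: "Cone L \<subseteq> ev L"
  unfolding Cone_eq by (rule hull_minimal) (auto intro: squares_subset[THEN subsetD] invariant_cone_ev)

text \<open>Thanks to this inclusion, a linear inequality on the cone need be checked on squares
  only.\<close>

lemma Cone_subset_closure: "Cone L \<subseteq> closure (convex_cone hull squares)"
  unfolding Cone_eq
  by (rule hull_minimal) (rule order_trans[OF hull_subset closure_subset], rule invariant_cone_closure_squares)

lemma squares_in_Cone: "squares \<subseteq> Cone L"
  unfolding Cone_eq by (rule hull_subset)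

lemma invariant_cone_Cone: "invariant_cone (even_alg L) (Cone L)"
proof -
  define \<C> where "\<C> = {C. invariant_cone (even_alg L) C \<and> squares \<subseteq> C}"
  have "Cone L = \<Inter>\<C>" by (simp add: Cone_eq hull_def \<C>_def)
  moreover have "closed C" "convex_cone C" "g \<in> exp_group (ev L) \<Longrightarrow> Ad S g ` C \<subseteq> C" if "C \<in> \<C>" for C g
    using that by (auto simp: \<C>_def invariant_cone_iff)
  ultimately show ?thesis
    unfolding invariant_cone_iff using Cone_subset
    by (intro conjI ballI) (simp_all add: closed_Inter convex_cone_Inter, blast)
qed

lemma closed_Cone: "closed (Cone L)" and convex_cone_Cone: "convex_cone (Cone L)"
  using invariant_cone_Cone by (auto simp: invariant_cone_iff)

lemma Ad_Cone:
  assumes "k \<subseteq> ev L" "g \<in> exp_group k" "x \<in> Cone L"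
  shows "Ad S g x \<in> Cone L"
proof -
  have "exp_group k \<subseteq> exp_group (ev L)"
    unfolding exp_group_def using assms(1) by (intro G.mono_generate) auto
  then show ?thesis
    using invariant_cone_Cone assms(2,3) unfolding invariant_cone_iff by blast
qed

end

section \<open>Unitary representations\<close>

lemma Ck_on_cong: "Ck_on k E U f \<Longrightarrow> (\<And>x. x \<in> U \<Longrightarrow> f x = g x) \<Longrightarrow> Ck_on k E U g"
proof (induction k arbitrary: f g)
  case 0
  then show ?case using continuous_on_cong by (metis Ck_on.simps(1))
next
  case (Suc k)
  then obtain f' where "\<forall>x\<in>U. (f has_derivative f' x) (at x within U)" "\<forall>v\<in>E. Ck_on k E U (\<lambda>x. f' x v)"
    by auto
  moreover from this(1) have "\<forall>x\<in>U. (g has_derivative f' x) (at x within U)"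
    using Suc.prems(2) has_derivative_transform by metis
  ultimately show ?case by auto
qed

lemma Ck_on_add: "Ck_on k E U f \<Longrightarrow> Ck_on k E U g \<Longrightarrow> Ck_on k E U (\<lambda>x. f x + g x)"
proof (induction k arbitrary: f g)
  case 0
  then show ?case by (simp add: continuous_on_add)
next
  case (Suc k)
  then obtain f' g' where
    "\<forall>x\<in>U. (f has_derivative f' x) (at x within U)" "\<forall>v\<in>E. Ck_on k E U (\<lambda>x. f' x v)"
    "\<forall>x\<in>U. (g has_derivative g' x) (at x within U)" "\<forall>v\<in>E. Ck_on k E U (\<lambda>x. g' x v)"
    by auto
  then show ?case
    using Suc.IH by (auto intro!: exI[of _ "\<lambda>x v. f' x v + g' x v"] has_derivative_add)
qed

lemma Ck_on_bounded_linear: "bounded_linear T \<Longrightarrow> Ck_on k E U f \<Longrightarrow> Ck_on k E U (\<lambda>x. T (f x))"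
proof (induction k arbitrary: f)
  case 0
  then show ?case by (simp add: bounded_linear.continuous_on)
next
  case (Suc k)
  then obtain f' where
    f': "\<forall>x\<in>U. (f has_derivative f' x) (at x within U)" "\<forall>v\<in>E. Ck_on k E U (\<lambda>x. f' x v)"
    by auto
  have "\<forall>x\<in>U. ((\<lambda>x. T (f x)) has_derivative (\<lambda>v. T (f' x v))) (at x within U)"
    using f'(1) bounded_linear.has_derivative[OF Suc.prems(1)] by blast
  moreover have "\<forall>v\<in>E. Ck_on k E U (\<lambda>x. T (f' x v))"
    using f'(2) Suc.IH[OF Suc.prems(1)] by blast
  ultimately show ?case by auto
qed

section \<open>Multiplication by i and the real inner product\<close>

lemma cinner_scaleC_right: "cinner x (a *\<^sub>C y) = cnj a * cinner x y" for x y :: "'h::complex_inner"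
  by (metis cinner_commute cinner_scaleC_left complex_cnj_mult)

lemma inner_i_left: "inner (\<i> *\<^sub>C x) y = - inner x (\<i> *\<^sub>C y)" for x y :: "'h::complex_inner"
  by (simp add: Re_cinner[symmetric] cinner_scaleC_left cinner_scaleC_right)

lemma scaleC_i_i: "\<i> *\<^sub>C \<i> *\<^sub>C x = - x" for x :: "'h::complex_inner"
  using scaleC_of_real[of "-1" x] by (simp add: scaleC_scaleC)

lemma scaleC_uminus_i: "(- \<i>) *\<^sub>C x = - (\<i> *\<^sub>C x)" for x :: "'h::complex_inner"
  using scaleC_of_real[of "-1" "\<i> *\<^sub>C x"] by (simp add: scaleC_scaleC)

lemma bounded_linear_scaleC_i: "bounded_linear (\<lambda>x :: 'h::complex_inner. \<i> *\<^sub>C x)"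
proof (rule bounded_linear_intro[where K = 1])
  fix x y :: 'h and r :: real
  show "\<i> *\<^sub>C (x + y) = \<i> *\<^sub>C x + \<i> *\<^sub>C y" by (rule scaleC_add_right)
  show "\<i> *\<^sub>C (r *\<^sub>R x) = r *\<^sub>R (\<i> *\<^sub>C x)"
    by (metis mult.commute scaleC_of_real scaleC_scaleC)
  have "inner (\<i> *\<^sub>C x) (\<i> *\<^sub>C x) = inner x x"
    by (simp add: inner_i_left scaleC_i_i)
  then show "norm (\<i> *\<^sub>C x) \<le> norm x * 1" by (simp add: norm_eq_sqrt_inner)
qed

lemma scaleC_i_minus: "\<i> *\<^sub>C (- x) = - (\<i> *\<^sub>C x)" for x :: "'h::complex_inner"
  by (rule linear_neg[OF bounded_linear.linear[OF bounded_linear_scaleC_i]])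

locale unitary_representation = supergroup +
  fixes H0 H1 :: "'h::complex_inner set" and \<pi> \<rho>
  assumes rep: "unitary_rep S H0 H1 \<pi> \<rho>"
begin

abbreviation "H \<equiv> H0 + H1"
abbreviation "Hs \<equiv> smooth_vectors (mfd S) H \<pi>"

lemma H_add: "v \<in> H \<Longrightarrow> w \<in> H \<Longrightarrow> v + w \<in> H"
  and H_scaleC: "v \<in> H \<Longrightarrow> a *\<^sub>C v \<in> H"
proof -
  have H01: "csubspace H0" "csubspace H1"
    using rep by (auto simp: unitary_rep_def Let_def)
  show "a *\<^sub>C v \<in> H" if "v \<in> H" for v
    using that H01 by (fastforce simp: csubspace_def set_plus_def scaleC_add_right)
  show "v + w \<in> H" if vw: "v \<in> H" "w \<in> H" for v w
  proof -
    obtain v0 v1 w0 w1 where *: "v0 \<in> H0" "w0 \<in> H0" "v1 \<in> H1" "w1 \<in> H1"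
      and eq: "v = v0 + v1" "w = w0 + w1"
      using vw unfolding set_plus_def by blast
    have "v0 + w0 \<in> H0" "v1 + w1 \<in> H1"
      using H01 * by (auto simp: csubspace_def intro: subspace_add)
    moreover have "v + w = (v0 + w0) + (v1 + w1)" by (simp add: eq)
    ultimately show ?thesis unfolding set_plus_def by blast
  qed
qed

lemma group_rep: "unitary_group_rep G (mfd S) H \<pi>"
  using rep by (simp add: unitary_rep_def Let_def)

lemma \<pi>_closed: "g \<in> carrier G \<Longrightarrow> v \<in> H \<Longrightarrow> \<pi> g v \<in> H"
  using group_rep unfolding unitary_group_rep_def by (meson bij_betwE)

lemma \<pi>_add: "g \<in> carrier G \<Longrightarrow> v \<in> H \<Longrightarrow> w \<in> H \<Longrightarrow> \<pi> g (v + w) = \<pi> g v + \<pi> g w"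
  and \<pi>_scaleC: "g \<in> carrier G \<Longrightarrow> v \<in> H \<Longrightarrow> \<pi> g (a *\<^sub>C v) = a *\<^sub>C \<pi> g v"
  and \<pi>_inner: "g \<in> carrier G \<Longrightarrow> v \<in> H \<Longrightarrow> w \<in> H \<Longrightarrow> inner (\<pi> g v) (\<pi> g w) = inner v w"
  using group_rep by (simp_all add: unitary_group_rep_def clinear_on_def Re_cinner[symmetric])

lemma \<pi>_one:
  assumes "v \<in> H"
  shows "\<pi> \<one>\<^bsub>G\<^esub> v = v"
proof -
  have "\<pi> (\<one>\<^bsub>G\<^esub> \<otimes>\<^bsub>G\<^esub> \<one>\<^bsub>G\<^esub>) v = \<pi> \<one>\<^bsub>G\<^esub> (\<pi> \<one>\<^bsub>G\<^esub> v)"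
    using group_rep assms G.one_closed unfolding unitary_group_rep_def by blast
  then have "\<pi> \<one>\<^bsub>G\<^esub> (\<pi> \<one>\<^bsub>G\<^esub> v) = \<pi> \<one>\<^bsub>G\<^esub> v"
    by simp
  moreover have "inj_on (\<pi> \<one>\<^bsub>G\<^esub>) H"
    using group_rep G.one_closed unfolding unitary_group_rep_def bij_betw_def by blast
  ultimately show ?thesis
    using assms \<pi>_closed[OF G.one_closed assms] by (meson inj_onD)
qed

lemma Hs_H: "v \<in> Hs \<Longrightarrow> v \<in> H"
  by (simp add: smooth_vectors_def)

text \<open>The target has the single chart \<open>id\<close>, and continuity of orbit maps is part
  of a unitary representation; what remains is smoothness in the charts of the group.\<close>

lemma smooth_vector_iff:
  "v \<in> Hs \<longleftrightarrow> v \<in> H \<and> (\<forall>(U, \<phi>) \<in> charts (mfd S).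
      smooth_on (model (mfd S)) (\<phi> ` U) ((\<lambda>g. \<pi> g v) \<circ> inv_into U \<phi>))"
proof (cases "v \<in> H")
  case True
  have top: "topspace (mtop (mfd S)) = carrier G"
    using supergroup by (simp add: lie_supergroup_def lie_group_def)
  have U: "U \<inter> (\<lambda>g. \<pi> g v) -` H = U" if "(U, \<phi>) \<in> charts (mfd S)" for U \<phi>
  proof -
    have "openin (mtop (mfd S)) U"
      using supergroup that by (auto simp: lie_supergroup_def lie_group_def smooth_manifold_def)
    then have "U \<subseteq> carrier G" using openin_subset top by auto
    then show ?thesis using \<pi>_closed True by auto
  qed
  have "continuous_map (mtop (mfd S)) (top_of_set H) (\<lambda>g. \<pi> g v)"
    using group_rep True \<pi>_closed top by (auto simp: unitary_group_rep_def continuous_map_in_subtopology)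
  then show ?thesis
    using U True unfolding smooth_vectors_def smooth_map_def linear_mfd_def
    by (auto simp: split_beta)
qed (simp add: smooth_vectors_def)

lemma chart_point:
  assumes "(U, \<phi>) \<in> charts (mfd S)" "x \<in> \<phi> ` U"
  shows "inv_into U \<phi> x \<in> carrier G"
proof -
  have "openin (mtop (mfd S)) U"
    using supergroup assms(1) by (auto simp: lie_supergroup_def lie_group_def smooth_manifold_def)
  then have "U \<subseteq> carrier G"
    using openin_subset supergroup by (auto simp: lie_supergroup_def lie_group_def)
  then show ?thesis using inv_into_into[OF assms(2)] by auto
qed

lemma Hs_Ck_on:
  "v \<in> Hs \<Longrightarrow> (U, \<phi>) \<in> charts (mfd S) \<Longrightarrow>
    Ck_on k (model (mfd S)) (\<phi> ` U) ((\<lambda>g. \<pi> g v) \<circ> inv_into U \<phi>)"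
  unfolding smooth_vector_iff smooth_on_def by blast

text \<open>Linearity of the space of smooth vectors has to be derived from the charts; polarization
  uses sums and multiples by i.\<close>

lemma Hs_add:
  assumes "v \<in> Hs" "w \<in> Hs"
  shows "v + w \<in> Hs"
  unfolding smooth_vector_iff
proof (intro conjI ballI, safe)
  have H: "v \<in> H" "w \<in> H" using assms Hs_H by auto
  then show "v + w \<in> H" by (rule H_add)
  fix U \<phi> assume c: "(U, \<phi>) \<in> charts (mfd S)"
  show "smooth_on (model (mfd S)) (\<phi> ` U) ((\<lambda>g. \<pi> g (v + w)) \<circ> inv_into U \<phi>)"
    unfolding smooth_on_def
  proof
    fix k
    have "Ck_on k (model (mfd S)) (\<phi> ` U) (\<lambda>x. ((\<lambda>g. \<pi> g v) \<circ> inv_into U \<phi>) x + ((\<lambda>g. \<pi> g w) \<circ> inv_into U \<phi>) x)"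
      by (intro Ck_on_add Hs_Ck_on assms c)
    then show "Ck_on k (model (mfd S)) (\<phi> ` U) ((\<lambda>g. \<pi> g (v + w)) \<circ> inv_into U \<phi>)"
      by (rule Ck_on_cong) (use \<pi>_add H chart_point[OF c] in auto)
  qed
qed

lemma Hs_scaleC_i:
  assumes "v \<in> Hs"
  shows "\<i> *\<^sub>C v \<in> Hs"
  unfolding smooth_vector_iff
proof (intro conjI ballI, safe)
  have H: "v \<in> H" using assms Hs_H by auto
  then show "\<i> *\<^sub>C v \<in> H" by (rule H_scaleC)
  fix U \<phi> assume c: "(U, \<phi>) \<in> charts (mfd S)"
  show "smooth_on (model (mfd S)) (\<phi> ` U) ((\<lambda>g. \<pi> g (\<i> *\<^sub>C v)) \<circ> inv_into U \<phi>)"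
    unfolding smooth_on_def
  proof
    fix k
    have "Ck_on k (model (mfd S)) (\<phi> ` U) (\<lambda>x. \<i> *\<^sub>C ((\<lambda>g. \<pi> g v) \<circ> inv_into U \<phi>) x)"
      by (rule Ck_on_bounded_linear[OF bounded_linear_scaleC_i Hs_Ck_on[OF assms c]])
    then show "Ck_on k (model (mfd S)) (\<phi> ` U) ((\<lambda>g. \<pi> g (\<i> *\<^sub>C v)) \<circ> inv_into U \<phi>)"
      by (rule Ck_on_cong) (use \<pi>_scaleC H chart_point[OF c] in auto)
  qed
qed

lemma \<rho>_closed:
  assumes "X \<in> space_of L" "v \<in> Hs"
  shows "\<rho> X v \<in> Hs"
proof -
  have "\<rho> X ` Hs \<subseteq> Hs" using rep assms(1) by (simp add: unitary_rep_def Let_def)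
  then show ?thesis using assms(2) by blast
qed

lemma \<rho>_clinear: "X \<in> space_of L \<Longrightarrow> clinear_on Hs (\<rho> X)"
  using rep by (simp add: unitary_rep_def Let_def)

lemma \<rho>_add: "X \<in> space_of L \<Longrightarrow> v \<in> Hs \<Longrightarrow> w \<in> Hs \<Longrightarrow> \<rho> X (v + w) = \<rho> X v + \<rho> X w"
  and \<rho>_scaleC: "X \<in> space_of L \<Longrightarrow> v \<in> Hs \<Longrightarrow> \<rho> X (a *\<^sub>C v) = a *\<^sub>C \<rho> X v"
  using \<rho>_clinear by (simp_all add: clinear_on_def)

lemma lin_on_\<rho>: "v \<in> Hs \<Longrightarrow> lin_on (space_of L) (\<lambda>X. \<rho> X v)"
  using rep by (simp add: unitary_rep_def Let_def lin_on_def)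

text \<open>By unitarity the inner product of \<pi>(Exp(tX)) v and \<pi>(Exp(tX)) w is constant in
  t; differentiate it at 0.\<close>

lemma \<rho>_skew:
  assumes X: "X \<in> ev L" and v: "v \<in> Hs" and w: "w \<in> Hs"
  shows "inner (\<rho> X v) w = - inner v (\<rho> X w)"
proof -
  let ?c = "\<lambda>v t. \<pi> (Exp S (t *\<^sub>R X)) v"
  have d: "(?c u has_derivative (\<lambda>t. t *\<^sub>R \<rho> X u)) (at 0)" if "u \<in> Hs" for u
    using rep X that by (simp add: unitary_rep_def Let_def has_vector_derivative_def)
  have "((\<lambda>t. inner (?c v t) (?c w t)) has_derivative
      (\<lambda>t. inner (?c v 0) (t *\<^sub>R \<rho> X w) + inner (t *\<^sub>R \<rho> X v) (?c w 0))) (at 0)"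
    by (rule has_derivative_inner[OF d[OF v] d[OF w]])
  moreover have "(\<lambda>t. inner (?c v t) (?c w t)) = (\<lambda>t. inner v w)"
    using X v w Hs_H by (auto simp: \<pi>_inner)
  ultimately have "((\<lambda>t::real. inner v w) has_derivative
      (\<lambda>t. inner (?c v 0) (t *\<^sub>R \<rho> X w) + inner (t *\<^sub>R \<rho> X v) (?c w 0))) (at 0)"
    by simp
  from has_derivative_unique[OF this has_derivative_const]
  have "inner (?c v 0) (1 *\<^sub>R \<rho> X w) + inner (1 *\<^sub>R \<rho> X v) (?c w 0) = 0"
    by metis
  then show ?thesis using v w Hs_H by (simp add: \<pi>_one)
qed

lemma \<rho>_square:
  assumes X: "X \<in> od L" and v: "v \<in> Hs"
  shows "inner ((- \<i>) *\<^sub>C \<rho> (br L X X) v) v = 2 * (norm (\<rho> X v))\<^sup>2"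
proof -
  have "(- \<i>) *\<^sub>C \<rho> (br L X X) v = \<rho> X (\<rho> X v) + \<rho> X (\<rho> X v)"
    using rep X v by (simp add: unitary_rep_def Let_def)
  moreover have "inner (\<rho> X (\<rho> X v)) v = inner (\<rho> X v) (\<rho> X v)"
    using rep X v \<rho>_closed[of X v] by (simp add: unitary_rep_def Let_def Re_cinner[symmetric])
  ultimately show ?thesis by (simp add: inner_add_left power2_norm_eq_inner)
qed

text \<open>For fixed \<open>v\<close> the form is linear in \<open>Y\<close>, so it is nonnegative
  on a closed convex cone. This cone contains the squares by \<open>\<rho>_square\<close>.\<close>

lemma Cone_nonneg:
  assumes Y: "Y \<in> Cone L" and v: "v \<in> Hs"
  shows "inner ((- \<i>) *\<^sub>C \<rho> Y v) v \<ge> 0"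
proof -
  obtain P where P: "linear P" "\<And>x. P x \<in> ev L" "\<And>x. x \<in> ev L \<Longrightarrow> P x = x"
    using subspace_projection[OF subspace_ev] by metis
  define q where "q Y = inner ((- \<i>) *\<^sub>C \<rho> (P Y) v) v" for Y
  have "linear ((\<lambda>X. \<rho> X v) \<circ> P)"
    using lin_on_subset[OF lin_on_\<rho>[OF v] ev_subset] P(1,2) by (rule lin_on_projection)
  moreover have "linear (\<lambda>u. inner ((- \<i>) *\<^sub>C u) v)"
    by (intro linearI) (simp_all add: scaleC_uminus_i inner_i_left inner_add_left)
  ultimately have q: "linear q"
    unfolding q_def using linear_compose[of "(\<lambda>X. \<rho> X v) \<circ> P" "\<lambda>u. inner ((- \<i>) *\<^sub>C u) v"]
    by (simp add: o_def)
  have "convex_cone {Y. q Y \<ge> 0}"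
    by (auto simp: convex_cone_iff linear_add[OF q] linear_scale[OF q] linear_0[OF q])
  moreover have "squares \<subseteq> {Y. q Y \<ge> 0}"
    using \<rho>_square[OF _ v] P(3) by (auto simp: squares_def q_def)
  ultimately have "convex_cone hull squares \<subseteq> {Y. q Y \<ge> 0}"
    by (intro hull_minimal)
  moreover have "closed {Y. q Y \<ge> 0}"
    by (intro closed_Collect_le continuous_on_const linear_continuous_on)
      (use q linear_conv_bounded_linear in auto)
  ultimately have "closure (convex_cone hull squares) \<subseteq> {Y. q Y \<ge> 0}"
    by (intro closure_minimal)
  then have "q Y \<ge> 0" using Y Cone_subset_closure by blast
  moreover have "P Y = Y" using Y Cone_subset by (intro P(3)) blast
  ultimately show ?thesis by (simp add: q_def)
qed

text \<open>Polarization, with \<open>w = i \<rho>(Y) v\<close>: \<open>\<rho>(Y)\<close> is skew, so \<open>-i \<rho>(Y)\<close> is determined by its quadratic form.\<close>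

lemma \<rho>_eq_0_of_form:
  assumes Y: "Y \<in> ev L" and form: "\<And>v. v \<in> Hs \<Longrightarrow> inner ((- \<i>) *\<^sub>C \<rho> Y v) v = 0" and v: "v \<in> Hs"
  shows "\<rho> Y v = 0"
proof -
  define w where "w = \<i> *\<^sub>C \<rho> Y v"
  have w: "w \<in> Hs" unfolding w_def using Y v by (intro Hs_scaleC_i \<rho>_closed) auto
  have form': "inner (\<rho> Y u) (\<i> *\<^sub>C u) = 0" if "u \<in> Hs" for u
    using form[OF that] by (simp add: scaleC_uminus_i inner_i_left)
  have "inner (\<rho> Y v + \<rho> Y w) (\<i> *\<^sub>C v + \<i> *\<^sub>C w) = 0"
    using form'[OF Hs_add[OF v w]] Y v w by (simp add: \<rho>_add scaleC_add_right)
  then have "inner (\<rho> Y v) (\<i> *\<^sub>C w) + inner (\<rho> Y w) (\<i> *\<^sub>C v) = 0"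
    using form'[OF v] form'[OF w] by (simp add: inner_add_left inner_add_right)
  moreover have "inner (\<rho> Y w) (\<i> *\<^sub>C v) = inner (\<rho> Y v) (\<i> *\<^sub>C w)"
    using \<rho>_skew[OF Y w Hs_scaleC_i[OF v]] Y v by (simp add: \<rho>_scaleC inner_i_left inner_commute)
  \<comment> \<open>Here i w = -\<rho>(Y) v, so this says that the norm of \<rho>(Y) v is 0.\<close>
  ultimately have "inner (\<rho> Y v) (\<i> *\<^sub>C w) = 0" by simp
  then show ?thesis by (simp add: w_def scaleC_i_i)
qed

end

section \<open>What unitary representations imply for the algebra\<close>

locale star_reduced_supergroup = supergroup S
  for S :: "('a, 'e::euclidean_space, 'v::euclidean_space) supergroup" +
  assumes star: "star_reduced S"
begin

lemma faithful_rep: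
  assumes "X \<in> space_of L" "X \<noteq> 0"
  obtains H0 H1 :: "ell2 set" and \<pi> \<rho> v where "unitary_representation S H0 H1 \<pi> \<rho>"
    "v \<in> smooth_vectors (mfd S) (H0 + H1) \<pi>" "\<rho> X v \<noteq> 0"
  using star assms supergroup unfolding star_reduced_def
  by (metis unitary_representation.intro unitary_representation_axioms.intro supergroup_axioms)

lemma pointed_Cone: "pointed (Cone L)"
proof -
  have "Y = 0" if Y: "Y \<in> Cone L" "- Y \<in> Cone L" for Y
  proof (rule ccontr)
    assume "Y \<noteq> 0"
    have ev: "Y \<in> ev L" using Y Cone_subset by auto
    obtain H0 H1 :: "ell2 set" and \<pi> \<rho> v where rep: "unitary_representation S H0 H1 \<pi> \<rho>"
      and v: "v \<in> smooth_vectors (mfd S) (H0 + H1) \<pi>" "\<rho> Y v \<noteq> 0"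
      using faithful_rep[OF ev_in_space[OF ev] \<open>Y \<noteq> 0\<close>] by metis
    interpret R: unitary_representation S H0 H1 \<pi> \<rho> by (rule rep)
    have "\<rho> Y v = 0"
    proof (rule R.\<rho>_eq_0_of_form[OF ev _ v(1)])
      fix u assume u: "u \<in> smooth_vectors (mfd S) (H0 + H1) \<pi>"
      have "\<rho> (- Y) u = - \<rho> Y u"
        using lin_on_scaleR[OF R.lin_on_\<rho>[OF u], of Y "-1"] ev by simp
      then have "(- \<i>) *\<^sub>C \<rho> (- Y) u = - ((- \<i>) *\<^sub>C \<rho> Y u)"
        by (simp add: scaleC_uminus_i scaleC_i_minus)
      then show "inner ((- \<i>) *\<^sub>C \<rho> Y u) u = 0"
        using R.Cone_nonneg[OF Y(1) u] R.Cone_nonneg[OF Y(2) u] by simp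
    qed
    then show False using v(2) by simp
  qed
  moreover have "0 \<in> Cone L" using convex_cone_Cone by (simp add: convex_cone_iff)
  ultimately show ?thesis unfolding pointed_def by force
qed

text \<open>By \<open>\<rho>_square\<close>, [X,X] = 0 would force \<rho>(X) = 0 in every unitary
  representation.\<close>

lemma square_nonzero:
  assumes X: "X \<in> od L" "X \<noteq> 0"
  shows "br L X X \<noteq> 0"
proof
  assume 0: "br L X X = 0"
  obtain H0 H1 :: "ell2 set" and \<pi> \<rho> v where rep: "unitary_representation S H0 H1 \<pi> \<rho>"
    and v: "v \<in> smooth_vectors (mfd S) (H0 + H1) \<pi>" "\<rho> X v \<noteq> 0"
    using faithful_rep[OF od_in_space[OF X(1)] X(2)] by metis
  interpret R: unitary_representation S H0 H1 \<pi> \<rho> by (rule rep)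
  have "\<rho> 0 v = 0"
    using lin_on_scaleR[OF R.lin_on_\<rho>[OF v(1)], of X 0] X by simp
  then have "inner ((- \<i>) *\<^sub>C \<rho> (br L X X) v) v = 0"
    by (simp add: 0 scaleC_uminus_i linear_0[OF bounded_linear.linear[OF bounded_linear_scaleC_i]])
  then show False using R.\<rho>_square[OF X(1) v(1)] v(2) by simp
qed

end

section \<open>Averaging over a bounded group of inner automorphisms\<close>

text \<open>With f* the adjoint, the squared norm of f* y is the inner product of y and f f* y;
  apply Cauchy-Schwarz and cancel. This carries orbit bounds over to functionals.\<close>

lemma adjoint_norm_le:
  fixes f :: "'v::euclidean_space \<Rightarrow> 'v"
  assumes "linear f" "\<And>x. norm (f x) \<le> K * norm x"
  shows "norm (adjoint f y) \<le> K * norm y"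
proof (cases "adjoint f y = 0")
  case True
  have "0 \<le> K * norm y" using assms(2)[of y] norm_ge_zero order_trans by blast
  then show ?thesis by (simp add: True)
next
  case False
  have "norm (adjoint f y) * norm (adjoint f y) = y \<bullet> f (adjoint f y)"
    using adjoint_works[OF assms(1), of "adjoint f y" y]
    by (simp add: inner_commute power2_norm_eq_inner flip: power2_eq_square)
  also have "\<dots> \<le> norm y * norm (f (adjoint f y))" by (rule norm_cauchy_schwarz)
  also have "\<dots> \<le> norm y * (K * norm (adjoint f y))"
    by (intro mult_left_mono assms(2)) simp
  finally have "norm (adjoint f y) * norm (adjoint f y) \<le> (K * norm y) * norm (adjoint f y)"
    by (simp add: ac_simps)
  then show ?thesis using False by simp
qed

lemma adjoint_o:
  fixes f g :: "'v::euclidean_space \<Rightarrow> 'v"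
  assumes "linear f" "linear g"
  shows "adjoint f \<circ> adjoint g = adjoint (g \<circ> f)"
  by (rule adjoint_unique[symmetric]) (use assms in \<open>simp add: adjoint_works inner_commute\<close>)

context supergroup
begin

lemma Ad_fixed:
  assumes "X \<in> ev L" "Y \<in> space_of L" "br L X Y = 0"
  shows "Ad S (Exp S X) Y = Y"
proof -
  have "(br L X ^^ Suc n) Y = 0" for n
    using assms by (induction n) simp_all
  then have "(1 / fact n) *\<^sub>R (br L X ^^ n) Y = 0" if "n \<notin> {..<1}" for n
    using that by (cases n) auto
  from sums_finite[OF _ this]
  have "(\<lambda>n. (1 / fact n) *\<^sub>R (br L X ^^ n) Y) sums Y" by force
  then show ?thesis
    using Ad_Exp_sums[OF assms(1,2)] by (rule sums_unique2[rotated])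
qed

lemma exp_group_fixed:
  assumes k: "subspace k" "k \<subseteq> ev L" and g: "g \<in> exp_group k" and Y: "Y \<in> space_of L"
    and comm: "\<And>X. X \<in> k \<Longrightarrow> br L X Y = 0"
  shows "Ad S g Y = Y"
  using k g
proof (induction rule: exp_group_induct)
  case (Exp X)
  then show ?case using k Y comm by (intro Ad_fixed) auto
qed (use Y in \<open>simp_all add: Ad_mult\<close>)

text \<open>The exponential series stops after the linear term, so the orbit is the line Y + t
  [X,Y], which is bounded only if it is constant.\<close>

lemma br_eq_0_of_square_eq_0:
  assumes X: "X \<in> ev L" and Y: "Y \<in> space_of L" and sq: "br L X (br L X Y) = 0"
    and bdd: "bounded (range (\<lambda>t. Ad S (Exp S (t *\<^sub>R X)) Y))"
  shows "br L X Y = 0"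
proof (rule ccontr)
  assume ne: "br L X Y \<noteq> 0"
  have Ad: "Ad S (Exp S (t *\<^sub>R X)) Y = Y + t *\<^sub>R br L X Y" for t
  proof -
    have 1: "br L (t *\<^sub>R X) Y = t *\<^sub>R br L X Y"
      using X Y by (simp add: br_scaleR_left)
    have 2: "br L (t *\<^sub>R X) (br L (t *\<^sub>R X) Y) = 0"
      using X Y by (simp add: br_scaleR_left br_scaleR_right sq)
    have "(br L (t *\<^sub>R X) ^^ Suc (Suc n)) Y = 0" for n
      using X by (induction n) (simp_all add: 2)
    then have "(1 / fact n) *\<^sub>R (br L (t *\<^sub>R X) ^^ n) Y = 0" if "n \<notin> {0, 1}" for n
      using that by (cases n rule: nat.exhaust; cases "n - 1") auto
    then have "(\<lambda>n. (1 / fact n) *\<^sub>R (br L (t *\<^sub>R X) ^^ n) Y) sums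
        (\<Sum>n\<in>{0, 1}. (1 / fact n) *\<^sub>R (br L (t *\<^sub>R X) ^^ n) Y)"
      by (intro sums_finite) auto
    then have "(\<lambda>n. (1 / fact n) *\<^sub>R (br L (t *\<^sub>R X) ^^ n) Y) sums (Y + t *\<^sub>R br L X Y)"
      by (simp add: 1)
    then show ?thesis
      using Ad_Exp_sums[OF scaleR_ev[OF X] Y] by (rule sums_unique2[rotated])
  qed
  from bdd obtain M where M: "norm (Y + t *\<^sub>R br L X Y) \<le> M" for t
    by (auto simp: bounded_iff Ad)
  \<comment> \<open>Makes the displacement longer than the triangle inequality permits for a curve
    bounded by \<open>M\<close>.\<close>
  define t where "t = (M + norm Y + 1) / norm (br L X Y)"
  have "norm (t *\<^sub>R br L X Y) \<le> M + norm Y"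
    using M[of t] norm_triangle_ineq4[of "Y + t *\<^sub>R br L X Y" Y] by simp
  moreover have "norm (t *\<^sub>R br L X Y) = \<bar>M + norm Y + 1\<bar>"
    using ne by (simp add: t_def)
  ultimately show False by linarith
qed

text \<open>Differentiate the constant f(Ad(Exp(tX)) Y) at 0. Besides real functionals,
  \<open>f\<close> will also be the identity: a fixed vector commutes with \<open>k\<close>.\<close>

lemma br_of_invariant_functional:
  assumes k: "subspace k" "k \<subseteq> ev L" and X: "X \<in> k" and Y: "Y \<in> space_of L"
    and f: "bounded_linear f" and inv: "\<And>g. g \<in> exp_group k \<Longrightarrow> f (Ad S g Y) = f Y"
  shows "f (br L X Y) = 0"
proof -
  have Xev: "X \<in> ev L" using k X by auto
  have "((\<lambda>t. f (Ad S (Exp S (t *\<^sub>R X)) Y)) has_vector_derivative f (br L X Y)) (at 0)"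
    using bounded_linear.has_vector_derivative[OF f Ad_Exp_has_vector_derivative[OF Xev Y, of 0]] Y
    by simp
  moreover have "(\<lambda>t. f (Ad S (Exp S (t *\<^sub>R X)) Y)) = (\<lambda>t. f Y)"
    using k X by (intro ext inv exp_group_Exp) (simp add: subspace_scale)
  ultimately have "((\<lambda>t::real. f Y) has_vector_derivative f (br L X Y)) (at 0)" by simp
  then show ?thesis
    using has_vector_derivative_const vector_derivative_unique_at by blast
qed

section \<open>Fixed vectors and fixed functionals of a bounded group\<close>

context
  fixes k :: "'v set" and P :: "'v \<Rightarrow> 'v" and K :: real
  assumes k: "k \<subseteq> ev L"
    and P: "linear P" "\<And>x. P x \<in> ev L" "\<And>x. x \<in> ev L \<Longrightarrow> P x = x"
    and K: "\<And>g x. g \<in> exp_group k \<Longrightarrow> norm (Ad S g (P x)) \<le> K * norm x"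
begin

text \<open>A semigroup of linear maps of the ambient space whose unit is \<open>P\<close>; on
  \<open>ev L\<close> it is the adjoint action.\<close>

definition AdP :: "'a \<Rightarrow> 'v \<Rightarrow> 'v" where "AdP g = Ad S g \<circ> P"

lemma linear_AdP: "g \<in> exp_group k \<Longrightarrow> linear (AdP g)"
  unfolding AdP_def using lin_on_subset[OF lin_on_Ad ev_subset] exp_group_closed[OF k] P(1,2)
  by (intro lin_on_projection) auto

lemma AdP_mult: "g \<in> exp_group k \<Longrightarrow> h \<in> exp_group k \<Longrightarrow> AdP g \<circ> AdP h = AdP (g \<otimes>\<^bsub>G\<^esub> h)"
  using exp_group_closed[OF k] by (auto simp: AdP_def P Ad_mult)

lemma AdP_norm: "g \<in> exp_group k \<Longrightarrow> norm (AdP g x) \<le> K * norm x"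
  using K by (simp add: AdP_def)

lemma AdP_one: "AdP \<one>\<^bsub>G\<^esub> = P"
  using P by (auto simp: AdP_def)

lemma AdP_inv: "g \<in> exp_group k \<Longrightarrow> AdP g \<circ> AdP (inv\<^bsub>G\<^esub> g) = P" "g \<in> exp_group k \<Longrightarrow> AdP (inv\<^bsub>G\<^esub> g) \<circ> AdP g = P"
  using AdP_mult exp_group_inv[OF k] exp_group_closed[OF k] AdP_one by simp_all

text \<open>The last property holds because z + U is closed, convex and contains the orbit. With U =
  [h, ev L] it will locate the average modulo the brackets.\<close>

lemma average_vector:
  assumes z: "z \<in> ev L"
  obtains z0 where "z0 \<in> ev L" "\<And>g. g \<in> exp_group k \<Longrightarrow> Ad S g z0 = z0"
    "\<And>U. subspace U \<Longrightarrow> (\<And>g. g \<in> exp_group k \<Longrightarrow> Ad S g z - z \<in> U) \<Longrightarrow> z0 - z \<in> U"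
proof -
  let ?T = "AdP ` exp_group k"
  obtain z0 where z0: "z0 \<in> closure (convex hull ((\<lambda>f. f z) ` ?T))" "\<And>f. f \<in> ?T \<Longrightarrow> f z0 = z0"
  proof (rule orbit_hull_fixed_point[where T = ?T and B = K and W = "ev L" and x = z])
    show "?T \<noteq> {}" using exp_group_one by blast
    show "f \<circ> g \<in> ?T" if "f \<in> ?T" "g \<in> ?T" for f g
      using that by (auto simp: AdP_mult exp_group_mult)
    show "norm x \<le> K * norm (f x)" if f: "f \<in> ?T" and x: "x \<in> ev L" for f x
    proof -
      obtain g where g: "g \<in> exp_group k" "f = AdP g" using f by auto
      have "norm (AdP (inv\<^bsub>G\<^esub> g) (AdP g x)) \<le> K * norm (AdP g x)"
        by (rule AdP_norm[OF exp_group_inv[OF k g(1)]])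
      moreover have "AdP (inv\<^bsub>G\<^esub> g) (AdP g x) = x"
        using fun_cong[OF AdP_inv(2)[OF g(1)], of x] x by (simp add: P)
      ultimately show ?thesis using g by simp
    qed
    show "f x \<in> ev L" if "f \<in> ?T" for f x
      using that by (auto simp: AdP_def P exp_group_closed[OF k])
  qed (auto simp: linear_AdP AdP_norm subspace_ev)
  have "AdP \<one>\<^bsub>G\<^esub> z0 = z0" using z0(2) exp_group_one by blast
  then have ev: "z0 \<in> ev L" using P(2) AdP_one by metis
  show thesis
  proof (rule that[OF ev])
    show "Ad S g z0 = z0" if "g \<in> exp_group k" for g
      using z0(2)[of "AdP g"] that ev by (simp add: AdP_def P)
    fix U assume U: "subspace U" "\<And>g. g \<in> exp_group k \<Longrightarrow> Ad S g z - z \<in> U"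
    have "closure (convex hull ((\<lambda>f. f z) ` ?T)) \<subseteq> (+) z ` U"
    proof (intro closure_minimal hull_minimal)
      show "(\<lambda>f. f z) ` ?T \<subseteq> (+) z ` U"
      proof clarify
        fix g assume "g \<in> exp_group k"
        then have "Ad S g z - z \<in> U" by (rule U(2))
        moreover have "AdP g z = z + (Ad S g z - z)" using z by (simp add: AdP_def P)
        ultimately show "AdP g z \<in> (+) z ` U" by (rule rev_image_eqI)
      qed
      show "convex ((+) z ` U)" "closed ((+) z ` U)"
        using U(1) by (auto simp: closed_subspace subspace_imp_convex intro: closed_translation convex_translation)
    qed
    then show "z0 - z \<in> U" using z0(1) by auto
  qed
qed

text \<open>Functionals are represented by vectors, on which the group acts through adjoints; these
  are bounded below on the range of the idempotent \<open>adjoint P\<close>. A lower bound along the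
  orbit defines a closed half-space, so it passes to the average.\<close>

lemma average_functional:
  obtains a where "\<And>g x. g \<in> exp_group k \<Longrightarrow> x \<in> ev L \<Longrightarrow> a \<bullet> Ad S g x = a \<bullet> x"
    "\<And>x c. x \<in> ev L \<Longrightarrow> (\<And>g. g \<in> exp_group k \<Longrightarrow> c \<le> \<alpha> \<bullet> Ad S g x) \<Longrightarrow> c \<le> a \<bullet> x"
proof -
  let ?T = "(\<lambda>g. adjoint (AdP g)) ` exp_group k"
  have linP: "linear (adjoint P)" by (rule adjoint_linear[OF P(1)])
  have PP: "adjoint P \<circ> adjoint P = adjoint P"
    using adjoint_o[OF P(1) P(1)] P by (simp add: o_def)
  have adjoint_AdP: "adjoint P \<circ> adjoint (AdP g) = adjoint (AdP g)" if "g \<in> exp_group k" for g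
    using adjoint_o[OF P(1) linear_AdP[OF that]] P by (simp add: o_def AdP_def)
  obtain a where a: "a \<in> closure (convex hull ((\<lambda>f. f \<alpha>) ` ?T))" "\<And>f. f \<in> ?T \<Longrightarrow> f a = a"
  proof (rule orbit_hull_fixed_point[where T = ?T and B = K and W = "range (adjoint P)" and x = \<alpha>])
    show "?T \<noteq> {}" using exp_group_one by blast
    show "f \<circ> g \<in> ?T" if "f \<in> ?T" "g \<in> ?T" for f g
      using that by (auto simp: adjoint_o linear_AdP AdP_mult exp_group_mult)
    show "subspace (range (adjoint P))"
      using linP by (intro linear_subspace_image) auto
    show "f x \<in> range (adjoint P)" if f: "f \<in> ?T" for f x
    proof -
      obtain g where g: "g \<in> exp_group k" "f = adjoint (AdP g)" using f by auto
      then have "f x = adjoint P (f x)" using fun_cong[OF adjoint_AdP[OF g(1)], of x] by simp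
      then show ?thesis by (rule range_eqI)
    qed
    show "norm x \<le> K * norm (f x)" if f: "f \<in> ?T" and x: "x \<in> range (adjoint P)" for f x
    proof -
      obtain g where g: "g \<in> exp_group k" "f = adjoint (AdP g)" using f by auto
      have gi: "inv\<^bsub>G\<^esub> g \<in> exp_group k" by (rule exp_group_inv[OF k g(1)])
      have "norm (adjoint (AdP (inv\<^bsub>G\<^esub> g)) (f x)) \<le> K * norm (f x)"
        by (intro adjoint_norm_le linear_AdP AdP_norm gi)
      moreover have "adjoint (AdP (inv\<^bsub>G\<^esub> g)) \<circ> adjoint (AdP g) = adjoint P"
        using adjoint_o[OF linear_AdP[OF gi] linear_AdP[OF g(1)]] AdP_inv(1)[OF g(1)] by simp
      then have "adjoint (AdP (inv\<^bsub>G\<^esub> g)) (f x) = adjoint P x"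
        using g(2) by (metis comp_apply)
      moreover obtain u where "x = adjoint P u" using x by blast
      then have "adjoint P x = x" using fun_cong[OF PP, of u] by simp
      ultimately show ?thesis by simp
    qed
  qed (auto simp: linear_AdP AdP_norm adjoint_linear intro!: adjoint_norm_le)
  show thesis
  proof (rule that)
    fix g x assume g: "g \<in> exp_group k" and x: "x \<in> ev L"
    have "adjoint (AdP g) a = a" using a(2) g by blast
    then have "a \<bullet> x = AdP g x \<bullet> a"
      using adjoint_works[OF linear_AdP[OF g], of x a] by (simp add: inner_commute)
    then show "a \<bullet> Ad S g x = a \<bullet> x" using x by (simp add: AdP_def P inner_commute)
  next
    fix x c assume x: "x \<in> ev L" and c: "\<And>g. g \<in> exp_group k \<Longrightarrow> c \<le> \<alpha> \<bullet> Ad S g x"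
    have "closure (convex hull ((\<lambda>f. f \<alpha>) ` ?T)) \<subseteq> {b. x \<bullet> b \<ge> c}"
    proof (intro closure_minimal hull_minimal convex_halfspace_ge closed_halfspace_ge)
      show "(\<lambda>f. f \<alpha>) ` ?T \<subseteq> {b. x \<bullet> b \<ge> c}"
      proof clarify
        fix g assume g: "g \<in> exp_group k"
        have "x \<bullet> adjoint (AdP g) \<alpha> = \<alpha> \<bullet> Ad S g x"
          using adjoint_works[OF linear_AdP[OF g], of x \<alpha>] x by (simp add: AdP_def P inner_commute)
        then show "c \<le> x \<bullet> adjoint (AdP g) \<alpha>" using c[OF g] by simp
      qed
    qed
    then show "c \<le> a \<bullet> x" using a(1) by (auto simp: inner_commute)
  qed
qed

end

definition bounded_on_ev :: "'v set \<Rightarrow> bool" where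
  "bounded_on_ev k \<longleftrightarrow> (\<forall>Y\<in>ev L. bounded ((\<lambda>g. Ad S g Y) ` exp_group k))"

lemma bounded_on_evE:
  assumes k: "k \<subseteq> ev L" and bdd: "bounded_on_ev k"
  obtains B where "B > 0" "\<And>g Y. g \<in> exp_group k \<Longrightarrow> Y \<in> ev L \<Longrightarrow> norm (Ad S g Y) \<le> B * norm Y"
proof -
  have "lin_on (ev L) f" if "f \<in> Ad S ` exp_group k" for f
    using that lin_on_subset[OF lin_on_Ad ev_subset] exp_group_closed[OF k] by auto
  moreover have "bounded ((\<lambda>f. f Y) ` Ad S ` exp_group k)" if "Y \<in> ev L" for Y
    using bdd that by (simp add: bounded_on_ev_def image_image)
  ultimately obtain B where "B > 0" "\<And>f Y. f \<in> Ad S ` exp_group k \<Longrightarrow> Y \<in> ev L \<Longrightarrow> norm (f Y) \<le> B * norm Y"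
    using pointwise_bounded_imp_uniformly_bounded[OF subspace_ev, of "Ad S ` exp_group k"] by metis
  then show thesis using that by blast
qed

lemma bounded_projectionE:
  assumes k: "k \<subseteq> ev L" and bdd: "bounded_on_ev k"
  obtains P K where "linear P" "\<And>x. P x \<in> ev L" "\<And>x. x \<in> ev L \<Longrightarrow> P x = x"
    "\<And>g x. g \<in> exp_group k \<Longrightarrow> norm (Ad S g (P x)) \<le> K * norm x"
proof -
  obtain P where P: "linear P" "\<And>x. P x \<in> ev L" "\<And>x. x \<in> ev L \<Longrightarrow> P x = x"
    using subspace_projection[OF subspace_ev] by metis
  obtain B where B: "B > 0" "\<And>g Y. g \<in> exp_group k \<Longrightarrow> Y \<in> ev L \<Longrightarrow> norm (Ad S g Y) \<le> B * norm Y"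
    using bounded_on_evE[OF assms] by metis
  obtain C where C: "\<And>x. norm (P x) \<le> C * norm x"
    using linear_bounded[OF P(1)] by blast
  have "norm (Ad S g (P x)) \<le> B * C * norm x" if "g \<in> exp_group k" for g x
  proof -
    have "norm (Ad S g (P x)) \<le> B * norm (P x)" using that P(2) by (rule B(2))
    also have "\<dots> \<le> B * (C * norm x)" using B(1) C by (intro mult_left_mono) auto
    finally show ?thesis by simp
  qed
  then show thesis using that P by blast
qed

lemma invariant_vector:
  assumes k: "k \<subseteq> ev L" and bdd: "bounded_on_ev k" and z: "z \<in> ev L"
  obtains z0 where "z0 \<in> ev L" "\<And>g. g \<in> exp_group k \<Longrightarrow> Ad S g z0 = z0"
    "\<And>U. subspace U \<Longrightarrow> (\<And>g. g \<in> exp_group k \<Longrightarrow> Ad S g z - z \<in> U) \<Longrightarrow> z0 - z \<in> U"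
proof -
  obtain P K where P: "linear P" "\<And>x. P x \<in> ev L" "\<And>x. x \<in> ev L \<Longrightarrow> P x = x"
    "\<And>g x. g \<in> exp_group k \<Longrightarrow> norm (Ad S g (P x)) \<le> K * norm x"
    using bounded_projectionE[OF k bdd] by metis
  show thesis by (rule average_vector[OF k P z]) (assumption+, (rule that; blast))
qed

lemma invariant_functional:
  assumes k: "k \<subseteq> ev L" and bdd: "bounded_on_ev k"
  obtains a where "\<And>g x. g \<in> exp_group k \<Longrightarrow> x \<in> ev L \<Longrightarrow> a \<bullet> Ad S g x = a \<bullet> x"
    "\<And>x c. x \<in> ev L \<Longrightarrow> (\<And>g. g \<in> exp_group k \<Longrightarrow> c \<le> \<alpha> \<bullet> Ad S g x) \<Longrightarrow> c \<le> a \<bullet> x"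
proof -
  obtain P K where P: "linear P" "\<And>x. P x \<in> ev L" "\<And>x. x \<in> ev L \<Longrightarrow> P x = x"
    "\<And>g x. g \<in> exp_group k \<Longrightarrow> norm (Ad S g (P x)) \<le> K * norm x"
    using bounded_projectionE[OF k bdd] by metis
  show thesis by (rule average_functional[OF k P, where \<alpha> = \<alpha>]) (assumption+, (rule that; blast))
qed

end

section \<open>The interior of the dual cone\<close>

context supergroup
begin

lemma restrict_inner_dual_space: "subspace W \<Longrightarrow> restrict (\<lambda>x. a \<bullet> x) W \<in> dual_space W"
  by (auto simp: dual_space_def inner_add_right subspace_add subspace_scale)

text \<open>The margin \<open>e\<close> absorbs perturbations: if the deviations of m at the
  finitely many vectors \<open>P b\<close> sum to less than \<open>e\<close>, then m differs from a
  at x by at most e times the norm of x. This condition on m is open for pointwise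
  convergence.\<close>

lemma Int_Cone_dualI:
  assumes e: "e > 0" "\<And>x. x \<in> Cone L \<Longrightarrow> e * norm x \<le> a \<bullet> x"
  shows "restrict (\<lambda>x. a \<bullet> x) (ev L) \<in> Int_Cone_dual L"
proof -
  let ?X = "dual_topology (ev L)"
  let ?l = "restrict (\<lambda>x. a \<bullet> x) (ev L)"
  obtain P where P: "linear P" "\<And>x. P x \<in> ev L" "\<And>x. x \<in> ev L \<Longrightarrow> P x = x"
    using subspace_projection[OF subspace_ev] by metis
  have top: "topspace ?X = dual_space (ev L)"
    by (auto simp: dual_topology_def dual_space_def PiE_def)
  define d where "d m = (\<Sum>b\<in>Basis. \<bar>m (P b) - a \<bullet> P b\<bar>)" for m
  have ev: "continuous_map ?X euclideanreal (\<lambda>m. m (P b))" for b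
    unfolding dual_topology_def
    by (intro continuous_map_from_subtopology continuous_map_product_projection P)
  have "continuous_map ?X euclideanreal d"
    unfolding d_def by (intro continuous_intros ev) auto
  then have "openin ?X {m \<in> topspace ?X. d m \<in> {..<e}}"
    by (rule openin_continuous_map_preimage) simp
  moreover have "?l \<in> {m \<in> topspace ?X. d m \<in> {..<e}}"
    using e(1) P(2) restrict_inner_dual_space[OF subspace_ev] by (simp add: top d_def)
  moreover have "{m \<in> topspace ?X. d m \<in> {..<e}} \<subseteq> dual_cone (ev L) (Cone L)"
  proof
    fix m assume "m \<in> {m \<in> topspace ?X. d m \<in> {..<e}}"
    then have m: "m \<in> dual_space (ev L)" and dm: "d m < e" by (auto simp: top)
    have "0 \<le> m x" if x: "x \<in> Cone L" for x
    proof -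
      have xev: "x \<in> ev L" using x Cone_subset by blast
      have "lin_on (ev L) (\<lambda>y. m y - a \<bullet> y)"
        using m by (simp add: lin_on_def dual_space_def inner_add_right right_diff_distrib)
      then have lin: "linear ((\<lambda>y. m y - a \<bullet> y) \<circ> P)"
        using P(1,2) by (rule lin_on_projection)
      have "m x - a \<bullet> x = ((\<lambda>y. m y - a \<bullet> y) \<circ> P) (\<Sum>b\<in>Basis. (x \<bullet> b) *\<^sub>R b)"
        by (simp add: euclidean_representation P(3)[OF xev])
      also have "\<dots> = (\<Sum>b\<in>Basis. (x \<bullet> b) * (m (P b) - a \<bullet> P b))"
        by (simp only: linear_sum[OF lin] linear_scale[OF lin]) simp
      finally have "\<bar>m x - a \<bullet> x\<bar> \<le> (\<Sum>b\<in>Basis. \<bar>(x \<bullet> b) * (m (P b) - a \<bullet> P b)\<bar>)"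
        by (simp only: sum_abs)
      also have "\<dots> \<le> (\<Sum>b\<in>Basis. norm x * \<bar>m (P b) - a \<bullet> P b\<bar>)"
        by (intro sum_mono) (simp add: abs_mult mult_right_mono Basis_le_norm)
      also have "\<dots> = norm x * d m" by (simp add: d_def sum_distrib_left)
      also have "\<dots> \<le> norm x * e" using dm by (intro mult_left_mono) auto
      finally show ?thesis using e(2)[OF x] by (simp add: mult.commute abs_le_iff)
    qed
    then show "m \<in> dual_cone (ev L) (Cone L)" using m by (simp add: dual_cone_def)
  qed
  ultimately show ?thesis
    unfolding Int_Cone_dual_def interior_of_def by blast
qed

end

context star_reduced_supergroup
begin

text \<open>An interior functional can be moved a little against a strictly positive functional
  \<open>a\<close> without leaving the dual cone, so it dominates a positive multiple of
  \<open>a\<close> on the cone.\<close>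

lemma Int_Cone_dualD:
  assumes l: "l \<in> Int_Cone_dual L"
  shows "l \<in> dual_space (ev L)" and "x \<in> Cone L \<Longrightarrow> x \<noteq> 0 \<Longrightarrow> 0 < l x"
proof -
  let ?X = "dual_topology (ev L)"
  obtain T where T: "openin ?X T" "l \<in> T" "T \<subseteq> dual_cone (ev L) (Cone L)"
    using l by (auto simp: Int_Cone_dual_def interior_of_def)
  then show ld: "l \<in> dual_space (ev L)" by (auto simp: dual_cone_def)
  assume x: "x \<in> Cone L" "x \<noteq> 0"
  obtain a e where e: "e > 0" "\<And>x. x \<in> Cone L \<Longrightarrow> e * norm x \<le> a \<bullet> x"
    using pointed_cone_positive_functional[OF closed_Cone convex_cone_Cone pointed_Cone] by metis
  define c where "c t = (\<lambda>y\<in>ev L. l y - t * (a \<bullet> y))" for t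
  have cd: "c t \<in> dual_space (ev L)" for t
    using ld subspace_ev
    by (auto simp: c_def dual_space_def subspace_add subspace_scale algebra_simps)
  have "continuous_map euclideanreal ?X c"
    unfolding dual_topology_def continuous_map_in_subtopology continuous_map_componentwise
  proof (intro conjI ballI)
    show "c \<in> topspace euclideanreal \<rightarrow> dual_space (ev L)" using cd by auto
    show "c ` topspace euclideanreal \<subseteq> extensional (ev L)" by (auto simp: c_def)
    show "continuous_map euclideanreal euclideanreal (\<lambda>t. c t y)" if "y \<in> ev L" for y
      using that by (auto simp: c_def intro!: continuous_intros)
  qed
  then have "open {t. c t \<in> T}"
    using T(1) by (auto simp: continuous_map_def)
  moreover have "c 0 = l"
    using ld by (auto simp: c_def dual_space_def intro: extensionalityI)
  ultimately obtain d where d: "d > 0" "\<And>t. \<bar>t\<bar> < d \<Longrightarrow> c t \<in> T"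
    using T(2) unfolding open_contains_ball by (auto simp: subset_iff dist_real_def)
  have "c (d/2) \<in> dual_cone (ev L) (Cone L)" using d T(3) by auto
  then have "0 \<le> c (d/2) x"
    using x(1) by (simp add: dual_cone_def)
  moreover have "x \<in> ev L" using x(1) Cone_subset by blast
  ultimately have "0 \<le> l x - (d/2) * (a \<bullet> x)"
    by (simp add: c_def)
  moreover have "0 < e * norm x" using e(1) x(2) by simp
  then have "0 < (d/2) * (a \<bullet> x)" using e(2)[OF x(1)] d(1) by simp
  ultimately show "0 < l x" by linarith
qed

lemma square_in_Cone: "X \<in> od L \<Longrightarrow> br L X X \<in> Cone L"
  using squares_in_Cone by (auto simp: squares_def)

lemma Omega_positive_definite:
  assumes l: "l \<in> Int_Cone_dual L"
  shows "symmetric_bilinear_form_on (od L) (Omega L l)" "positive_definite_on (od L) (Omega L l)"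
proof -
  have lin: "l (x + y) = l x + l y" "l (c *\<^sub>R x) = c * l x" if "x \<in> ev L" "y \<in> ev L" for x y c
    using Int_Cone_dualD(1)[OF l] that by (auto simp: dual_space_def)
  show "symmetric_bilinear_form_on (od L) (Omega L l)"
    unfolding symmetric_bilinear_form_on_def Omega_def
  proof (intro ballI allI conjI)
    fix x y z c assume *: "x \<in> od L" "y \<in> od L" "z \<in> od L"
    show "l (br L x y) = l (br L y x)" using br_od_comm[OF *(1,2)] by simp
    show "l (br L (x + y) z) = l (br L x z) + l (br L y z)"
      using * by (simp add: br_add_left lin)
    show "l (br L (c *\<^sub>R x) z) = c * l (br L x z)"
      using * lin(2)[of "br L x z" "br L x z"] by (simp add: br_scaleR_left)
  qed
  show "positive_definite_on (od L) (Omega L l)"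
    unfolding positive_definite_on_def Omega_def
    using Int_Cone_dualD(2)[OF l] square_in_Cone square_nonzero by blast
qed

section \<open>Compactly embedded subalgebras of the even part\<close>

text \<open>Averaging could destroy strict positivity. The bound \<open>B\<close> for inverses
  prevents this: Ad(g) x has norm at least |x| / B, so the margin along the whole orbit is e /
  B.\<close>

lemma invariant_positive_functional:
  assumes k: "k \<subseteq> ev L" and bdd: "bounded_on_ev k"
  obtains a e where "e > 0" "\<And>x. x \<in> Cone L \<Longrightarrow> e * norm x \<le> a \<bullet> x"
    "\<And>g x. g \<in> exp_group k \<Longrightarrow> x \<in> ev L \<Longrightarrow> a \<bullet> Ad S g x = a \<bullet> x"
proof -
  obtain \<alpha> e where e: "e > 0" "\<And>x. x \<in> Cone L \<Longrightarrow> e * norm x \<le> \<alpha> \<bullet> x"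
    using pointed_cone_positive_functional[OF closed_Cone convex_cone_Cone pointed_Cone] by metis
  obtain B where B: "B > 0" "\<And>g Y. g \<in> exp_group k \<Longrightarrow> Y \<in> ev L \<Longrightarrow> norm (Ad S g Y) \<le> B * norm Y"
    using bounded_on_evE[OF k bdd] by metis
  obtain a where a: "\<And>g x. g \<in> exp_group k \<Longrightarrow> x \<in> ev L \<Longrightarrow> a \<bullet> Ad S g x = a \<bullet> x"
    "\<And>x c. x \<in> ev L \<Longrightarrow> (\<And>g. g \<in> exp_group k \<Longrightarrow> c \<le> \<alpha> \<bullet> Ad S g x) \<Longrightarrow> c \<le> a \<bullet> x"
    using invariant_functional[OF k bdd, where \<alpha> = \<alpha>] by blast
  show thesis
  proof (rule that[of "e / B" a])
    show "e / B > 0" using e(1) B(1) by simp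
    fix x assume x: "x \<in> Cone L"
    then have xev: "x \<in> ev L" using Cone_subset by blast
    show "e / B * norm x \<le> a \<bullet> x"
    proof (rule a(2)[OF xev])
      fix g assume g: "g \<in> exp_group k"
      have gc: "g \<in> carrier G" by (rule exp_group_closed[OF k g])
      have "norm x \<le> B * norm (Ad S g x)"
        using B(2)[OF exp_group_inv[OF k g], of "Ad S g x"] gc xev by simp
      then have "e / B * norm x \<le> e * norm (Ad S g x)"
        using B(1) e(1) by (simp add: field_simps)
      also have "\<dots> \<le> \<alpha> \<bullet> Ad S g x" by (rule e(2)[OF Ad_Cone[OF k g x]])
      finally show "e / B * norm x \<le> \<alpha> \<bullet> Ad S g x" .
    qed
  qed (rule a(1))
qed

text \<open>The constant is the minimum of a continuous positive function on the unit sphere of the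
  odd part; homogeneity of degree two does the rest. If the odd part is 0, the sphere is empty and 1
  will do.\<close>

lemma square_norm_lower_bound:
  obtains c where "c > 0" "\<And>X. X \<in> od L \<Longrightarrow> c * (norm X)\<^sup>2 \<le> norm (br L X X)"
proof -
  obtain P where P: "linear P" "\<And>x. P x \<in> od L" "\<And>x. x \<in> od L \<Longrightarrow> P x = x"
    using subspace_projection[OF subspace_od] by metis
  have "bilinear (\<lambda>x y. br L (P x) (P y))"
    using P(2) unfolding bilinear_def
    by (auto intro!: linearI simp: linear_add[OF P(1)] linear_scale[OF P(1)] br_add_left
        br_add_right br_scaleR_left br_scaleR_right)
  then have "bounded_bilinear (\<lambda>x y. br L (P x) (P y))"
    by (simp add: bilinear_conv_bounded_bilinear)
  then have cont: "continuous_on (od L \<inter> sphere 0 1) (\<lambda>x. norm (br L (P x) (P x)))"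
    by (intro continuous_on_norm bounded_bilinear.continuous_on[where prod = "\<lambda>x y. br L (P x) (P y)"] continuous_on_id)
  have cpt: "compact (od L \<inter> sphere 0 1)"
    by (rule closed_Int_compact[OF closed_subspace[OF subspace_od] compact_sphere])
  have normalize: "(1 / norm X) *\<^sub>R X \<in> od L \<inter> sphere 0 1" if "X \<in> od L" "X \<noteq> 0" for X
    using that subspace_scale[OF subspace_od] by simp
  show thesis
  proof (cases "od L \<inter> sphere 0 1 = {}")
    case True
    then have "X = 0" if "X \<in> od L" for X using normalize[OF that] by blast
    then show thesis using that[of 1] by fastforce
  next
    case False
    then obtain Z where Z: "Z \<in> od L \<inter> sphere 0 1"
      "\<And>Y. Y \<in> od L \<inter> sphere 0 1 \<Longrightarrow> norm (br L (P Z) (P Z)) \<le> norm (br L (P Y) (P Y))"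
      using continuous_attains_inf[OF cpt _ cont] by blast
    show thesis
    proof (rule that)
      have "Z \<in> od L" "Z \<noteq> 0" using Z(1) by auto
      then show "norm (br L Z Z) > 0" using square_nonzero by simp
      fix X assume X: "X \<in> od L"
      show "norm (br L Z Z) * (norm X)\<^sup>2 \<le> norm (br L X X)"
      proof (cases "X = 0")
        case True
        then show ?thesis by simp
      next
        case False
        have "norm (br L Z Z) \<le> norm (br L ((1 / norm X) *\<^sub>R X) ((1 / norm X) *\<^sub>R X))"
          using Z(2)[OF normalize[OF X False]] Z(1) P(3) normalize[OF X False] by simp
        also have "\<dots> = norm (br L X X) / (norm X)\<^sup>2"
          using X subspace_scale[OF subspace_od X]
          by (simp add: br_scaleR_left br_scaleR_right power2_eq_square)
        finally show ?thesis using False by (simp add: field_simps)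
      qed
    qed
  qed
qed

text \<open>An invariant functional in the interior of the dual cone makes \<open>\<Omega>\<close> an invariant inner product on the odd part.\<close>

lemma compactly_embedded_if_even:
  assumes k: "k \<subseteq> ev L" and cpt: "compactly_embedded (even_alg L) k"
  shows "compactly_embedded L k"
  unfolding compactly_embedded_iff[OF k]
proof
  fix Y assume "Y \<in> space_of L"
  then obtain Y0 Y1 where Y: "Y = Y0 + Y1" "Y0 \<in> ev L" "Y1 \<in> od L" by (rule space_ofE)
  have bdd: "bounded_on_ev k"
    using cpt unfolding compactly_embedded_even_iff[OF k] bounded_on_ev_def .
  obtain a e where a: "e > 0" "\<And>x. x \<in> Cone L \<Longrightarrow> e * norm x \<le> a \<bullet> x"
    "\<And>g x. g \<in> exp_group k \<Longrightarrow> x \<in> ev L \<Longrightarrow> a \<bullet> Ad S g x = a \<bullet> x"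
    using invariant_positive_functional[OF k bdd] by metis
  obtain c where c: "c > 0" "\<And>X. X \<in> od L \<Longrightarrow> c * (norm X)\<^sup>2 \<le> norm (br L X X)"
    using square_norm_lower_bound by metis
  obtain M where M: "\<And>g. g \<in> exp_group k \<Longrightarrow> norm (Ad S g Y0) \<le> M"
    using bdd Y(2) unfolding bounded_on_ev_def bounded_iff by blast
  \<comment> \<open>The second summand comes from e c |Ad(g) Y1|^2 \<le> a([Ad(g) Y1, Ad(g) Y1]) =
    a([Y1,Y1]).\<close>
  have "norm (Ad S g Y) \<le> M + sqrt ((a \<bullet> br L Y1 Y1) / (e * c))" if g: "g \<in> exp_group k" for g
  proof -
    have gc: "g \<in> carrier G" by (rule exp_group_closed[OF k g])
    have "e * (c * (norm (Ad S g Y1))\<^sup>2) \<le> e * norm (br L (Ad S g Y1) (Ad S g Y1))"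
      using a(1) c(2)[of "Ad S g Y1"] gc Y(3) by (intro mult_left_mono) auto
    also have "\<dots> \<le> a \<bullet> br L (Ad S g Y1) (Ad S g Y1)"
      using gc Y(3) by (intro a(2) square_in_Cone) auto
    also have "\<dots> = a \<bullet> br L Y1 Y1"
      using a(3)[OF g, of "br L Y1 Y1"] gc Y(3) by (simp add: Ad_br)
    finally have "(norm (Ad S g Y1))\<^sup>2 \<le> (a \<bullet> br L Y1 Y1) / (e * c)"
      using a(1) c(1) by (simp add: field_simps)
    then have "norm (Ad S g Y1) \<le> sqrt ((a \<bullet> br L Y1 Y1) / (e * c))"
      by (rule real_le_rsqrt)
    moreover have "Ad S g Y = Ad S g Y0 + Ad S g Y1"
      unfolding Y(1) using Y by (intro lin_on_add[OF lin_on_Ad[OF gc]]) auto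
    ultimately show ?thesis
      using M[OF g] norm_triangle_ineq[of "Ad S g Y0" "Ad S g Y1"] by simp
  qed
  then show "bounded ((\<lambda>g. Ad S g Y) ` exp_group k)"
    unfolding bounded_iff by blast
qed

section \<open>Existence of a compactly embedded Cartan subalgebra\<close>

text \<open>If x + z and x - z are the images of x + d y and x - d y, then adding the estimates of
  their norms by a positive functional cancels z on the right, while the norms add up to at least 2
  |z|.\<close>

lemma stabilizer_bounded:
  assumes k: "k \<subseteq> ev L" and x: "x \<in> ev L"
    and int: "\<And>y. y \<in> ev L \<Longrightarrow> \<exists>d>0. x + d *\<^sub>R y \<in> Cone L \<and> x - d *\<^sub>R y \<in> Cone L"
    and fixed: "\<And>g. g \<in> exp_group k \<Longrightarrow> Ad S g x = x"
  shows "bounded_on_ev k"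
  unfolding bounded_on_ev_def
proof
  fix y assume y: "y \<in> ev L"
  obtain d where d: "d > 0" "x + d *\<^sub>R y \<in> Cone L" "x - d *\<^sub>R y \<in> Cone L"
    using int[OF y] by blast
  obtain a e where e: "e > 0" "\<And>x. x \<in> Cone L \<Longrightarrow> e * norm x \<le> a \<bullet> x"
    using pointed_cone_positive_functional[OF closed_Cone convex_cone_Cone pointed_Cone] by metis
  have "norm (Ad S g y) \<le> (a \<bullet> x) / (e * d)" if g: "g \<in> exp_group k" for g
  proof -
    have gc: "g \<in> carrier G" by (rule exp_group_closed[OF k g])
    have lin: "lin_on (ev L) (Ad S g)" using lin_on_Ad[OF gc] ev_subset by (rule lin_on_subset)
    define z where "z = d *\<^sub>R Ad S g y"
    have "Ad S g (x + d *\<^sub>R y) = x + z" "Ad S g (x - d *\<^sub>R y) = x - z"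
      using x y fixed[OF g]
      by (simp_all add: z_def lin_on_add[OF lin] lin_on_diff[OF lin subspace_ev] lin_on_scaleR[OF lin])
    then have "x + z \<in> Cone L" "x - z \<in> Cone L"
      using Ad_Cone[OF k g d(2)] Ad_Cone[OF k g d(3)] by simp_all
    then have "e * norm (x + z) + e * norm (x - z) \<le> 2 * (a \<bullet> x)"
      using e(2)[of "x + z"] e(2)[of "x - z"] by (simp add: inner_add_right inner_diff_right)
    moreover have "2 * norm z \<le> norm (x + z) + norm (x - z)"
      using norm_triangle_ineq4[of "x + z" "x - z"] by (simp add: scaleR_2[symmetric])
    then have "e * (2 * norm z) \<le> e * (norm (x + z) + norm (x - z))"
      using e(1) by (intro mult_left_mono) auto
    ultimately have "e * norm z \<le> a \<bullet> x" by (simp add: algebra_simps)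
    then show ?thesis using e(1) d(1) by (simp add: z_def field_simps)
  qed
  then show "bounded ((\<lambda>g. Ad S g y) ` exp_group k)"
    unfolding bounded_iff by blast
qed

text \<open>Polarization of the symmetric bracket of odd elements.\<close>

lemma span_Cone:
  assumes "ev L = brs L (od L) (od L)"
  shows "span (Cone L) = ev L"
proof
  show "span (Cone L) \<subseteq> ev L"
    by (rule span_minimal[OF Cone_subset subspace_ev])
  have "br L X Y \<in> span (Cone L)" if XY: "X \<in> od L" "Y \<in> od L" for X Y
  proof -
    have XY': "X + Y \<in> od L" using XY subspace_add[OF subspace_od] by blast
    have "br L (X + Y) (X + Y) = br L X X + br L Y Y + 2 *\<^sub>R br L X Y"
      using XY XY' br_od_comm[OF XY] by (simp add: br_add_left br_add_right scaleR_2)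
    then have "br L X Y = (1/2) *\<^sub>R (br L (X + Y) (X + Y) - br L X X - br L Y Y)"
      by simp
    moreover have "br L Z Z \<in> span (Cone L)" if "Z \<in> od L" for Z
      using square_in_Cone[OF that] by (rule span_base)
    ultimately show ?thesis
      using XY XY' by (metis span_diff span_scale)
  qed
  then show "ev L \<subseteq> span (Cone L)"
    unfolding assms brs_def by (intro span_minimal) auto
qed

definition centralizer :: "'v \<Rightarrow> 'v set" where
  "centralizer x = {z \<in> ev L. br L x z = 0}"

lemma subspace_centralizer: "x \<in> ev L \<Longrightarrow> subspace (centralizer x)"
  unfolding centralizer_def using subspace_ev
  by (auto simp: subspace_def br_add_right br_scaleR_right)

text \<open>
  For \<open>x\<close> in the interior of the cone with smallest centralizer \<open>h\<close>, the elements \<open>x + t y\<close>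
  with \<open>y\<close> in \<open>h\<close> and small \<open>t\<close> have the same centralizer, so \<open>h\<close> is abelian.
\<close>

lemma exists_compactly_embedded_cartan:
  assumes gen: "ev L = brs L (od L) (od L)"
  shows "\<exists>h. cartan_subalgebra (even_alg L) h \<and> compactly_embedded L h"
proof -
  define R where "R = rel_interior (Cone L)"
  have Cone0: "0 \<in> Cone L" using convex_cone_Cone by (simp add: convex_cone_iff)
  have convex: "convex (Cone L)" using convex_cone_Cone by (simp add: convex_cone_def)
  \<comment> \<open>As 0 lies in the cone, the affine hull is the span; the relative interior is
    thus the interior in \<open>ev L\<close>.\<close>
  have aff: "affine hull (Cone L) = ev L"
    using affine_hull_span_0[of "Cone L"] hull_inc[OF Cone0] span_Cone[OF gen] by simp
  have RC: "R \<subseteq> Cone L" unfolding R_def by (rule rel_interior_subset)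
  have Rev: "R \<subseteq> ev L" using RC Cone_subset by blast
  have "R \<noteq> {}"
    unfolding R_def using rel_interior_eq_empty[OF convex] Cone0 by blast
  have near: "\<exists>d>0. \<forall>t. \<bar>t\<bar> < d \<longrightarrow> x + t *\<^sub>R y \<in> R" if xy: "x \<in> R" "y \<in> ev L" for x y
  proof -
    have "openin (top_of_set (ev L)) R"
      using openin_rel_interior[of "Cone L"] aff by (simp add: R_def)
    then obtain r where r: "r > 0" "ball x r \<inter> ev L \<subseteq> R"
      using xy(1) unfolding openin_contains_ball by blast
    have "x + t *\<^sub>R y \<in> R" if t: "\<bar>t\<bar> < r / (1 + norm y)" for t
    proof -
      have "\<bar>t\<bar> * norm y \<le> \<bar>t\<bar> * (1 + norm y)" by (simp add: mult_left_mono)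
      also have "\<dots> < r" using t by (simp add: pos_less_divide_eq add_pos_nonneg)
      finally have "x + t *\<^sub>R y \<in> ball x r" by (simp add: dist_norm)
      moreover have "x + t *\<^sub>R y \<in> ev L"
        using xy Rev by (auto intro: subspace_add[OF subspace_ev])
      ultimately show ?thesis using r(2) by blast
    qed
    moreover have "r / (1 + norm y) > 0" using r(1) by (simp add: add_pos_nonneg)
    ultimately show ?thesis by blast
  qed
  obtain x where x: "x \<in> R" and min: "\<And>y. y \<in> R \<Longrightarrow> dim (centralizer x) \<le> dim (centralizer y)"
    using ex_has_least_nat[of "\<lambda>x. x \<in> R" _ "\<lambda>x. dim (centralizer x)"] \<open>R \<noteq> {}\<close> by blast
  define h where "h = centralizer x"
  have xev: "x \<in> ev L" using x Rev by blast
  have h: "subspace h" "h \<subseteq> ev L"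
    using subspace_centralizer[OF xev] by (auto simp: h_def centralizer_def)
  have xh: "x \<in> h" using xev by (simp add: h_def centralizer_def br_self)
  have comm: "br L y x = 0" if "y \<in> h" for y
    using that br_anticomm[OF _ xev, of y] by (simp add: h_def centralizer_def)
  have bdd: "bounded_on_ev h"
  proof (rule stabilizer_bounded[OF h(2) xev])
    show "Ad S g x = x" if "g \<in> exp_group h" for g
      using that xev comm by (intro exp_group_fixed[OF h]) auto
    show "\<exists>d>0. x + d *\<^sub>R y \<in> Cone L \<and> x - d *\<^sub>R y \<in> Cone L" if y: "y \<in> ev L" for y
    proof -
      obtain d where d: "d > 0" "\<And>t. \<bar>t\<bar> < d \<Longrightarrow> x + t *\<^sub>R y \<in> R" using near[OF x y] by blast
      have "x + (d/2) *\<^sub>R y \<in> Cone L" "x - (d/2) *\<^sub>R y \<in> Cone L"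
        using d(1) d(2)[of "d/2"] d(2)[of "- (d/2)"] RC by auto
      then show ?thesis using d(1) by (intro exI[of _ "d/2"]) simp
    qed
  qed
  have ker2: "br L x z = 0" if z: "z \<in> ev L" and "br L x (br L x z) = 0" for z
  proof (rule br_eq_0_of_square_eq_0[OF xev _ that(2)])
    have "bounded ((\<lambda>g. Ad S g z) ` exp_group h)" using bdd z by (simp add: bounded_on_ev_def)
    moreover have "range (\<lambda>t. Ad S (Exp S (t *\<^sub>R x)) z) \<subseteq> (\<lambda>g. Ad S g z) ` exp_group h"
      using exp_group_Exp subspace_scale[OF h(1) xh] by blast
    ultimately show "bounded (range (\<lambda>t. Ad S (Exp S (t *\<^sub>R x)) z))" by (rule bounded_subset)
  qed (use z in simp)
  obtain P where P: "linear P" "\<And>x. P x \<in> ev L" "\<And>x. x \<in> ev L \<Longrightarrow> P x = x"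
    using subspace_projection[OF subspace_ev] by metis
  have linP: "linear (br L y \<circ> P)" if "y \<in> ev L" for y
    by (rule lin_on_projection[OF lin_on_subset[OF lin_on_br[OF ev_in_space[OF that]] ev_subset] P(1,2)])
  define m where "m = (br L x \<circ> P) ` UNIV"
  have m: "subspace m" unfolding m_def using linP[OF xev] by (intro linear_subspace_image) auto
  have mev: "w \<in> ev L" if "w \<in> m" for w
    using that P(2) xev by (auto simp: m_def)
  \<comment> \<open>By \<open>ker2\<close>, ad x is injective on its own image, hence bounded below
    there. This is the bound that survives a small perturbation of x.\<close>
  have "\<exists>c>0. \<forall>w\<in>m. c * norm w \<le> norm ((br L x \<circ> P) w)"
  proof (rule injective_imp_isometric[OF closed_subspace[OF m] m])
    show "bounded_linear (br L x \<circ> P)" using linP[OF xev] linear_conv_bounded_linear by blast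
    show "\<forall>w\<in>m. (br L x \<circ> P) w = 0 \<longrightarrow> w = 0"
    proof (intro ballI impI)
      fix w assume w: "w \<in> m" "(br L x \<circ> P) w = 0"
      then obtain u where u: "w = br L x (P u)" by (auto simp: m_def)
      have "br L x (br L x (P u)) = 0" using w(2) P(3)[OF mev[OF w(1)]] u by simp
      then show "w = 0" using ker2[OF P(2)] u by simp
    qed
  qed
  then obtain c where c: "c > 0" "\<And>w. w \<in> m \<Longrightarrow> c * norm w \<le> norm (br L x w)"
    using P(3) mev by auto
  have abelian: "br L y y' = 0" if y: "y \<in> h" "y' \<in> h" for y y'
  proof -
    have yev: "y \<in> ev L" "y' \<in> ev L" using y h(2) by auto
    obtain M where M: "M > 0" "\<And>w. norm ((br L y \<circ> P) w) \<le> M * norm w"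
      using linear_bounded_pos[OF linP[OF yev(1)]] by blast
    obtain d where d: "d > 0" "\<And>t. \<bar>t\<bar> < d \<Longrightarrow> x + t *\<^sub>R y \<in> R" using near[OF x yev(1)] by blast
    \<comment> \<open>The first bound keeps x + t y in \<open>R\<close>; the second makes t ad y
      smaller than the lower bound \<open>c\<close> of ad x on \<open>m\<close>.\<close>
    define t where "t = min (d/2) (c / (2 * M))"
    have t: "t > 0" "t < d" "t * M < c"
    proof -
      show "t > 0" "t < d" using d(1) c(1) M(1) by (auto simp: t_def)
      have "t * M \<le> c / (2 * M) * M" using M(1) by (intro mult_right_mono) (auto simp: t_def)
      also have "\<dots> < c" using M(1) c(1) by simp
      finally show "t * M < c" .
    qed
    define x' where "x' = x + t *\<^sub>R y"
    have x'R: "x' \<in> R" using d(2)[of t] t by (simp add: x'_def)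
    then have x'ev: "x' \<in> ev L" using Rev by blast
    have br_x': "br L x' z = br L x z + t *\<^sub>R br L y z" if "z \<in> ev L" for z
      using that xev yev by (simp add: x'_def br_add_left br_scaleR_left)
    have x'x: "br L x' x = 0"
      using br_x'[OF xev] comm[OF y(1)] br_self[OF xev] by simp
    have "centralizer x' \<subseteq> h"
    proof
      fix z assume "z \<in> centralizer x'"
      then have z: "z \<in> ev L" "br L x' z = 0" by (auto simp: centralizer_def)
      define w where "w = br L x z"
      have w: "w \<in> m" unfolding m_def w_def using P(3)[OF z(1)] by (intro image_eqI[of _ _ z]) auto
      \<comment> \<open>Since [x',x] = 0, ad x' commutes with ad x and kills w. On \<open>m\<close>
        the perturbation is too small to cancel ad x, so w = 0.\<close>
      have "br L x' w = br L (br L x' x) z + br L x (br L x' z)"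
        unfolding w_def using x'ev xev z(1) by (intro br_jacobi) auto
      then have "br L x' w = 0"
        using x'x z xev br_scaleR_left[of 0 z 0] subspace_0[OF subspace_ev] by simp
      then have "br L x w = - (t *\<^sub>R br L y w)"
        using br_x'[OF mev[OF w]] by (simp add: eq_neg_iff_add_eq_0)
      then have "c * norm w \<le> t * norm (br L y w)"
        using c(2)[OF w] t(1) by simp
      also have "\<dots> \<le> t * (M * norm w)"
        using M(2)[of w] P(3)[OF mev[OF w]] t(1) by (intro mult_left_mono) auto
      finally have "(c - t * M) * norm w \<le> 0" by (simp add: algebra_simps)
      then have "w = 0" using t(3) by (simp add: mult_le_0_iff)
      then show "z \<in> h" using z(1) by (simp add: h_def centralizer_def w_def)
    qed
    \<comment> \<open>Minimality of the dimension turns the inclusion into equality, so h commutes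
      with x' as well as with x, hence with y.\<close>
    then have "centralizer x' = h"
      using subspace_dim_equal[OF subspace_centralizer[OF x'ev] h(1)] min[OF x'R] by (simp add: h_def)
    then have "br L x' y' = 0" using y(2) by (auto simp: centralizer_def)
    moreover have "br L x y' = 0" using y(2) by (simp add: h_def centralizer_def)
    ultimately show ?thesis using br_x'[OF yev(2)] t(1) by simp
  qed
  have "cartan_subalgebra (even_alg L) h"
    unfolding cartan_subalgebra_def space_of_even_alg even_alg_sel
  proof (intro conjI)
    have h0: "0 \<in> h" by (rule subspace_0[OF h(1)])
    show "lie_subalgebra (even_alg L) h"
      using h abelian h0 by (simp add: lie_subalgebra_def)
    have "{br L y z |y z. y \<in> h \<and> z \<in> h} = {0}"
      using abelian h0 by force
    then have "lower_central (even_alg L) h 1 = {0}"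
      by (simp add: brs_def)
    then show "\<exists>n. lower_central (even_alg L) h n = {0}" by blast
    show "{z \<in> ev L. \<forall>y\<in>h. br L z y \<in> h} = h"
    proof
      show "h \<subseteq> {z \<in> ev L. \<forall>y\<in>h. br L z y \<in> h}" using h(2) abelian h0 by auto
      show "{z \<in> ev L. \<forall>y\<in>h. br L z y \<in> h} \<subseteq> h"
      proof clarify
        fix z assume z: "z \<in> ev L" "\<forall>y\<in>h. br L z y \<in> h"
        \<comment> \<open>A normalizing z satisfies [x,[x,z]] = 0, and \<open>ker2\<close> puts it
          into the centralizer.\<close>
        have "br L x z \<in> h"
          using z(2) xh br_anticomm[OF xev z(1)] subspace_neg[OF h(1)] by auto
        then have "br L x (br L x z) = 0" by (simp add: h_def centralizer_def)
        then show "z \<in> h" using ker2[OF z(1)] z(1) by (simp add: h_def centralizer_def)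
      qed
    qed
  qed
  moreover have "compactly_embedded L h"
    using bdd by (intro compactly_embedded_if_even h(2))
      (simp add: compactly_embedded_even_iff[OF h(2)] bounded_on_ev_def)
  ultimately show ?thesis by blast
qed

section \<open>Functionals supported on a compactly embedded Cartan subalgebra\<close>

text \<open>\<open>projection\<close> is a definite description, so the decomposition has to be
  proved first: existence by averaging vectors, uniqueness by averaging functionals.\<close>

lemma Int_Cone_dual_meets_cartan_dual:
  assumes cartan: "cartan_subalgebra (even_alg L) h" and cpt: "compactly_embedded L h"
  shows "Int_Cone_dual L \<inter> dual_map (ev L) (projection h (brs L h (ev L))) ` dual_space h \<noteq> {}"
proof -
  have h: "subspace h" "h \<subseteq> ev L" and h_br: "\<And>x y. x \<in> h \<Longrightarrow> y \<in> h \<Longrightarrow> br L x y \<in> h"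
    and norm: "\<And>z. z \<in> ev L \<Longrightarrow> (\<And>y. y \<in> h \<Longrightarrow> br L z y \<in> h) \<Longrightarrow> z \<in> h"
    using cartan by (auto simp: cartan_subalgebra_def lie_subalgebra_def)
  obtain n where n: "lower_central (even_alg L) h n = {0}"
    using cartan by (auto simp: cartan_subalgebra_def)
  have h0: "0 \<in> h" by (rule subspace_0[OF h(1)])
  have bdd: "bounded_on_ev h"
    using cpt by (simp add: compactly_embedded_iff[OF h(2)] bounded_on_ev_def)
  have ker2: "br L y z = 0" if y: "y \<in> h" and z: "z \<in> ev L" and sq: "br L y (br L y z) = 0" for y z
  proof (rule br_eq_0_of_square_eq_0[OF _ _ sq])
    have "bounded ((\<lambda>g. Ad S g z) ` exp_group h)" using bdd z by (simp add: bounded_on_ev_def)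
    moreover have "range (\<lambda>t. Ad S (Exp S (t *\<^sub>R y)) z) \<subseteq> (\<lambda>g. Ad S g z) ` exp_group h"
      using exp_group_Exp subspace_scale[OF h(1) y] by blast
    ultimately show "bounded (range (\<lambda>t. Ad S (Exp S (t *\<^sub>R y)) z))" by (rule bounded_subset)
  qed (use y z h(2) in auto)
  \<comment> \<open>Nilpotency kills a power of ad y on \<open>h\<close>, and \<open>ker2\<close>
    lowers the exponent to one.\<close>
  have abelian: "br L y z = 0" if y: "y \<in> h" and z: "z \<in> h" for y z
  proof -
    have pow_h: "(br L y ^^ j) z \<in> h" for j
      by (induction j) (use y z h_br in auto)
    have reduce: "(br L y ^^ Suc j) z = 0 \<Longrightarrow> br L y z = 0" for j
    proof (induction j)
      case (Suc j)
      have "br L y ((br L y ^^ j) z) = 0"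
      proof (rule ker2[OF y])
        show "(br L y ^^ j) z \<in> ev L" using pow_h[of j] h(2) by blast
        show "br L y (br L y ((br L y ^^ j) z)) = 0" using Suc.prems by simp
      qed
      then show ?case using Suc.IH by simp
    qed simp
    have "(br L y ^^ j) z \<in> lower_central (even_alg L) h j" for j
    proof (induction j)
      case (Suc j)
      then show ?case using y by (auto simp: brs_def intro!: span_base)
    qed (use z in simp)
    then have "(br L y ^^ n) z = 0" using n by auto
    \<comment> \<open>One more factor, since \<open>reduce\<close> starts at exponent one and
      \<open>n\<close> may be 0.\<close>
    then have "(br L y ^^ Suc n) z = 0" using y h(2) by auto
    then show ?thesis by (rule reduce)
  qed
  \<comment> \<open>What commutes with \<open>h\<close> normalizes it, and \<open>h\<close> is its
    own normalizer.\<close>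
  have centralizer_h: "z \<in> h" if z: "z \<in> ev L" and "\<And>y. y \<in> h \<Longrightarrow> br L y z = 0" for z
  proof (rule norm[OF z])
    fix y assume "y \<in> h"
    then show "br L z y \<in> h"
      using that(2)[of y] br_anticomm[OF z, of y] h(2) h0 by auto
  qed
  define U where "U = brs L h (ev L)"
  have U: "subspace U" by (simp add: U_def brs_def)
  have brU: "br L y z \<in> U" if "y \<in> h" "z \<in> ev L" for y z
    unfolding U_def brs_def using that by (intro span_base) blast
  have Uev: "U \<subseteq> ev L"
    unfolding U_def brs_def using h(2) subspace_ev by (intro span_minimal) auto
  \<comment> \<open>All terms of the exponential series after the zeroth are brackets with y, and
    \<open>U\<close> is closed; products telescope.\<close>
  have moveU: "\<forall>z\<in>ev L. Ad S g z - z \<in> U" if "g \<in> exp_group h" for g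
    using h that
  proof (induction rule: exp_group_induct)
    case one
    then show ?case using subspace_0[OF U] by simp
  next
    case (Exp y)
    show ?case
    proof
      fix z assume z: "z \<in> ev L"
      have yev: "y \<in> ev L" using Exp h(2) by blast
      have pow: "(br L y ^^ j) z \<in> ev L" for j
        by (induction j) (use yev z in auto)
      let ?f = "\<lambda>j. (1 / fact j) *\<^sub>R (br L y ^^ j) z"
      have "?f sums Ad S (Exp S y) z" using yev z by (intro Ad_Exp_sums) auto
      then have "(\<lambda>j. ?f (Suc j)) sums (Ad S (Exp S y) z - ?f 0)"
        by (subst sums_Suc_iff) simp
      then have lim: "(\<lambda>N. \<Sum>j<N. ?f (Suc j)) \<longlonglongrightarrow> Ad S (Exp S y) z - z"
        by (simp add: sums_def)
      have "(\<Sum>j<N. ?f (Suc j)) \<in> U" for N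
        using brU[OF Exp pow] by (intro subspace_sum[OF U] subspace_scale[OF U]) simp
      then show "Ad S (Exp S y) z - z \<in> U"
        using closed_sequentially[OF closed_subspace[OF U] _ lim] by blast
    qed
  next
    case (mult g1 g2)
    show ?case
    proof
      fix z assume z: "z \<in> ev L"
      have "(Ad S g1 (Ad S g2 z) - Ad S g2 z) + (Ad S g2 z - z) \<in> U"
        using mult z by (intro subspace_add[OF U]) auto
      then show "Ad S (g1 \<otimes>\<^bsub>G\<^esub> g2) z - z \<in> U" using mult z by (simp add: Ad_mult)
    qed
  qed
  \<comment> \<open>The average of z is fixed, so it commutes with \<open>h\<close> and lies in it;
    by \<open>moveU\<close> it differs from z by an element of \<open>U\<close>.\<close>
  have decomp: "\<exists>z0\<in>h. z - z0 \<in> U" if z: "z \<in> ev L" for z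
  proof -
    obtain z0 where z0: "z0 \<in> ev L" "\<And>g. g \<in> exp_group h \<Longrightarrow> Ad S g z0 = z0"
      "\<And>U. subspace U \<Longrightarrow> (\<And>g. g \<in> exp_group h \<Longrightarrow> Ad S g z - z \<in> U) \<Longrightarrow> z0 - z \<in> U"
      using invariant_vector[OF h(2) bdd z] by blast
    have "br L y z0 = 0" if "y \<in> h" for y
      using br_of_invariant_functional[OF h that _ bounded_linear_ident] z0(1,2) by simp
    then have "z0 \<in> h" by (rule centralizer_h[OF z0(1)])
    moreover have "z0 - z \<in> U" using moveU z by (intro z0(3)[OF U]) auto
    then have "z - z0 \<in> U" using subspace_neg[OF U] by fastforce
    ultimately show ?thesis by blast
  qed
  have kill: "a \<bullet> u = 0"
    if inv: "\<And>g x. g \<in> exp_group h \<Longrightarrow> x \<in> ev L \<Longrightarrow> a \<bullet> Ad S g x = a \<bullet> x" and u: "u \<in> U" for a u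
  proof -
    have "U \<subseteq> {u. a \<bullet> u = 0}"
      unfolding U_def brs_def
    proof (rule span_minimal)
      show "{br L y z |y z. y \<in> h \<and> z \<in> ev L} \<subseteq> {u. a \<bullet> u = 0}"
        using br_of_invariant_functional[OF h _ _ bounded_linear_inner_right] inv by auto
      show "subspace {u. a \<bullet> u = 0}" by (rule subspace_hyperplane)
    qed
    then show ?thesis using u by blast
  qed
  \<comment> \<open>Average the functional given by w itself. Since \<open>h\<close> is abelian, w
    is fixed, so the average is still at least |w|^2 at w; but invariant functionals vanish on
    \<open>U\<close>.\<close>
  have disjoint: "w = 0" if w: "w \<in> h" "w \<in> U" for w
  proof -
    have wev: "w \<in> ev L" using w h(2) by blast
    obtain a where a: "\<And>g x. g \<in> exp_group h \<Longrightarrow> x \<in> ev L \<Longrightarrow> a \<bullet> Ad S g x = a \<bullet> x"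
      "\<And>x c. x \<in> ev L \<Longrightarrow> (\<And>g. g \<in> exp_group h \<Longrightarrow> c \<le> w \<bullet> Ad S g x) \<Longrightarrow> c \<le> a \<bullet> x"
      using invariant_functional[OF h(2) bdd, where \<alpha> = w] by blast
    have "Ad S g w = w" if "g \<in> exp_group h" for g
      using that wev abelian w(1) by (intro exp_group_fixed[OF h]) auto
    then have "w \<bullet> w \<le> a \<bullet> w" by (intro a(2)[OF wev]) simp
    also have "a \<bullet> w = 0" using a(1) w(2) by (rule kill)
    finally show ?thesis using inner_gt_zero_iff[of w] by linarith
  qed
  define p where "p = projection h U"
  have p: "p z \<in> h \<and> z - p z \<in> U" if z: "z \<in> ev L" for z
    unfolding p_def projection_def
  proof (rule theI')
    obtain z0 where z0: "z0 \<in> h" "z - z0 \<in> U" using decomp[OF z] by blast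
    show "\<exists>!y. y \<in> h \<and> z - y \<in> U"
    proof (rule ex1I[of _ z0])
      fix y assume y: "y \<in> h \<and> z - y \<in> U"
      have "y - z0 \<in> h" using y z0 subspace_diff[OF h(1)] by blast
      moreover have "(z - z0) - (z - y) \<in> U" using y z0 subspace_diff[OF U] by blast
      then have "y - z0 \<in> U" by simp
      ultimately have "y - z0 = 0" by (rule disjoint)
      then show "y = z0" by simp
    qed (use z0 in blast)
  qed
  obtain a e where a: "e > 0" "\<And>x. x \<in> Cone L \<Longrightarrow> e * norm x \<le> a \<bullet> x"
    "\<And>g x. g \<in> exp_group h \<Longrightarrow> x \<in> ev L \<Longrightarrow> a \<bullet> Ad S g x = a \<bullet> x"
    using invariant_positive_functional[OF h(2) bdd] by metis
  have "a \<bullet> z = a \<bullet> p z" if "z \<in> ev L" for z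
    using kill[OF a(3), of "z - p z"] p[OF that] by (simp add: inner_diff_right)
  then have "restrict (\<lambda>x. a \<bullet> x) (ev L) = dual_map (ev L) p (restrict (\<lambda>x. a \<bullet> x) h)"
    unfolding dual_map_def using p by (intro restrict_ext) simp
  moreover have "restrict (\<lambda>x. a \<bullet> x) h \<in> dual_space h"
    using h(1) by (rule restrict_inner_dual_space)
  ultimately show ?thesis
    using Int_Cone_dualI[OF a(1,2)] by (auto simp: p_def U_def)
qed

end

theorem proposition6p1p2:
  fixes S :: "('a, 'e::euclidean_space, 'v::euclidean_space) supergroup"
  assumes "lie_supergroup S" and "star_reduced S"
  shows "pointed (Cone (alg S)) \<and>
    (\<forall>l\<in>Int_Cone_dual (alg S).
       symmetric_bilinear_form_on (od (alg S)) (Omega (alg S) l) \<and>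
       positive_definite_on (od (alg S)) (Omega (alg S) l)) \<and>
    (\<forall>k. lie_subalgebra (even_alg (alg S)) k \<and> compactly_embedded (even_alg (alg S)) k
       \<longrightarrow> compactly_embedded (alg S) k) \<and>
    (ev (alg S) = brs (alg S) (od (alg S)) (od (alg S))
       \<longrightarrow> (\<exists>h. cartan_subalgebra (even_alg (alg S)) h \<and> compactly_embedded (alg S) h)) \<and>
    (\<forall>h. cartan_subalgebra (even_alg (alg S)) h \<and> compactly_embedded (alg S) h
       \<longrightarrow> Int_Cone_dual (alg S) \<inter>
           dual_map (ev (alg S)) (projection h (brs (alg S) h (ev (alg S)))) ` dual_space h \<noteq> {})"
proof -
  interpret star_reduced_supergroup S
    using assms by unfold_locales
  have "k \<subseteq> ev (alg S)" if "lie_subalgebra (even_alg (alg S)) k" for k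
    using that by (simp add: lie_subalgebra_def)
  then show ?thesis
    using pointed_Cone Omega_positive_definite compactly_embedded_if_even
      exists_compactly_embedded_cartan Int_Cone_dual_meets_cartan_dual
    by blast
qed

end
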